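(* Let $m$ be a positive integer, let $1<p$ and let $s$ be a real number. Let $\Omega$ be an open subset of $\mathbb{R}^N$ with non-empty complement. Let $u\in W^{m,p}_0(\Omega,d_{\partial\Omega}^s)$. Then $$\int_\Omega|u|^p\,d_{\partial\Omega}(x)^{-mp+s}\,dx<\infty$$ implies that there exist $u_i\in W^{m,p}_0(\Omega,d_{\partial\Omega}^s)_+$, $i=1,2$, with $u=u_1-u_2$.
   Context: $d_{\partial\Omega}(x)$ is the distance from $x$ to $\partial\Omega$. $W^{m,p}_0(\Omega,d_{\partial\Omega}^s)$ is the completion of $C_0^\infty(\Omega)$ in the norm $\sum_{k=0}^m\|\nabla^kv\|_{L^p(\Omega,d_{\partial\Omega}^s)}$, where $\|g\|_{L^p(\Omega,d_{\partial\Omega}^s)}=(\int_\Omega|g|^pd_{\partial\Omega}(x)^sdx)^{1/p}$ and $\nabla^kv$ is the vector of all weak derivatives of order $k$; the subscript $+$ denotes the cone of nonnegative functions in the space. *)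

theory Defs
  imports "HOL-Analysis.Analysis"
begin

text \<open>
  A partial derivative of order \<open>k\<close> is indexed by a list \<open>is\<close> of \<open>k\<close> coordinate directions; the lists
  of length \<open>k\<close> index the entries of the derivative tensor \<open>\<nabla>\<^sup>k\<close>.
  Functions on \<open>\<Omega>\<close> are represented by total functions whose values outside \<open>\<Omega>\<close> are irrelevant,
  and are identified when they agree almost everywhere on \<open>\<Omega>\<close>.
\<close>

primrec pderivs :: "'n::finite list \<Rightarrow> (real ^ 'n \<Rightarrow> real) \<Rightarrow> real ^ 'n \<Rightarrow> real" where
  "pderivs [] f = f"
| "pderivs (i # is) f = (\<lambda>x. frechet_derivative (pderivs is f) (at x) (axis i 1))"

text \<open>
  Differentiability of all iterated partial derivatives makes each of them continuous, so this is
  \<open>C\<^sup>\<infinity>\<close>.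
\<close>

definition smooth :: "(real ^ 'n::finite \<Rightarrow> real) \<Rightarrow> bool" where
  "smooth f \<longleftrightarrow> (\<forall>is x. pderivs is f differentiable (at x))"

definition test_functions :: "(real ^ 'n::finite) set \<Rightarrow> (real ^ 'n \<Rightarrow> real) set" where
  "test_functions \<Omega> =
     {\<phi>. smooth \<phi> \<and> compact (closure {x. \<phi> x \<noteq> 0}) \<and> closure {x. \<phi> x \<noteq> 0} \<subseteq> \<Omega>}"

definition locally_integrable_on :: "(real ^ 'n::finite \<Rightarrow> real) \<Rightarrow> (real ^ 'n) set \<Rightarrow> bool"
    (infixr "locally'_integrable'_on" 46) where
  "v locally_integrable_on \<Omega> \<longleftrightarrow>
     (\<forall>K. compact K \<and> K \<subseteq> \<Omega> \<longrightarrow> v absolutely_integrable_on K)"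

definition has_weak_deriv ::
    "(real ^ 'n::finite) set \<Rightarrow> 'n list \<Rightarrow> (real ^ 'n \<Rightarrow> real) \<Rightarrow> (real ^ 'n \<Rightarrow> real) \<Rightarrow> bool" where
  "has_weak_deriv \<Omega> is v w \<longleftrightarrow>
     v locally_integrable_on \<Omega> \<and> w locally_integrable_on \<Omega> \<and>
     (\<forall>\<phi>\<in>test_functions \<Omega>.
        (LINT x|lebesgue_on \<Omega>. v x * pderivs is \<phi> x) =
        (-1) ^ length is * (LINT x|lebesgue_on \<Omega>. w x * \<phi> x))"

text \<open>Weak derivatives are unique only up to null sets, hence the choice of a representative.\<close>

definition weak_deriv ::
    "(real ^ 'n::finite) set \<Rightarrow> 'n list \<Rightarrow> (real ^ 'n \<Rightarrow> real) \<Rightarrow> real ^ 'n \<Rightarrow> real" where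
  "weak_deriv \<Omega> is v = (SOME w. has_weak_deriv \<Omega> is v w)"

definition grad_abs ::
    "(real ^ 'n::finite) set \<Rightarrow> nat \<Rightarrow> (real ^ 'n \<Rightarrow> real) \<Rightarrow> real ^ 'n \<Rightarrow> real" where
  "grad_abs \<Omega> k v x = sqrt (\<Sum>is | length is = k. (weak_deriv \<Omega> is v x)\<^sup>2)"

definition bdist :: "(real ^ 'n::finite) set \<Rightarrow> real ^ 'n \<Rightarrow> real" where
  "bdist \<Omega> x = infdist x (frontier \<Omega>)"

definition weighted_Lp :: "(real ^ 'n::finite) set \<Rightarrow> real \<Rightarrow> real \<Rightarrow> (real ^ 'n \<Rightarrow> real) set" where
  "weighted_Lp \<Omega> p s =
     {g. g \<in> borel_measurable (lebesgue_on \<Omega>) \<and>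
         integrable (lebesgue_on \<Omega>) (\<lambda>x. \<bar>g x\<bar> powr p * bdist \<Omega> x powr s)}"

text \<open>The next two norms are meaningful only for functions in \<open>weighted_Lp\<close> and \<open>weighted_Sobolev\<close>.\<close>

definition weighted_Lp_norm ::
    "(real ^ 'n::finite) set \<Rightarrow> real \<Rightarrow> real \<Rightarrow> (real ^ 'n \<Rightarrow> real) \<Rightarrow> real" where
  "weighted_Lp_norm \<Omega> p s g =
     (LINT x|lebesgue_on \<Omega>. \<bar>g x\<bar> powr p * bdist \<Omega> x powr s) powr (1 / p)"

definition Sobolev_norm ::
    "(real ^ 'n::finite) set \<Rightarrow> nat \<Rightarrow> real \<Rightarrow> real \<Rightarrow> (real ^ 'n \<Rightarrow> real) \<Rightarrow> real" where
  "Sobolev_norm \<Omega> m p s v = (\<Sum>k\<le>m. weighted_Lp_norm \<Omega> p s (grad_abs \<Omega> k v))"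

definition weighted_Sobolev ::
    "(real ^ 'n::finite) set \<Rightarrow> nat \<Rightarrow> real \<Rightarrow> real \<Rightarrow> (real ^ 'n \<Rightarrow> real) set" where
  "weighted_Sobolev \<Omega> m p s =
     {v. \<forall>is. length is \<le> m \<longrightarrow>
           (\<exists>w. has_weak_deriv \<Omega> is v w) \<and> weak_deriv \<Omega> is v \<in> weighted_Lp \<Omega> p s}"

text \<open>
  The completion of the test functions, realised as their closure in \<open>weighted_Sobolev\<close>. This is the
  completion because, for \<open>\<Omega>\<close> open and not the whole space, the weight is bounded above and away from
  zero on compact subsets of \<open>\<Omega>\<close>: a Cauchy sequence of test functions converges, with its derivatives
  up to order \<open>m\<close>, in the weighted \<open>L\<^sup>p\<close> space and hence in local \<open>L\<^sup>1\<close>, so its limit has weak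
  derivatives up to order \<open>m\<close>, and the limit function determines them.
\<close>

definition weighted_Sobolev0 ::
    "(real ^ 'n::finite) set \<Rightarrow> nat \<Rightarrow> real \<Rightarrow> real \<Rightarrow> (real ^ 'n \<Rightarrow> real) set" where
  "weighted_Sobolev0 \<Omega> m p s =
     {v \<in> weighted_Sobolev \<Omega> m p s.
        \<exists>\<phi>. (\<forall>j. \<phi> j \<in> test_functions \<Omega>) \<and>
            (\<lambda>j. Sobolev_norm \<Omega> m p s (\<lambda>x. v x - \<phi> j x)) \<longlonglongrightarrow> 0}"

definition weighted_Sobolev0_plus ::
    "(real ^ 'n::finite) set \<Rightarrow> nat \<Rightarrow> real \<Rightarrow> real \<Rightarrow> (real ^ 'n \<Rightarrow> real) set" where
  "weighted_Sobolev0_plus \<Omega> m p s =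
     {v \<in> weighted_Sobolev0 \<Omega> m p s. AE x in lebesgue_on \<Omega>. 0 \<le> v x}"

end

theory Submission
  imports Defs
begin

text \<open>
  It suffices to find a nonnegative \<open>w\<close> in the space with \<open>\<bar>u\<bar> \<le> w\<close>, for then \<open>u = w - (w - u)\<close>. The
  majorant is built without singular integrals. Let \<open>\<rho> = min 1 d\<close> and let \<open>g\<close> dominate
  \<open>\<bar>u\<bar> / \<rho>\<^sup>m\<close> and the derivatives of order \<open>m\<close> of a sequence of test functions approximating \<open>u\<close>; the
  integral condition says that \<open>g\<close> can be chosen in the weighted \<open>L\<^sup>p\<close> space. For an integer \<open>i\<close> let
  \<open>E\<^sub>i\<close> be the union of all balls of radius at most \<open>\<rho> / 20\<close> (at the centre) on which the average of
  \<open>g\<close> exceeds \<open>2\<^sup>i\<close>, let \<open>\<delta>\<^sub>i\<close> be the distance to the complement of \<open>E\<^sub>i\<close>, capped at \<open>1\<close>, and let \<open>w\<close>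
  be a smooth version of \<open>\<Sum>\<^sub>i 2\<^sup>i \<delta>\<^sub>i\<^sup>m\<close>, namely a sum of bumps on Whitney balls of the \<open>E\<^sub>i\<close>.

  The derivatives of \<open>w\<close> of order at most \<open>m\<close> are at most a constant times the sum of \<open>2\<^sup>i\<close> times the
  indicator of \<open>E\<^sub>i\<close>, which is comparable to a local maximal function of \<open>g\<close>; a local maximal theorem
  (here \<open>p > 1\<close> enters, and the weight is harmless because \<open>d\<close> is nearly constant on the balls
  considered) puts them into the weighted \<open>L\<^sup>p\<close> space, and the partial sums are test functions. On the
  other hand, an \<open>m\<close>-th order finite difference along rays, averaged over the ray directions, bounds
  \<open>\<bar>u(x)\<bar>\<close> by \<open>r\<^sup>m\<close> times an average of \<open>\<bar>u\<bar> / \<rho>\<^sup>m\<close> plus the integral over \<open>t\<close> of \<open>t\<^sup>m\<^sup>-\<^sup>1\<close> times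
  the average of \<open>g\<close> over the ball of radius \<open>t\<close> about \<open>x\<close>. An average exceeding \<open>2\<^sup>i\<close> on a ball of
  radius \<open>t\<close> forces \<open>t \<le> \<delta>\<^sub>i(x)\<close>, so integrating level by level gives a multiple of
  \<open>\<Sum>\<^sub>i 2\<^sup>i \<delta>\<^sub>i(x)\<^sup>m\<close>.
\<close>

section \<open>Smooth functions and bumps\<close>

text \<open>For \<open>m \<ge> 2\<close> the positive part of \<open>u\<close> need not have weak
  derivatives of order \<open>m\<close>, hence the search for a majorant. The power \<open>m\<close>
  of the distance is right from two sides: a bump of height \<open>\<delta> ^ m\<close> on a ball of
  size \<open>\<delta>\<close> has derivatives of order \<open>k\<close> of size
  \<open>\<delta> ^ (m - k)\<close>, bounded thanks to the cap, while integrating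
  \<open>t ^ (m - 1)\<close> up to \<open>\<delta>\<close> gives back a multiple of
  \<open>\<delta> ^ m\<close>. Dyadic levels are chosen because the powers \<open>2 ^ i\<close> of
  the levels containing a point add up to at most twice the largest one, so that the sum can be
  raised to the power \<open>p\<close> term by term. Pointwise estimates are made for the
  approximating test functions, where Taylor's formula along rays is available, and pass to
  \<open>u\<close> at points where a fast sequence converges; therefore \<open>g\<close> has to
  serve all approximants at once. A finite difference replaces a Taylor expansion of
  \<open>u\<close> because the latter would bring in derivatives of intermediate order, on which the
  integral condition says nothing directly; the values of \<open>u\<close> at the sample points are
  exactly what it controls.\<close>

lemma pderivs_append: "pderivs (is @ js) f = pderivs is (pderivs js f)"
  by (induction "is") auto

lemma smooth_pderivs:
  assumes "smooth f"
  shows "smooth (pderivs is f)"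
  using assms unfolding smooth_def by (simp flip: pderivs_append)

lemma smooth_differentiable: "smooth f \<Longrightarrow> f differentiable (at x)"
  unfolding smooth_def by (metis pderivs.simps(1))

lemma smooth_continuous_on: "smooth f \<Longrightarrow> continuous_on S f"
  by (meson continuous_at_imp_continuous_on differentiable_imp_continuous_within smooth_differentiable)

lemma smooth_borel_measurable: "smooth f \<Longrightarrow> f \<in> borel_measurable borel"
  by (simp add: borel_measurable_continuous_onI smooth_continuous_on)

text \<open>
  Unlike \<^const>\<open>pderivs\<close>, this strips the innermost derivative first, which makes closure under
  products a plain induction.
\<close>

primrec diff_upto :: "nat \<Rightarrow> (real ^ 'n::finite \<Rightarrow> real) \<Rightarrow> bool" where
  "diff_upto 0 f = True"
| "diff_upto (Suc k) f \<longleftrightarrow> (\<forall>x. f differentiable (at x)) \<and> (\<forall>i. diff_upto k (pderivs [i] f))"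

lemma smooth_iff_diff_upto: "smooth f \<longleftrightarrow> (\<forall>k. diff_upto k f)"
proof
  have "smooth f \<Longrightarrow> diff_upto k f" for k
    by (induction k arbitrary: f) (auto simp: smooth_differentiable intro: smooth_pderivs simp del: pderivs.simps)
  then show "smooth f \<Longrightarrow> \<forall>k. diff_upto k f" by blast
  have *: "\<forall>x. pderivs is f differentiable (at x)" if "diff_upto (Suc (length is)) f" for "is"
    using that
  proof (induction "is" arbitrary: f rule: rev_induct)
    case (snoc i "is")
    then have "diff_upto (Suc (length is)) (pderivs [i] f)" by simp
    from snoc.IH[OF this] show ?case by (simp add: pderivs_append)
  qed auto
  then show "\<forall>k. diff_upto k f \<Longrightarrow> smooth f"
    unfolding smooth_def by blast
qed

lemma pderivs1_eqI:
  assumes "\<And>x. (f has_derivative D x) (at x)"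
  shows "pderivs [i] f = (\<lambda>x. D x (axis i 1))"
  using frechet_derivative_at[OF assms] by (auto simp: fun_eq_iff)

lemma pderivs1_const: "pderivs [i] (\<lambda>x. c) = (\<lambda>x. 0)"
  by (subst pderivs1_eqI[where D="\<lambda>_ _. 0"]) auto

lemma pderivs1_add:
  assumes "\<And>x. f differentiable (at x)" "\<And>x. g differentiable (at x)"
  shows "pderivs [i] (\<lambda>x. f x + g x) = (\<lambda>x. pderivs [i] f x + pderivs [i] g x)"
  using pderivs1_eqI[OF has_derivative_add[OF assms[unfolded frechet_derivative_works]]] by simp

lemma pderivs1_mult:
  assumes "\<And>x. f differentiable (at x)" "\<And>x. g differentiable (at x)"
  shows "pderivs [i] (\<lambda>x. f x * g x) = (\<lambda>x. f x * pderivs [i] g x + pderivs [i] f x * g x)"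
  using pderivs1_eqI[OF has_derivative_mult[OF assms[unfolded frechet_derivative_works]]] by simp

lemma pderivs1_affine:
  assumes "\<And>x. f differentiable (at x)"
  shows "pderivs [i] (\<lambda>x. f (c *\<^sub>R (x - z))) = (\<lambda>x. c * pderivs [i] f (c *\<^sub>R (x - z)))"
proof -
  have d: "((\<lambda>x. f (c *\<^sub>R (x - z))) has_derivative
     (\<lambda>h. frechet_derivative f (at (c *\<^sub>R (x - z))) (c *\<^sub>R h))) (at x)" for x
    by (rule has_derivative_compose[of "\<lambda>x. c *\<^sub>R (x - z)" "\<lambda>h. c *\<^sub>R h" x UNIV f])
       (auto intro!: derivative_eq_intros assms[unfolded frechet_derivative_works])
  have "linear (frechet_derivative f (at y))" for y
    using assms by (simp add: linear_frechet_derivative)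
  then show ?thesis
    by (subst pderivs1_eqI[OF d]) (auto simp: linear_scale)
qed

lemma pderivs1_coord:
  assumes "\<And>t. (h has_real_derivative h' t) (at t)"
  shows "pderivs [i] (\<lambda>x. h (x $ j)) = (\<lambda>x. (if i = j then 1 else 0) * h' (x $ j))"
    and "(\<lambda>x. h (x $ j)) differentiable (at x)"
proof -
  have d: "((\<lambda>x. h (x $ j)) has_derivative (\<lambda>v. v $ j * h' (x $ j))) (at x)" for x
    using has_derivative_compose[OF bounded_linear_imp_has_derivative[OF bounded_linear_vec_nth] assms[unfolded has_field_derivative_def]]
    by (simp add: mult.commute)
  show "pderivs [i] (\<lambda>x. h (x $ j)) = (\<lambda>x. (if i = j then 1 else 0) * h' (x $ j))"
    by (subst pderivs1_eqI[OF d]) (auto simp: axis_def)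
  show "(\<lambda>x. h (x $ j)) differentiable (at x)"
    using d differentiable_def by blast
qed

lemma diff_upto_SucD: "diff_upto (Suc k) f \<Longrightarrow> diff_upto k f"
  by (induction k arbitrary: f) (simp_all del: pderivs.simps)

lemma diff_upto_const: "diff_upto k (\<lambda>x. c)"
  by (induction k arbitrary: c) (simp_all add: pderivs1_const del: pderivs.simps)

lemma diff_upto_add: "diff_upto k f \<Longrightarrow> diff_upto k g \<Longrightarrow> diff_upto k (\<lambda>x. f x + g x)"
  by (induction k arbitrary: f g) (simp_all add: pderivs1_add del: pderivs.simps)

lemma diff_upto_mult: "diff_upto k f \<Longrightarrow> diff_upto k g \<Longrightarrow> diff_upto k (\<lambda>x. f x * g x)"
proof (induction k arbitrary: f g)
  case (Suc k)
  then have "diff_upto k f" "diff_upto k g" using diff_upto_SucD by blast+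
  then show ?case
    using Suc by (simp add: pderivs1_mult diff_upto_add del: pderivs.simps)
qed simp

lemma diff_upto_affine: "diff_upto k f \<Longrightarrow> diff_upto k (\<lambda>x. f (c *\<^sub>R (x - z)))"
proof (induction k arbitrary: f)
  case (Suc k)
  have "(\<lambda>x. f (c *\<^sub>R (x - z))) differentiable (at x)" for x
    using Suc.prems differentiable_chain_at[of "\<lambda>x. c *\<^sub>R (x - z)" x f] by (simp add: o_def del: pderivs.simps)
  then show ?case
    using Suc by (simp add: pderivs1_affine diff_upto_mult diff_upto_const del: pderivs.simps)
qed simp

section \<open>Smooth cutoff functions from \<open>exp (- (1 / t))\<close>\<close>

primrec real_diff_upto :: "nat \<Rightarrow> (real \<Rightarrow> real) \<Rightarrow> bool" where
  "real_diff_upto 0 h = True"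
| "real_diff_upto (Suc k) h \<longleftrightarrow>
     (\<exists>h'. (\<forall>t. (h has_real_derivative h' t) (at t)) \<and> real_diff_upto k h')"

lemma real_diff_upto_add:
  "real_diff_upto k f \<Longrightarrow> real_diff_upto k g \<Longrightarrow> real_diff_upto k (\<lambda>t. f t + g t)"
proof (induction k arbitrary: f g)
  case (Suc k)
  then obtain f' g' where "\<And>t. (f has_real_derivative f' t) (at t)" "real_diff_upto k f'"
     "\<And>t. (g has_real_derivative g' t) (at t)" "real_diff_upto k g'" by auto
  then show ?case using Suc.IH[of f' g'] by (auto intro!: exI[of _ "\<lambda>t. f' t + g' t"] DERIV_add)
qed simp

lemma real_diff_upto_cmult: "real_diff_upto k f \<Longrightarrow> real_diff_upto k (\<lambda>t. c * f t)"
proof (induction k arbitrary: f)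
  case (Suc k)
  then obtain f' where "\<And>t. (f has_real_derivative f' t) (at t)" "real_diff_upto k f'" by auto
  then show ?case using Suc.IH[of f'] by (auto intro!: exI[of _ "\<lambda>t. c * f' t"] DERIV_cmult)
qed simp

lemma real_diff_upto_affine: "real_diff_upto k f \<Longrightarrow> real_diff_upto k (\<lambda>t. f (c * t + d))"
proof (induction k arbitrary: f)
  case (Suc k)
  then obtain f' where f': "\<And>t. (f has_real_derivative f' t) (at t)" "real_diff_upto k f'" by auto
  have "((\<lambda>t. f (c * t + d)) has_real_derivative c * f' (c * t + d)) (at t)" for t
    using DERIV_chain2[where f=f and g="\<lambda>t. c * t + d", OF f'(1)[of "c * t + d"], of c UNIV]
      DERIV_add[OF DERIV_cmult_Id[of c t UNIV] DERIV_const[of d]]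
    by (simp add: mult.commute)
  then show ?case using Suc.IH[of f'] f' real_diff_upto_cmult by (auto intro!: exI[of _ "\<lambda>t. c * f' (c * t + d)"])
qed simp

lemma diff_upto_coord: "real_diff_upto k h \<Longrightarrow> diff_upto k (\<lambda>x. h (x $ j))"
proof (induction k arbitrary: h)
  case (Suc k)
  then obtain h' where h': "\<And>t. (h has_real_derivative h' t) (at t)" "real_diff_upto k h'" by auto
  have "diff_upto k (\<lambda>x. (if i = j then 1 else 0) * h' (x $ j))" for i
    by (intro diff_upto_mult diff_upto_const Suc.IH h')
  then show ?case
    by (simp add: pderivs1_coord[OF h'(1)] del: pderivs.simps)
qed simp

text \<open>The extra factor \<open>(1 / t) ^ n\<close> closes the family under differentiation up
  to linear combinations, so that smoothness of the classical function \<open>flat 0\<close> becomes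
  a single induction.\<close>

definition flat :: "nat \<Rightarrow> real \<Rightarrow> real" where
  "flat n t = (if t > 0 then (1 / t) ^ n * exp (- (1 / t)) else 0)"

lemma flat_tendsto_0: "(flat n \<longlongrightarrow> 0) (at 0)"
proof -
  have "((\<lambda>t. (1 / t) ^ n / exp (1 / t)) \<longlongrightarrow> 0) (at_right (0::real))"
    using filterlim_compose[OF tendsto_power_div_exp_0[of n] filterlim_inverse_at_top_right]
    by (simp add: inverse_eq_divide)
  then have "(flat n \<longlongrightarrow> 0) (at_right 0)"
    by (rule Lim_transform_eventually)
       (auto simp: eventually_at_right_field flat_def exp_minus field_simps intro!: exI[of _ 1])
  moreover have "(flat n \<longlongrightarrow> 0) (at_left 0)"
    by (rule tendsto_eventually) (auto simp: eventually_at_left_field flat_def intro!: exI[of _ "-1"])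
  ultimately show ?thesis by (simp add: filterlim_split_at)
qed

lemma flat_has_derivative:
  "(flat n has_real_derivative (- real n * flat (Suc n) t + flat (Suc (Suc n)) t)) (at t)"
proof (cases t "0::real" rule: linorder_cases)
  case less
  then have "((\<lambda>t. 0) has_real_derivative 0) (at t)" by simp
  then have "(flat n has_real_derivative 0) (at t)"
    using less by (rule_tac has_field_derivative_transform_within_open[where S="{..<0}"]) (auto simp: flat_def)
  then show ?thesis using less by (simp add: flat_def)
next
  case equal
  \<comment> \<open>At the gluing point the difference quotient of \<open>flat n\<close> is
    \<open>flat (Suc n)\<close>, so the limit already computed gives the derivative 0.\<close>
  have "((\<lambda>h. (flat n (0 + h) - flat n 0) / h) \<longlongrightarrow> 0) (at 0)"
    by (rule Lim_transform_eventually[OF flat_tendsto_0[of "Suc n"]])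
       (auto simp: eventually_at_filter flat_def)
  then show ?thesis using equal by (simp add: DERIV_def flat_def)
next
  case greater
  \<comment> \<open>The case split covers \<open>n = 0\<close>, where the truncated
    \<open>n - 1\<close> is harmless because both sides vanish.\<close>
  have *: "n * (1 / t) ^ (n - 1) * (1 / t)^2 = n * (1 / t) ^ Suc n"
    by (cases n) (auto simp: power2_eq_square)
  have "((\<lambda>t. (1 / t) ^ n * exp (- (1 / t))) has_real_derivative
     (- real n * flat (Suc n) t + flat (Suc (Suc n)) t)) (at t)"
    using greater * by (auto intro!: derivative_eq_intros simp: flat_def power2_eq_square algebra_simps)
  then show ?thesis
    using greater by (rule_tac has_field_derivative_transform_within_open[where S="{0<..}"]) (auto simp: flat_def)
qed

lemma real_diff_upto_flat: "real_diff_upto k (flat n)"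
proof (induction k arbitrary: n)
  case (Suc k)
  show ?case
    using flat_has_derivative[of n] real_diff_upto_add[OF real_diff_upto_cmult[OF Suc, of "- real n" "Suc n"] Suc[of "Suc (Suc n)"]]
    by (auto intro!: exI[of _ "\<lambda>t. - real n * flat (Suc n) t + flat (Suc (Suc n)) t"] simp del: of_nat_Suc)
qed simp

section \<open>Closure properties of smooth functions and test functions\<close>

lemma smooth_add: "smooth f \<Longrightarrow> smooth g \<Longrightarrow> smooth (\<lambda>x. f x + g x)"
  by (simp add: smooth_iff_diff_upto diff_upto_add)
lemma smooth_mult: "smooth f \<Longrightarrow> smooth g \<Longrightarrow> smooth (\<lambda>x. f x * g x)"
  by (simp add: smooth_iff_diff_upto diff_upto_mult)
lemma smooth_const: "smooth (\<lambda>x. c)"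
  by (simp add: smooth_iff_diff_upto diff_upto_const)
lemma smooth_affine: "smooth f \<Longrightarrow> smooth (\<lambda>x. f (c *\<^sub>R (x - z)))"
  by (simp add: smooth_iff_diff_upto diff_upto_affine)

lemma smooth_prod:
  assumes "\<And>a. a \<in> A \<Longrightarrow> smooth (f a)"
  shows "smooth (\<lambda>x. \<Prod>a\<in>A. f a x)"
  using assms by (induction A rule: infinite_finite_induct) (auto simp: smooth_const smooth_mult)

lemma pderivs_zero: "pderivs is (\<lambda>x. 0) = (\<lambda>x. 0)"
  by (induction "is") simp_all

lemma pderivs_Cons1: "pderivs (i # is) f = pderivs [i] (pderivs is f)"
  by simp

lemma pderivs_add:
  assumes "smooth f" "smooth g"
  shows "pderivs is (\<lambda>x. f x + g x) = (\<lambda>x. pderivs is f x + pderivs is g x)"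
proof (induction "is")
  case (Cons i "is")
  have "pderivs [i] (\<lambda>x. pderivs is f x + pderivs is g x) = (\<lambda>x. pderivs [i] (pderivs is f) x + pderivs [i] (pderivs is g) x)"
    using assms by (intro pderivs1_add) (auto intro: smooth_differentiable smooth_pderivs)
  then show ?case using Cons by (simp only: pderivs_Cons1[of i "is"])
qed simp

lemma pderivs_cmult:
  assumes "smooth f"
  shows "pderivs is (\<lambda>x. c * f x) = (\<lambda>x. c * pderivs is f x)"
proof (induction "is")
  case (Cons i "is")
  have "pderivs [i] (\<lambda>x. c * pderivs is f x) = (\<lambda>x. c * pderivs [i] (pderivs is f) x + pderivs [i] (\<lambda>x. c) x * pderivs is f x)"
    using assms by (intro pderivs1_mult) (auto intro: smooth_differentiable smooth_pderivs)
  then show ?case using Cons by (simp only: pderivs_Cons1[of i "is"] pderivs1_const) simp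
qed simp

lemma pderivs_affine:
  assumes "smooth f"
  shows "pderivs is (\<lambda>x. f (c *\<^sub>R (x - z))) = (\<lambda>x. c ^ length is * pderivs is f (c *\<^sub>R (x - z)))"
proof (induction "is")
  case (Cons i "is")
  have "pderivs [i] (\<lambda>x. c ^ length is * pderivs is f (c *\<^sub>R (x - z)))
     = (\<lambda>x. c ^ length is * pderivs [i] (\<lambda>x. pderivs is f (c *\<^sub>R (x - z))) x)"
    using assms by (intro pderivs_cmult) (auto intro: smooth_affine smooth_pderivs)
  also have "\<dots> = (\<lambda>x. c ^ length (i # is) * pderivs [i] (pderivs is f) (c *\<^sub>R (x - z)))"
    using assms by (subst pderivs1_affine) (auto intro: smooth_differentiable smooth_pderivs)
  finally show ?case using Cons by (simp only: pderivs_Cons1[of i "is"])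
qed simp

text \<open>The complement of the closed support is open and \<open>f\<close> vanishes on it, so
  each derivative there is locally that of 0. Supports therefore do not grow under
  differentiation.\<close>

lemma pderivs_eq_0_outside:
  assumes "x \<notin> closure {x. f x \<noteq> 0}"
  shows "pderivs is f x = 0"
proof -
  let ?U = "- closure {x. f x \<noteq> 0}"
  have "\<forall>x\<in>?U. pderivs is f x = 0"
  proof (induction "is")
    case Nil
    show ?case using closure_subset[of "{x. f x \<noteq> 0}"] by auto
  next
    case (Cons i "is")
    have "(pderivs is f has_derivative (\<lambda>h. 0)) (at x)" if "x \<in> ?U" for x
    proof -
      have "((\<lambda>_. 0) has_derivative (\<lambda>h. 0)) (at x)" by simp
      then show ?thesis
        by (rule has_derivative_transform_within_open[where s="?U"]) (use Cons that in auto)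
    qed
    then have "frechet_derivative (pderivs is f) (at x) = (\<lambda>h. 0)" if "x \<in> ?U" for x
      using that frechet_derivative_at by metis
    then show ?case by simp
  qed
  then show ?thesis using assms by blast
qed

lemma test_functionsD:
  assumes "\<phi> \<in> test_functions \<Omega>"
  shows "smooth \<phi>" "compact (closure {x. \<phi> x \<noteq> 0})" "closure {x. \<phi> x \<noteq> 0} \<subseteq> \<Omega>"
  using assms by (auto simp: test_functions_def)

lemma test_functionsI:
  assumes "smooth \<phi>" "{x. \<phi> x \<noteq> 0} \<subseteq> K" "compact K" "K \<subseteq> \<Omega>"
  shows "\<phi> \<in> test_functions \<Omega>"
proof -
  have "closure {x. \<phi> x \<noteq> 0} \<subseteq> K"
    using assms by (simp add: closure_minimal compact_imp_closed)
  moreover from this have "compact (closure {x. \<phi> x \<noteq> 0})"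
    using compact_Int_closed[OF assms(3) closed_closure, of "{x. \<phi> x \<noteq> 0}"] by (simp only: inf.absorb2)
  ultimately show ?thesis
    using assms by (auto simp: test_functions_def)
qed

lemma test_functions_zero: "(\<lambda>x. 0) \<in> test_functions \<Omega>"
  by (rule test_functionsI[where K="{}"]) (auto simp: smooth_const)

lemma test_functions_add:
  assumes f: "f \<in> test_functions \<Omega>" and g: "g \<in> test_functions \<Omega>"
  shows "(\<lambda>x. f x + g x) \<in> test_functions \<Omega>"
proof (rule test_functionsI)
  show "smooth (\<lambda>x. f x + g x)"
    using f g by (intro smooth_add test_functionsD(1))
  have "{x. f x + g x \<noteq> 0} \<subseteq> {x. f x \<noteq> 0} \<union> {x. g x \<noteq> 0}"
    by auto
  then show "{x. f x + g x \<noteq> 0} \<subseteq> closure {x. f x \<noteq> 0} \<union> closure {x. g x \<noteq> 0}"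
    using closure_subset[of "{x. f x \<noteq> 0}"] closure_subset[of "{x. g x \<noteq> 0}"] by auto
  show "compact (closure {x. f x \<noteq> 0} \<union> closure {x. g x \<noteq> 0})"
    by (intro compact_Un test_functionsD(2)[OF f] test_functionsD(2)[OF g])
  show "closure {x. f x \<noteq> 0} \<union> closure {x. g x \<noteq> 0} \<subseteq> \<Omega>"
    using test_functionsD(3)[OF f] test_functionsD(3)[OF g] by simp
qed

lemma test_functions_cmult:
  assumes "f \<in> test_functions \<Omega>"
  shows "(\<lambda>x. c * f x) \<in> test_functions \<Omega>"
  using test_functionsD[OF assms(1)] closure_subset[of "{x. f x \<noteq> 0}"]
  by (intro test_functionsI[where K="closure {x. f x \<noteq> 0}"])
     (auto simp: smooth_mult smooth_const)

lemma test_functions_sum: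
  assumes "\<And>a. a \<in> A \<Longrightarrow> f a \<in> test_functions \<Omega>"
  shows "(\<lambda>x. \<Sum>a\<in>A. f a x) \<in> test_functions \<Omega>"
  using assms by (induction A rule: infinite_finite_induct) (auto simp: test_functions_zero test_functions_add)

lemma pderivs_sum:
  assumes "\<And>a. a \<in> A \<Longrightarrow> smooth (f a)"
  shows "pderivs is (\<lambda>x. \<Sum>a\<in>A. f a x) = (\<lambda>x. \<Sum>a\<in>A. pderivs is (f a) x)"
proof -
  have "smooth (\<lambda>x. \<Sum>a\<in>A. f a x) \<and> pderivs is (\<lambda>x. \<Sum>a\<in>A. f a x) = (\<lambda>x. \<Sum>a\<in>A. pderivs is (f a) x)"
    using assms
  proof (induction A rule: infinite_finite_induct)
    case (insert a A)
    then have *: "smooth (f a)" "smooth (\<lambda>x. \<Sum>a\<in>A. f a x)"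
      "pderivs is (\<lambda>x. \<Sum>a\<in>A. f a x) = (\<lambda>x. \<Sum>a\<in>A. pderivs is (f a) x)" by auto
    show ?case
      using smooth_add[OF *(1,2)] pderivs_add[OF *(1,2)] insert(1,2) *(3) by simp
  qed (simp_all add: smooth_const pderivs_zero)
  then show ?thesis by blast
qed

lemma test_functions_pderivs:
  assumes "f \<in> test_functions \<Omega>"
  shows "pderivs is f \<in> test_functions \<Omega>"
  using test_functionsD[OF assms] pderivs_eq_0_outside[of _ f "is"]
  by (intro test_functionsI[where K="closure {x. f x \<noteq> 0}"]) (auto intro: smooth_pderivs)

lemma test_functions_bounded:
  assumes "f \<in> test_functions \<Omega>"
  obtains B where "B > 0" "\<And>x. \<bar>f x\<bar> \<le> B"
proof -
  note f = test_functionsD[OF assms]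
  have "bounded (f ` closure {x. f x \<noteq> 0})"
    using f compact_continuous_image compact_imp_bounded smooth_continuous_on by blast
  then obtain B where B: "B > 0" "\<And>x. x \<in> closure {x. f x \<noteq> 0} \<Longrightarrow> \<bar>f x\<bar> \<le> B"
    by (auto simp: bounded_pos)
  have "\<bar>f x\<bar> \<le> B" for x
    using B closure_subset[of "{x. f x \<noteq> 0}"] by (cases "f x = 0") auto
  with B(1) show ?thesis using that by blast
qed

text \<open>The parameter \<open>c\<close> is a steepness: as \<open>c\<close> grows, the function
  tends boundedly to the indicator of the open box. Large \<open>c\<close> serves to test integrals
  over boxes, and \<open>c = 1\<close> is the model for the Whitney bumps.\<close>

definition box_bump :: "real \<Rightarrow> real ^ 'n::finite \<Rightarrow> real ^ 'n \<Rightarrow> real ^ 'n \<Rightarrow> real" where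
  "box_bump c a b x = (\<Prod>i\<in>UNIV. flat 0 (c * (x $ i - a $ i)) * flat 0 (c * (b $ i - x $ i)))"

lemma smooth_box_bump:
  fixes a b :: "real ^ 'n::finite"
  shows "smooth (box_bump c a b)"
proof -
  have 1: "smooth (\<lambda>x::real^'n. flat 0 (c * (x $ i - a $ i)))" for i
    using diff_upto_coord[OF real_diff_upto_affine[OF real_diff_upto_flat[of _ 0], of _ c "- c * a $ i"], of _ i]
    by (simp add: smooth_iff_diff_upto algebra_simps)
  have 2: "smooth (\<lambda>x::real^'n. flat 0 (c * (b $ i - x $ i)))" for i
    using diff_upto_coord[OF real_diff_upto_affine[OF real_diff_upto_flat[of _ 0], of _ "- c" "c * b $ i"], of _ i]
    by (simp add: smooth_iff_diff_upto algebra_simps)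
  show ?thesis
    unfolding box_bump_def using 1 2 by (intro smooth_prod smooth_mult)
qed

lemma flat0_bounds: "0 \<le> flat 0 t" "flat 0 t \<le> 1"
  by (auto simp: flat_def)

lemma box_bump_nonneg: "0 \<le> box_bump c a b x"
  unfolding box_bump_def by (intro prod_nonneg ballI mult_nonneg_nonneg flat0_bounds)

lemma box_bump_le_1: "box_bump c a b x \<le> 1"
  unfolding box_bump_def by (intro prod_le_1) (auto simp: flat0_bounds mult_le_one)

lemma box_bump_eq_0:
  assumes "c > 0" "x \<notin> box a b"
  shows "box_bump c a b x = 0"
proof -
  obtain i where "\<not> (a $ i < x $ i \<and> x $ i < b $ i)"
    using assms(2) by (auto simp: mem_box_cart)
  then have "flat 0 (c * (x $ i - a $ i)) * flat 0 (c * (b $ i - x $ i)) = 0"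
    using assms(1) by (auto simp: flat_def zero_less_mult_iff)
  then show ?thesis unfolding box_bump_def by (intro prod_zero bexI[of _ i]) auto
qed

lemma box_bump_test_function:
  assumes "c > 0" "cbox a b \<subseteq> \<Omega>"
  shows "box_bump c a b \<in> test_functions \<Omega>"
  using assms box_bump_eq_0[OF assms(1), of _ a b] box_subset_cbox[of a b]
  by (intro test_functionsI[where K="cbox a b"]) (auto simp: smooth_box_bump)

lemma box_bump_tendsto_indicator:
  "(\<lambda>n. box_bump (real (Suc n)) a b x) \<longlonglongrightarrow> indicator (box a b) x"
proof (cases "x \<in> box a b")
  case False
  then show ?thesis by (simp add: box_bump_eq_0)
next
  case True
  have *: "(\<lambda>n. flat 0 (real (Suc n) * t)) \<longlonglongrightarrow> 1" if "t > 0" for t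
  proof -
    have "(\<lambda>n. exp (- ((1 / t) * (1 / real (Suc n))))) \<longlonglongrightarrow> exp (- ((1 / t) * 0))"
      by (intro tendsto_intros lim_1_over_n LIMSEQ_Suc[OF lim_1_over_n])
    then show ?thesis using that by (simp add: flat_def zero_less_mult_iff mult.commute)
  qed
  have "(\<lambda>n. box_bump (real (Suc n)) a b x) \<longlonglongrightarrow> (\<Prod>i\<in>(UNIV::'a set). 1 * 1)"
    unfolding box_bump_def using True by (intro tendsto_prod tendsto_mult *) (auto simp: mem_box_cart)
  then show ?thesis using True by simp
qed

section \<open>Weak derivatives\<close>

lemma test_functions_mono: "\<phi> \<in> test_functions \<Omega> \<Longrightarrow> \<Omega> \<subseteq> \<Omega>' \<Longrightarrow> \<phi> \<in> test_functions \<Omega>'"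
  by (auto simp: test_functions_def)

lemma integrable_lborel_compact_support:
  fixes f :: "'a::euclidean_space \<Rightarrow> real"
  assumes "continuous_on UNIV f" "compact K" "\<And>x. x \<notin> K \<Longrightarrow> f x = 0"
  shows "integrable lborel f"
proof -
  have "integrable lborel (\<lambda>x. indicator K x *\<^sub>R f x)"
    using assms by (intro borel_integrable_compact) (auto intro: continuous_on_subset)
  moreover have "(\<lambda>x. indicator K x *\<^sub>R f x) = f"
    using assms(3) by (auto simp: fun_eq_iff indicator_def)
  ultimately show ?thesis by simp
qed

lemma test_functions_integrable:
  assumes "f \<in> test_functions \<Omega>"
  shows "integrable lborel f"
  using test_functionsD[OF assms] closure_subset[of "{x. f x \<noteq> 0}"]
  by (intro integrable_lborel_compact_support[where K="closure {x. f x \<noteq> 0}"] smooth_continuous_on) auto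

section \<open>Integration by parts\<close>

lemma smooth_has_derivative_line:
  assumes "smooth f"
  shows "((\<lambda>t. f (x + t *\<^sub>R axis i 1)) has_real_derivative pderivs [i] f (x + t *\<^sub>R axis i 1)) (at t)"
proof -
  have "((\<lambda>t. x + t *\<^sub>R axis i 1) has_derivative (\<lambda>h. h *\<^sub>R axis i 1)) (at t)"
    by (auto intro!: derivative_eq_intros)
  from has_derivative_compose[OF this smooth_differentiable[OF assms, unfolded frechet_derivative_works]]
  have "((\<lambda>t. f (x + t *\<^sub>R axis i 1)) has_derivative
    (\<lambda>h. frechet_derivative f (at (x + t *\<^sub>R axis i 1)) (h *\<^sub>R axis i 1))) (at t)" .
  moreover have "linear (frechet_derivative f (at y))" for y
    using assms by (simp add: linear_frechet_derivative smooth_differentiable)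
  ultimately show ?thesis
    by (simp add: has_field_derivative_def linear_scale mult_commute_abs)
qed

text \<open>Translation invariance of Lebesgue measure makes every difference quotient integrate to
  0, and dominated convergence carries this over to the derivative.\<close>

lemma integral_pderiv_eq_0:
  assumes f: "f \<in> test_functions \<Omega>"
  shows "integral\<^sup>L lborel (pderivs [i] f) = 0"
proof -
  note sm = test_functionsD(1)[OF f]
  define e :: "real ^ 'a" where "e = axis i 1"
  define K where "K = closure {x. f x \<noteq> 0}"
  \<comment> \<open>The unit neighbourhood of the support contains the support of every difference
    quotient with step at most 1, and so carries a common integrable bound.\<close>
  define K' where "K' = {x + y | x y. x \<in> K \<and> y \<in> cball 0 1}"
  have K': "compact K'" unfolding K'_def K_def
    using test_functionsD(2)[OF f] by (intro compact_sums) auto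
  have [simp]: "norm e = 1" by (simp add: e_def)
  obtain B where B: "B > 0" "\<And>x. \<bar>pderivs [i] f x\<bar> \<le> B"
    using test_functions_bounded[OF test_functions_pderivs[OF f, of "[i]"]] by metis
  define D where "D n x = (f (x + (1 / real (Suc n)) *\<^sub>R e) - f x) * real (Suc n)" for n x
  have shift: "integrable lborel (\<lambda>x. f (x + c))" "(\<integral>x. f (x + c) \<partial>lborel) = integral\<^sup>L lborel f" for c
  proof -
    have [measurable]: "f \<in> borel_measurable borel" using sm by (rule smooth_borel_measurable)
    have "integrable (distr lborel borel ((+) c)) f"
      using test_functions_integrable[OF f] by (simp add: lborel_distr_plus)
    then show "integrable lborel (\<lambda>x. f (x + c))"
      by (simp add: integrable_distr_eq add.commute)
    have "integral\<^sup>L (distr lborel borel ((+) c)) f = (\<integral>x. f (c + x) \<partial>lborel)"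
      by (intro integral_distr) auto
    then show "(\<integral>x. f (x + c) \<partial>lborel) = integral\<^sup>L lborel f"
      by (simp add: lborel_distr_plus add.commute)
  qed
  have D0: "integral\<^sup>L lborel (D n) = 0" for n
    unfolding D_def using shift test_functions_integrable[OF f] by (simp add: Bochner_Integration.integral_diff)
  have lim: "(\<lambda>n. D n x) \<longlonglongrightarrow> pderivs [i] f x" for x
  proof -
    have "((\<lambda>t. f (x + t *\<^sub>R e)) has_real_derivative pderivs [i] f x) (at 0)"
      using smooth_has_derivative_line[OF sm, of x i 0] by (simp add: e_def)
    then have "((\<lambda>h. (f (x + h *\<^sub>R e) - f x) / h) \<longlongrightarrow> pderivs [i] f x) (at 0)"
      by (simp add: DERIV_def)
    moreover have "filterlim (\<lambda>n. 1 / real (Suc n)) (at 0) sequentially"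
      unfolding filterlim_at using LIMSEQ_Suc[OF lim_1_over_n] by simp
    ultimately have "(\<lambda>n. (f (x + (1 / real (Suc n)) *\<^sub>R e) - f x) / (1 / real (Suc n))) \<longlonglongrightarrow> pderivs [i] f x"
      by (rule filterlim_compose)
    then show ?thesis by (simp add: D_def)
  qed
  have bound: "norm (D n x) \<le> B * indicator K' x" for n x
  proof (cases "x \<in> K'")
    case True
    define h where "h = 1 / real (Suc n)"
    have h: "h > 0" by (simp add: h_def)
    obtain z where "z > 0" "z < h"
      "f (x + h *\<^sub>R e) - f (x + 0 *\<^sub>R e) = (h - 0) * pderivs [i] f (x + z *\<^sub>R axis i 1)"
      using MVT2[OF h, of "\<lambda>t. f (x + t *\<^sub>R e)" "\<lambda>t. pderivs [i] f (x + t *\<^sub>R axis i 1)"]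
        smooth_has_derivative_line[OF sm, of x i] unfolding e_def by blast
    then have "D n x = pderivs [i] f (x + z *\<^sub>R axis i 1)"
      by (simp add: D_def h_def del: pderivs.simps)
    then show ?thesis using B True by simp
  next
    case False
    define c where "c = (1 / real (Suc n)) *\<^sub>R e"
    have c: "norm c \<le> 1" by (simp add: c_def)
    have "x \<notin> K" using False unfolding K'_def
      by (metis (mono_tags, lifting) add.right_neutral centre_in_cball mem_Collect_eq zero_le_one)
    moreover have "x + c \<notin> K"
    proof
      assume "x + c \<in> K"
      moreover have "x = (x + c) + (- c)" "- c \<in> cball 0 1" using c by auto
      ultimately show False using False unfolding K'_def by blast
    qed
    ultimately have "f x = 0" "f (x + c) = 0"
      using closure_subset[of "{x. f x \<noteq> 0}"] by (auto simp: K_def)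
    then show ?thesis using False by (simp add: D_def c_def)
  qed
  have [measurable]: "f \<in> borel_measurable borel" "pderivs [i] f \<in> borel_measurable borel"
    using sm by (auto intro: smooth_borel_measurable smooth_pderivs simp del: pderivs.simps)
  have [measurable]: "K' \<in> sets borel" using K' by (simp add: borel_compact)
  have "integrable lborel (\<lambda>x. B * indicator K' x)"
    using emeasure_compact_finite[OF K'] by (intro integrable_mult_right integrable_real_indicator) auto
  then have "(\<lambda>n. integral\<^sup>L lborel (D n)) \<longlonglongrightarrow> integral\<^sup>L lborel (pderivs [i] f)"
  proof (rule integral_dominated_convergence[rotated 2])
    show "D n \<in> borel_measurable lborel" for n unfolding D_def by measurable
  qed (use lim bound in \<open>auto simp del: pderivs.simps\<close>)
  then show ?thesis by (simp add: D0 LIMSEQ_const_iff del: pderivs.simps)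
qed

lemma test_functions_mult:
  assumes "smooth f" "g \<in> test_functions \<Omega>"
  shows "(\<lambda>x. f x * g x) \<in> test_functions \<Omega>"
  using test_functionsD[OF assms(2)] closure_subset[of "{x. g x \<noteq> 0}"]
  by (intro test_functionsI[where K="closure {x. g x \<noteq> 0}"]) (auto intro: smooth_mult assms(1))

lemma integral_by_parts_smooth1:
  assumes f: "smooth f" and g: "g \<in> test_functions \<Omega>"
  shows "(\<integral>x. f x * pderivs [i] g x \<partial>lborel) = - (\<integral>x. pderivs [i] f x * g x \<partial>lborel)"
proof -
  note g' = test_functionsD(1)[OF g]
  have "(\<integral>x. f x * pderivs [i] g x + pderivs [i] f x * g x \<partial>lborel) = 0"
    using integral_pderiv_eq_0[OF test_functions_mult[OF f g], of i]
    unfolding pderivs1_mult[OF smooth_differentiable[OF f] smooth_differentiable[OF g']] .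
  moreover have "integrable lborel (\<lambda>x. f x * pderivs [i] g x)" "integrable lborel (\<lambda>x. pderivs [i] f x * g x)"
    by (rule test_functions_integrable[OF test_functions_mult[OF f test_functions_pderivs[OF g]]])
      (rule test_functions_integrable[OF test_functions_mult[OF smooth_pderivs[OF f] g]])
  ultimately show ?thesis by (simp del: pderivs.simps)
qed

lemma integral_by_parts_smooth:
  assumes "smooth f" and g: "g \<in> test_functions \<Omega>"
  shows "(\<integral>x. f x * pderivs is g x \<partial>lborel) =
    (-1) ^ length is * (\<integral>x. pderivs (rev is) f x * g x \<partial>lborel)"
  using assms(1)
proof (induction "is" arbitrary: f)
  case (Cons i "is")
  have "(\<integral>x. f x * pderivs [i] (pderivs is g) x \<partial>lborel) = - (\<integral>x. pderivs [i] f x * pderivs is g x \<partial>lborel)"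
    by (intro integral_by_parts_smooth1[OF Cons.prems test_functions_pderivs[OF g]])
  also have "\<dots> = - ((-1) ^ length is * (\<integral>x. pderivs (rev is) (pderivs [i] f) x * g x \<partial>lborel))"
    by (subst Cons.IH) (auto intro!: smooth_pderivs Cons.prems simp del: pderivs.simps)
  finally show ?case
    by (simp only: pderivs_Cons1[of i "is"] rev.simps pderivs_append) simp
qed simp

lemma integral_lebesgue_on_vanishing:
  fixes f :: "'a::euclidean_space \<Rightarrow> real"
  assumes "f \<in> borel_measurable borel" "\<And>x. x \<notin> \<Omega> \<Longrightarrow> f x = 0" "\<Omega> \<in> sets lebesgue"
  shows "integral\<^sup>L (lebesgue_on \<Omega>) f = integral\<^sup>L lborel f"
proof -
  have "(\<lambda>x. indicator \<Omega> x *\<^sub>R f x) = f" using assms(2) by (auto simp: fun_eq_iff indicator_def)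
  then show ?thesis using assms by (simp add: integral_restrict_space integral_completion)
qed

lemma test_functions_eq_0: "g \<in> test_functions \<Omega> \<Longrightarrow> x \<notin> \<Omega> \<Longrightarrow> g x = 0"
  using closure_subset[of "{x. g x \<noteq> 0}"] by (auto simp: test_functions_def)

lemma continuous_locally_integrable:
  assumes "continuous_on UNIV f"
  shows "f locally_integrable_on \<Omega>"
  unfolding locally_integrable_on_def
proof (intro allI impI)
  fix K assume "compact K \<and> K \<subseteq> \<Omega>"
  then have "integrable lborel (\<lambda>x. indicator K x *\<^sub>R f x)"
    using assms by (intro borel_integrable_compact) (auto intro: continuous_on_subset)
  then show "f absolutely_integrable_on K"
    unfolding set_integrable_def by (subst integrable_completion) auto
qed

text \<open>
  Integrating by parts reverses the order of the directions; keeping track of it avoids the symmetry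
  of mixed derivatives.
\<close>

lemma smooth_has_weak_deriv:
  assumes "smooth f" "open \<Omega>"
  shows "has_weak_deriv \<Omega> is f (pderivs (rev is) f)"
  unfolding has_weak_deriv_def
proof (intro conjI ballI continuous_locally_integrable smooth_continuous_on smooth_pderivs assms)
  fix \<phi> assume \<phi>: "\<phi> \<in> test_functions \<Omega>"
  have [measurable]: "f \<in> borel_measurable borel" "pderivs is \<phi> \<in> borel_measurable borel"
    "pderivs (rev is) f \<in> borel_measurable borel" "\<phi> \<in> borel_measurable borel"
    using assms \<phi> by (auto intro!: smooth_borel_measurable smooth_pderivs dest: test_functionsD)
  have "\<Omega> \<in> sets lebesgue" using assms(2) by auto
  then show "(LINT x|lebesgue_on \<Omega>. f x * pderivs is \<phi> x) =
         (- 1) ^ length is * (LINT x|lebesgue_on \<Omega>. pderivs (rev is) f x * \<phi> x)"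
    using integral_by_parts_smooth[OF assms(1) \<phi>, of "is"]
      test_functions_eq_0[OF \<phi>] test_functions_eq_0[OF test_functions_pderivs[OF \<phi>]]
    by (subst (1 2) integral_lebesgue_on_vanishing) auto
qed

section \<open>Local integrals determine a function\<close>

lemma AE_lebesgue_on_openI:
  fixes \<Omega> :: "'a::euclidean_space set"
  assumes "open \<Omega>" "\<And>a b. cbox a b \<subseteq> \<Omega> \<Longrightarrow> AE x in lebesgue_on (cbox a b). P x"
  shows "AE x in lebesgue_on \<Omega>. P x"
proof -
  obtain \<D> where D: "countable \<D>" "\<D> \<subseteq> Pow \<Omega>" "\<And>X. X \<in> \<D> \<Longrightarrow> \<exists>a b. X = cbox a b" "\<Union>\<D> = \<Omega>"
    using open_countable_Union_open_cbox[OF assms(1)] by metis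
  have "AE x in lebesgue. x \<in> X \<longrightarrow> P x" if X: "X \<in> \<D>" for X
  proof -
    obtain a b where "X = cbox a b" using D(3)[OF X] by blast
    then show ?thesis using assms(2)[of a b] X D(2) by (auto simp: AE_restrict_space_iff)
  qed
  then have "AE x in lebesgue. \<forall>X\<in>\<D>. x \<in> X \<longrightarrow> P x"
    using D(1) by (subst AE_ball_countable) auto
  then have "AE x in lebesgue. x \<in> \<Omega> \<longrightarrow> P x"
    by (rule eventually_mono) (use D(4) in blast)
  then show ?thesis
    using assms(1) by (subst AE_restrict_space_iff) auto
qed

text \<open>By Lebesgue differentiation, almost every value of \<open>f\<close> is the limit of
  averages over small cubes having the point as a corner, and all these averages are 0.\<close>

lemma AE_eq_0_if_box_integrals_0:
  fixes f :: "real ^ 'n::finite \<Rightarrow> real"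
  assumes "open \<Omega>" and loc: "f locally_integrable_on \<Omega>"
    and 0: "\<And>a b. cbox a b \<subseteq> \<Omega> \<Longrightarrow> integral (cbox a b) f = 0"
  shows "AE x in lebesgue_on \<Omega>. f x = 0"
proof (rule AE_lebesgue_on_openI[OF \<open>open \<Omega>\<close>])
  fix a b :: "real ^ 'n" assume ab: "cbox a b \<subseteq> \<Omega>"
  \<comment> \<open>Extension by 0 gives a function that is integrable on every box, as the
    differentiation theorem demands.\<close>
  define g where "g x = (if x \<in> cbox a b then f x else 0)" for x
  have fab: "f absolutely_integrable_on cbox a b"
    using loc ab by (auto simp: locally_integrable_on_def)
  have g: "g integrable_on cbox c d" for c d
  proof -
    have "g integrable_on UNIV" unfolding g_def
      using set_lebesgue_integral_eq_integral(1)[OF fab] by (simp only: integrable_restrict_UNIV)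
    then show ?thesis by (rule integrable_on_subcbox) auto
  qed
  obtain N where N: "negligible N" "\<And>x e. \<lbrakk>x \<notin> N; 0 < e\<rbrakk> \<Longrightarrow>
      \<exists>d>0. \<forall>h. 0 < h \<and> h < d \<longrightarrow>
         norm (integral (cbox x (x + h *\<^sub>R One)) g /\<^sub>R h ^ DIM(real^'n) - g x) < e"
    using integrable_ccontinuous_explicit[OF g] by metis
  have "f x = 0" if x: "x \<in> box a b" "x \<notin> N" for x
  proof (rule ccontr)
    assume "f x \<noteq> 0"
    then obtain d where d: "d > 0" "\<And>h. 0 < h \<Longrightarrow> h < d \<Longrightarrow>
       norm (integral (cbox x (x + h *\<^sub>R One)) g /\<^sub>R h ^ DIM(real^'n) - g x) < \<bar>f x\<bar>"
      using N(2)[OF x(2), of "\<bar>f x\<bar>"] by auto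
    obtain r where r: "r > 0" "ball x r \<subseteq> box a b"
      using x(1) open_box open_contains_ball by blast
    \<comment> \<open>Small enough for the differentiation estimate and for the cube of side
      \<open>h\<close> with corner \<open>x\<close> to have diameter below \<open>r\<close>.\<close>
    define h where "h = min (d / 2) (r / 2 / (norm (One::real^'n) + 1))"
    have np: "norm (One::real^'n) + 1 > 0" by (smt (verit) norm_ge_zero)
    have h: "0 < h" "h < d" "h * norm (One::real^'n) < r"
    proof -
      show "0 < h" "h < d" using d r np by (auto simp: h_def)
      have "h * (norm (One::real^'n) + 1) \<le> r / 2" 
        using np unfolding h_def by (subst pos_le_divide_eq[symmetric]) auto
      then show "h * norm (One::real^'n) < r" using \<open>0 < h\<close> r by (simp add: distrib_left)
    qed
    have sub: "cbox x (x + h *\<^sub>R One) \<subseteq> cbox a b"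
    proof -
      have "cbox x (x + h *\<^sub>R One) \<subseteq> box a b"
      proof
        fix y assume y: "y \<in> cbox x (x + h *\<^sub>R One)"
        have "norm (y - x) \<le> norm (h *\<^sub>R One :: real^'n)"
          using y by (intro norm_le_componentwise) (auto simp: mem_box inner_simps)
        then have "y \<in> ball x r" using h by (simp add: dist_norm norm_minus_commute)
        then show "y \<in> box a b" using r by auto
      qed
      then show ?thesis using box_subset_cbox by blast
    qed
    have "integral (cbox x (x + h *\<^sub>R One)) g = integral (cbox x (x + h *\<^sub>R One)) f"
      using sub by (intro integral_cong) (auto simp: g_def)
    also have "\<dots> = 0" using sub ab by (intro 0) auto
    finally have "norm (g x) < \<bar>f x\<bar>" using d(2)[OF h(1,2)] by simp
    then show False using x box_subset_cbox[of a b] by (auto simp: g_def split: if_splits)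
  qed
  then have "{x \<in> cbox a b. f x \<noteq> 0} \<subseteq> N \<union> (cbox a b - box a b)" by auto
  moreover have "negligible (N \<union> (cbox a b - box a b))"
    using N(1) negligible_frontier_interval by (intro negligible_Un)
  ultimately have "negligible {x \<in> cbox a b. f x \<noteq> 0}" by (rule negligible_subset[rotated])
  then have "AE x in lebesgue. x \<notin> {x \<in> cbox a b. f x \<noteq> 0}"
    by (intro AE_not_in) (simp add: negligible_iff_null_sets)
  then show "AE x in lebesgue_on (cbox a b). f x = 0"
    by (subst AE_restrict_space_iff) (auto elim!: eventually_mono)
qed

text \<open>Ever steeper box bumps converge to the indicator of an open box, and the faces of a box
  are null sets; so dominated convergence reduces the claim to integrals over boxes. This is the
  uniqueness principle behind weak derivatives.\<close>

lemma AE_eq_0_if_test_integrals_0: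
  fixes f :: "real ^ 'n::finite \<Rightarrow> real"
  assumes "open \<Omega>" and loc: "f locally_integrable_on \<Omega>"
    and 0: "\<And>\<phi>. \<phi> \<in> test_functions \<Omega> \<Longrightarrow> (LINT x|lebesgue_on \<Omega>. f x * \<phi> x) = 0"
  shows "AE x in lebesgue_on \<Omega>. f x = 0"
proof (rule AE_eq_0_if_box_integrals_0[OF assms(1,2)])
  fix a b assume ab: "cbox a b \<subseteq> \<Omega>"
  define \<phi> where "\<phi> n = box_bump (real (Suc n)) a b" for n
  have f: "f absolutely_integrable_on cbox a b"
    using loc ab by (auto simp: locally_integrable_on_def)
  have \<Omega>: "\<Omega> \<in> sets lebesgue" using assms(1) by auto
  have \<phi>: "\<phi> n \<in> test_functions \<Omega>" for n
    unfolding \<phi>_def using ab by (intro box_bump_test_function) auto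
  have [measurable]: "\<phi> n \<in> borel_measurable borel" for n
    using test_functionsD(1)[OF \<phi>] by (rule smooth_borel_measurable)
  have \<phi>0: "\<phi> n x = 0" if "x \<notin> box a b" for n x
    unfolding \<phi>_def using that by (intro box_bump_eq_0) auto
  define F where "F = (\<lambda>x. indicator (cbox a b) x *\<^sub>R f x)"
  have F: "integrable lebesgue F" using f by (simp add: F_def set_integrable_def)
  have "(indicator (box a b) :: _ \<Rightarrow> real) \<in> borel_measurable lebesgue" by (simp add: measurable_completion)
  then have F': "(\<lambda>x. F x * indicator (box a b) x) \<in> borel_measurable lebesgue"
    using F by (intro borel_measurable_times) auto
  have eq: "(LINT x|lebesgue_on \<Omega>. f x * \<phi> n x) = (LINT x|lebesgue. F x * \<phi> n x)" for n
  proof -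
    have "indicator \<Omega> x *\<^sub>R (f x * \<phi> n x) = F x * \<phi> n x" for x
      using ab \<phi>0[of x n] box_subset_cbox[of a b] by (cases "x \<in> box a b") (auto simp: F_def subset_iff)
    then show ?thesis using \<Omega> by (subst integral_restrict_space) (simp_all only: space_completion space_lborel space_borel Int_UNIV_right)
  qed
  have "(\<lambda>n. LINT x|lebesgue. F x * \<phi> n x) \<longlonglongrightarrow> (LINT x|lebesgue. F x * indicator (box a b) x)"
  proof (rule integral_dominated_convergence[where w="\<lambda>x. \<bar>F x\<bar>"])
    have "\<phi> n \<in> borel_measurable lebesgue" for n by (simp add: measurable_completion)
    then show "(\<lambda>x. F x * \<phi> n x) \<in> borel_measurable lebesgue" for n
      using F by (intro borel_measurable_times) auto
    show "(\<lambda>x. F x * indicator (box a b) x) \<in> borel_measurable lebesgue" by (rule F')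
    show "AE x in lebesgue. (\<lambda>n. F x * \<phi> n x) \<longlonglongrightarrow> F x * indicator (box a b) x"
      unfolding \<phi>_def by (intro AE_I2 tendsto_intros box_bump_tendsto_indicator)
    show "AE x in lebesgue. norm (F x * \<phi> n x) \<le> \<bar>F x\<bar>" for n
      using box_bump_nonneg[of "real (Suc n)" a b] box_bump_le_1[of "real (Suc n)" a b]
      by (auto intro!: AE_I2 simp: abs_mult \<phi>_def mult_left_le)
  qed (use F in auto)
  moreover have "(LINT x|lebesgue. F x * \<phi> n x) = 0" for n using 0[OF \<phi>, of n] eq by simp
  ultimately have z: "(LINT x|lebesgue. F x * indicator (box a b) x) = 0" by (simp add: LIMSEQ_const_iff)
  have "AE x in lebesgue. x \<notin> cbox a b - box a b"
    using negligible_frontier_interval[of a b] by (intro AE_not_in) (simp add: negligible_iff_null_sets)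
  then have "(LINT x|lebesgue. F x) = (LINT x|lebesgue. F x * indicator (box a b) x)"
    using F F' by (intro integral_cong_AE) (auto simp: F_def indicator_def elim!: eventually_mono)
  with z have "(LINT x:cbox a b|lebesgue. f x) = 0" by (simp add: F_def set_lebesgue_integral_def)
  then show "integral (cbox a b) f = 0"
    using set_lebesgue_integral_eq_integral(2)[OF f] by simp
qed

lemma locally_integrable_diff:
  "f locally_integrable_on \<Omega> \<Longrightarrow> g locally_integrable_on \<Omega> \<Longrightarrow> (\<lambda>x. f x - g x) locally_integrable_on \<Omega>"
  by (auto simp: locally_integrable_on_def intro: set_integral_diff)

lemma locally_integrable_times_test:
  fixes v :: "real ^ 'n::finite \<Rightarrow> real"
  assumes "v locally_integrable_on \<Omega>" "g \<in> test_functions \<Omega>" "open \<Omega>"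
  shows "integrable (lebesgue_on \<Omega>) (\<lambda>x. v x * g x)"
proof -
  define K where "K = closure {x. g x \<noteq> 0}"
  have K: "compact K" "K \<subseteq> \<Omega>" "\<And>x. x \<notin> K \<Longrightarrow> g x = 0"
    using test_functionsD[OF assms(2)] closure_subset[of "{x. g x \<noteq> 0}"] by (auto simp: K_def)
  have v: "integrable lebesgue (\<lambda>x. indicator K x *\<^sub>R v x)"
    using assms(1) K by (auto simp: locally_integrable_on_def set_integrable_def)
  obtain B where B: "\<And>x. \<bar>g x\<bar> \<le> B" using test_functions_bounded[OF assms(2)] by metis
  have g: "g \<in> borel_measurable lebesgue"
    using smooth_borel_measurable[OF test_functionsD(1)[OF assms(2)]] by (simp add: measurable_completion)
  have "integrable lebesgue (\<lambda>x. g x * (indicator K x *\<^sub>R v x))"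
  proof (rule Bochner_Integration.integrable_bound[where f="\<lambda>x. B * (indicator K x *\<^sub>R v x)"])
    show "AE x in lebesgue. norm (g x * (indicator K x *\<^sub>R v x)) \<le> norm (B * (indicator K x *\<^sub>R v x))"
      using B by (auto intro!: AE_I2 simp: abs_mult mult_right_mono order_trans[OF B abs_ge_self])
  qed (use v g in \<open>auto intro: borel_measurable_times integrable_mult_right\<close>)
  moreover have "(\<lambda>x. g x * (indicator K x *\<^sub>R v x)) = (\<lambda>x. indicator \<Omega> x *\<^sub>R (v x * g x))"
    using K by (auto simp: fun_eq_iff indicator_def)
  ultimately show ?thesis
    using assms(3) by (subst integrable_restrict_space) auto
qed

lemma has_weak_deriv_unique:
  assumes "open \<Omega>" "has_weak_deriv \<Omega> is v w" "has_weak_deriv \<Omega> is v w'"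
  shows "AE x in lebesgue_on \<Omega>. w x = w' x"
proof -
  have "AE x in lebesgue_on \<Omega>. w x - w' x = 0"
  proof (rule AE_eq_0_if_test_integrals_0[OF assms(1)])
    show "(\<lambda>x. w x - w' x) locally_integrable_on \<Omega>"
      using assms by (auto simp: has_weak_deriv_def intro: locally_integrable_diff)
    fix \<phi> assume \<phi>: "\<phi> \<in> test_functions \<Omega>"
    have "integrable (lebesgue_on \<Omega>) (\<lambda>x. w x * \<phi> x)" "integrable (lebesgue_on \<Omega>) (\<lambda>x. w' x * \<phi> x)"
      using assms \<phi> by (auto simp: has_weak_deriv_def intro: locally_integrable_times_test)
    moreover have "(LINT x|lebesgue_on \<Omega>. w x * \<phi> x) = (LINT x|lebesgue_on \<Omega>. w' x * \<phi> x)"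
      using assms(2,3) \<phi> unfolding has_weak_deriv_def
      by (metis (no_types, lifting) mult_cancel_left power_eq_0_iff zero_neq_neg_one)
    ultimately show "(LINT x|lebesgue_on \<Omega>. (w x - w' x) * \<phi> x) = 0"
      by (simp add: left_diff_distrib)
  qed
  then show ?thesis by simp
qed

section \<open>The weighted Sobolev space\<close>

text \<open>The \<open>p\<close>-th power of the weighted norm, taken in the extended reals so that
  sums and limits can be estimated before finiteness is known.\<close>

definition weighted_nn_integral ::
    "(real ^ 'n::finite) set \<Rightarrow> real \<Rightarrow> real \<Rightarrow> (real ^ 'n \<Rightarrow> real) \<Rightarrow> ennreal" where
  "weighted_nn_integral \<Omega> p s g = (\<integral>\<^sup>+ x. ennreal (\<bar>g x\<bar> powr p * bdist \<Omega> x powr s) \<partial>lebesgue_on \<Omega>)"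

lemma bdist_measurable: "bdist \<Omega> \<in> borel_measurable borel"
  unfolding bdist_def by (intro borel_measurable_continuous_onI continuous_intros)

lemma borel_measurable_lebesgue_onI: "f \<in> borel_measurable borel \<Longrightarrow> f \<in> borel_measurable (lebesgue_on S)"
  by (intro measurable_restrict_space1) (simp add: measurable_completion)

lemma bdist_measurable_lebesgue_on [measurable]: "bdist \<Omega> \<in> borel_measurable (lebesgue_on S)"
  by (intro borel_measurable_lebesgue_onI bdist_measurable)

lemma weighted_Lp_iff:
  "g \<in> weighted_Lp \<Omega> p s \<longleftrightarrow>
     g \<in> borel_measurable (lebesgue_on \<Omega>) \<and> weighted_nn_integral \<Omega> p s g < \<infinity>"
proof (cases "g \<in> borel_measurable (lebesgue_on \<Omega>)")
  case True
  then have [measurable]: "g \<in> borel_measurable (lebesgue_on \<Omega>)" .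
  have "(\<lambda>x. \<bar>g x\<bar> powr p * bdist \<Omega> x powr s) \<in> borel_measurable (lebesgue_on \<Omega>)"
    by measurable
  then show ?thesis using True
    by (simp add: weighted_Lp_def weighted_nn_integral_def integrable_iff_bounded)
qed (simp add: weighted_Lp_def)

lemma weighted_Lp_norm_eq:
  assumes [measurable]: "g \<in> borel_measurable (lebesgue_on \<Omega>)"
  shows "weighted_Lp_norm \<Omega> p s g = enn2real (weighted_nn_integral \<Omega> p s g) powr (1 / p)"
  unfolding weighted_Lp_norm_def weighted_nn_integral_def
  by (subst integral_eq_nn_integral) auto

lemma weighted_nn_integral_mono_AE:
  assumes "AE x in lebesgue_on \<Omega>. \<bar>f x\<bar> \<le> \<bar>g x\<bar>" "0 \<le> p"
  shows "weighted_nn_integral \<Omega> p s f \<le> weighted_nn_integral \<Omega> p s g"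
  unfolding weighted_nn_integral_def
  using assms by (intro nn_integral_mono_AE) (auto elim!: eventually_mono intro!: ennreal_leI mult_right_mono powr_mono2)

lemma weighted_nn_integral_cong_AE:
  assumes "AE x in lebesgue_on \<Omega>. f x = g x"
  shows "weighted_nn_integral \<Omega> p s f = weighted_nn_integral \<Omega> p s g"
  unfolding weighted_nn_integral_def
  using assms by (intro nn_integral_cong_AE) (auto elim!: eventually_mono)

text \<open>Every summand is compared with the largest one. The constant is cruder than the one from
  convexity, but the argument covers every positive \<open>p\<close>, and only finiteness of the
  constant matters.\<close>

lemma powr_sum_le:
  fixes f :: "'a \<Rightarrow> real"
  assumes "finite A" "0 < p"
  shows "(\<Sum>a\<in>A. \<bar>f a\<bar>) powr p \<le> real (card A) powr p * (\<Sum>a\<in>A. \<bar>f a\<bar> powr p)"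
proof (cases "A = {}")
  case False
  define M where "M = Max ((\<lambda>a. \<bar>f a\<bar>) ` A)"
  have M: "\<bar>f a\<bar> \<le> M" if "a \<in> A" for a using assms that by (auto simp: M_def)
  have "M \<in> (\<lambda>a. \<bar>f a\<bar>) ` A" unfolding M_def using assms False by (intro Max_in) auto
  then obtain a where a: "a \<in> A" "M = \<bar>f a\<bar>" by auto
  have "(\<Sum>a\<in>A. \<bar>f a\<bar>) \<le> real (card A) * M"
    using sum_bounded_above[of A "\<lambda>a. \<bar>f a\<bar>" M] M by auto
  then have "(\<Sum>a\<in>A. \<bar>f a\<bar>) powr p \<le> (real (card A) * M) powr p"
    using assms by (intro powr_mono2) (auto intro: sum_nonneg)
  also have "\<dots> = real (card A) powr p * \<bar>f a\<bar> powr p"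
    using a by (simp add: powr_mult)
  also have "\<dots> \<le> real (card A) powr p * (\<Sum>a\<in>A. \<bar>f a\<bar> powr p)"
    using a assms by (intro mult_left_mono member_le_sum) auto
  finally show ?thesis .
qed (use assms in auto)

lemma powr_add_le:
  fixes a b :: real
  assumes "0 < p"
  shows "\<bar>a + b\<bar> powr p \<le> 2 powr p * (\<bar>a\<bar> powr p + \<bar>b\<bar> powr p)"
proof -
  have "\<bar>a + b\<bar> powr p \<le> (\<Sum>i\<in>{True,False}. \<bar>if i then a else b\<bar>) powr p"
    using assms by (intro powr_mono2) auto
  also have "\<dots> \<le> real (card {True,False}) powr p * (\<Sum>i\<in>{True,False}. \<bar>if i then a else b\<bar> powr p)"
    using assms by (intro powr_sum_le) auto
  finally show ?thesis by simp
qed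

lemma weighted_nn_integral_add:
  assumes [measurable]: "f \<in> borel_measurable (lebesgue_on \<Omega>)" "g \<in> borel_measurable (lebesgue_on \<Omega>)"
    and "0 < p"
  shows "weighted_nn_integral \<Omega> p s (\<lambda>x. f x + g x) \<le>
     ennreal (2 powr p) * (weighted_nn_integral \<Omega> p s f + weighted_nn_integral \<Omega> p s g)"
proof -
  have "weighted_nn_integral \<Omega> p s (\<lambda>x. f x + g x) \<le>
    (\<integral>\<^sup>+ x. ennreal (2 powr p) * (ennreal (\<bar>f x\<bar> powr p * bdist \<Omega> x powr s) + ennreal (\<bar>g x\<bar> powr p * bdist \<Omega> x powr s)) \<partial>lebesgue_on \<Omega>)"
    unfolding weighted_nn_integral_def
  proof (intro nn_integral_mono)
    fix x
    show "ennreal (\<bar>f x + g x\<bar> powr p * bdist \<Omega> x powr s)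
         \<le> ennreal (2 powr p) * (ennreal (\<bar>f x\<bar> powr p * bdist \<Omega> x powr s) + ennreal (\<bar>g x\<bar> powr p * bdist \<Omega> x powr s))"
      using mult_right_mono[OF powr_add_le[OF \<open>0 < p\<close>, of "f x" "g x"], of "bdist \<Omega> x powr s"]
      by (simp flip: ennreal_plus ennreal_mult add: algebra_simps)
  qed
  also have "\<dots> = ennreal (2 powr p) * (weighted_nn_integral \<Omega> p s f + weighted_nn_integral \<Omega> p s g)"
    unfolding weighted_nn_integral_def by (simp add: nn_integral_cmult nn_integral_add)
  finally show ?thesis .
qed

lemma weighted_nn_integral_cmult:
  assumes [measurable]: "f \<in> borel_measurable (lebesgue_on \<Omega>)"
  shows "weighted_nn_integral \<Omega> p s (\<lambda>x. c * f x) = ennreal (\<bar>c\<bar> powr p) * weighted_nn_integral \<Omega> p s f"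
  unfolding weighted_nn_integral_def
  by (subst nn_integral_cmult[symmetric])
     (auto simp: abs_mult powr_mult ennreal_mult[symmetric] mult.assoc)

lemma weighted_nn_integral_sum:
  assumes fin: "finite A" and meas: "\<And>a. a \<in> A \<Longrightarrow> f a \<in> borel_measurable (lebesgue_on \<Omega>)"
    and "0 < p"
  shows "weighted_nn_integral \<Omega> p s (\<lambda>x. \<Sum>a\<in>A. \<bar>f a x\<bar>) \<le>
     ennreal (real (card A) powr p) * (\<Sum>a\<in>A. weighted_nn_integral \<Omega> p s (f a))"
proof -
  have "weighted_nn_integral \<Omega> p s (\<lambda>x. \<Sum>a\<in>A. \<bar>f a x\<bar>) \<le>
    (\<integral>\<^sup>+ x. ennreal (real (card A) powr p) * (\<Sum>a\<in>A. ennreal (\<bar>f a x\<bar> powr p * bdist \<Omega> x powr s)) \<partial>lebesgue_on \<Omega>)"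
    unfolding weighted_nn_integral_def
  proof (intro nn_integral_mono)
    fix x
    show "ennreal (\<bar>\<Sum>a\<in>A. \<bar>f a x\<bar>\<bar> powr p * bdist \<Omega> x powr s)
         \<le> ennreal (real (card A) powr p) * (\<Sum>a\<in>A. ennreal (\<bar>f a x\<bar> powr p * bdist \<Omega> x powr s))"
      using mult_right_mono[OF powr_sum_le[OF fin \<open>0 < p\<close>, of "\<lambda>a. f a x"], of "bdist \<Omega> x powr s"]
      by (simp flip: ennreal_mult add: sum_nonneg sum_distrib_right sum_distrib_left mult.assoc)
  qed
  also have "\<dots> = ennreal (real (card A) powr p) * (\<Sum>a\<in>A. weighted_nn_integral \<Omega> p s (f a))"
  proof -
    have m: "(\<lambda>x. ennreal (\<bar>f a x\<bar> powr p * bdist \<Omega> x powr s)) \<in> borel_measurable (lebesgue_on \<Omega>)" if "a \<in> A" for a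
      using meas[OF that] by measurable
    have "(\<integral>\<^sup>+ x. (\<Sum>a\<in>A. ennreal (\<bar>f a x\<bar> powr p * bdist \<Omega> x powr s)) \<partial>lebesgue_on \<Omega>)
      = (\<Sum>a\<in>A. weighted_nn_integral \<Omega> p s (f a))"
      unfolding weighted_nn_integral_def by (intro nn_integral_sum m)
    then show ?thesis
      using m by (subst nn_integral_cmult) (auto simp del: sum_ennreal)
  qed
  finally show ?thesis .
qed

section \<open>The weight on compact subsets\<close>

lemma bdist_pos:
  assumes "open \<Omega>" "\<Omega> \<noteq> UNIV" "x \<in> \<Omega>"
  shows "0 < bdist \<Omega> x"
proof -
  have "frontier \<Omega> \<noteq> {}" using assms frontier_eq_empty[of \<Omega>] by auto
  moreover have "x \<notin> frontier \<Omega>" using assms by (simp add: frontier_def interior_open)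
  ultimately show ?thesis
    unfolding bdist_def by (intro infdist_pos_not_in_closed) (auto simp: frontier_closed)
qed

lemma continuous_on_bdist_powr:
  assumes "open \<Omega>" "\<Omega> \<noteq> UNIV" "K \<subseteq> \<Omega>"
  shows "continuous_on K (\<lambda>x. bdist \<Omega> x powr s)"
proof -
  have "\<forall>x\<in>K. infdist x (frontier \<Omega>) \<noteq> 0"
    using bdist_pos[OF assms(1,2)] assms(3) unfolding bdist_def by (metis less_irrefl subsetD)
  then show ?thesis
    unfolding bdist_def by (intro continuous_intros)
qed

lemma locally_integrable_measurable:
  fixes f :: "real ^ 'n::finite \<Rightarrow> real"
  assumes "open \<Omega>" "f locally_integrable_on \<Omega>"
  shows "f \<in> borel_measurable (lebesgue_on \<Omega>)"
proof -
  obtain \<D> where D: "countable \<D>" "\<D> \<subseteq> Pow \<Omega>" "\<And>X. X \<in> \<D> \<Longrightarrow> \<exists>a b. X = cbox a b" "\<Union>\<D> = \<Omega>"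
    using open_countable_Union_open_cbox[OF assms(1)] by metis
  show ?thesis
  proof (rule measurable_piecewise_restrict[OF D(1)])
    fix X assume X: "X \<in> \<D>"
    obtain a b where ab: "X = cbox a b" using D(3)[OF X] by blast
    have "f absolutely_integrable_on X"
      using assms(2) X D(2) ab by (auto simp: locally_integrable_on_def)
    then have "integrable (lebesgue_on X) f"
      using ab by (simp add: integrable_restrict_space set_integrable_def)
    then have "f \<in> borel_measurable (lebesgue_on X)" by auto
    moreover have "restrict_space (lebesgue_on \<Omega>) X = lebesgue_on X"
      using X D(2) ab assms(1)
      by (subst restrict_restrict_space) (auto simp: Int_absorb1)
    ultimately show "f \<in> borel_measurable (restrict_space (lebesgue_on \<Omega>) X)" by simp
    show "X \<inter> space (lebesgue_on \<Omega>) \<in> sets (lebesgue_on \<Omega>)"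
      using X D(2) ab assms(1) by (subst sets_restrict_space_iff) (auto simp: Int_absorb2)
  qed (use D in auto)
qed

text \<open>On a nonempty compact subset of \<open>\<Omega>\<close> the weight has a positive
  minimum \<open>c\<close>, and \<open>t \<le> 1 + t powr p\<close> for \<open>t \<ge> 0\<close>;
  together these bound \<open>\<bar>g x\<bar>\<close> by an integrable function.\<close>

lemma weighted_Lp_locally_integrable:
  fixes g :: "real ^ 'n::finite \<Rightarrow> real"
  assumes "open \<Omega>" "\<Omega> \<noteq> UNIV" "g \<in> weighted_Lp \<Omega> p s" "1 \<le> p"
  shows "g locally_integrable_on \<Omega>"
  unfolding locally_integrable_on_def
proof (intro allI impI)
  fix K assume K: "compact K \<and> K \<subseteq> \<Omega>"
  have \<Omega>: "\<Omega> \<in> sets lebesgue" using assms(1) by auto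
  have Kb: "K \<in> sets borel" using K by (simp add: borel_compact)
  then have KL: "K \<in> sets lebesgue" by simp
  have [measurable]: "g \<in> borel_measurable (lebesgue_on \<Omega>)" using assms(3) by (simp add: weighted_Lp_iff)
  have "continuous_on K (\<lambda>x. bdist \<Omega> x powr s)"
    by (rule continuous_on_bdist_powr) (use K assms in auto)
  then have "\<exists>c>0. \<forall>x\<in>K. c \<le> bdist \<Omega> x powr s"
  proof (cases "K = {}")
    case False
    then obtain y where "y \<in> K" "\<forall>x\<in>K. bdist \<Omega> y powr s \<le> bdist \<Omega> x powr s"
      using continuous_attains_inf[of K "\<lambda>x. bdist \<Omega> x powr s"] K \<open>continuous_on K _\<close> by blast
    then show ?thesis using bdist_pos[OF assms(1,2), of y] K
      by (intro exI[of _ "bdist \<Omega> y powr s"]) auto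
  qed (auto intro: exI[of _ 1])
  then obtain c where c: "c > 0" "\<And>x. x \<in> K \<Longrightarrow> c \<le> bdist \<Omega> x powr s" by blast
  have sub: "K \<in> sets (lebesgue_on \<Omega>)" using K KL \<Omega> by (auto simp: sets_restrict_space_iff)
  have int: "integrable (lebesgue_on \<Omega>) (\<lambda>x. indicator K x + (1 / c) * (\<bar>g x\<bar> powr p * bdist \<Omega> x powr s))"
  proof (intro Bochner_Integration.integrable_add integrable_mult_right)
    show "integrable (lebesgue_on \<Omega>) (\<lambda>x. \<bar>g x\<bar> powr p * bdist \<Omega> x powr s)"
      using assms(3) by (simp add: weighted_Lp_def)
    have "emeasure (lebesgue_on \<Omega>) K < \<infinity>"
      using K \<Omega> emeasure_compact_finite[of K] Kb by (subst emeasure_restrict_space) auto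
    then show "integrable (lebesgue_on \<Omega>) (indicator K :: _ \<Rightarrow> real)"
      using sub by (intro integrable_real_indicator) auto
  qed
  have "integrable (lebesgue_on \<Omega>) (\<lambda>x. indicator K x *\<^sub>R g x)"
  proof (rule Bochner_Integration.integrable_bound[OF int])
    show "(\<lambda>x. indicator K x *\<^sub>R g x) \<in> borel_measurable (lebesgue_on \<Omega>)"
      using sub by measurable
    show "AE x in lebesgue_on \<Omega>. norm (indicator K x *\<^sub>R g x) \<le> norm (indicator K x + 1 / c * (\<bar>g x\<bar> powr p * bdist \<Omega> x powr s))"
    proof (rule AE_I2)
      fix x
      show "norm (indicator K x *\<^sub>R g x) \<le> norm (indicator K x + 1 / c * (\<bar>g x\<bar> powr p * bdist \<Omega> x powr s))"
      proof (cases "x \<in> K")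
        case True
        have "\<bar>g x\<bar> \<le> 1 + \<bar>g x\<bar> powr p"
        proof (cases "\<bar>g x\<bar> \<le> 1")
          case False
          then have "\<bar>g x\<bar> powr 1 \<le> \<bar>g x\<bar> powr p" using assms(4) by (intro powr_mono) auto
          then show ?thesis using False by simp
        qed (auto intro: order_trans[where y=1])
        also have "\<bar>g x\<bar> powr p \<le> 1 / c * (\<bar>g x\<bar> powr p * bdist \<Omega> x powr s)"
          using c(2)[OF True] c(1) mult_left_mono[OF c(2)[OF True], of "\<bar>g x\<bar> powr p"] by (simp add: field_simps)
        finally show ?thesis using True c by (simp add: abs_if)
      qed auto
    qed
  qed
  then have "integrable lebesgue (\<lambda>x. indicator \<Omega> x *\<^sub>R (indicator K x *\<^sub>R g x))"
    using \<Omega> by (simp add: integrable_restrict_space)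
  moreover have "(\<lambda>x. indicator \<Omega> x *\<^sub>R (indicator K x *\<^sub>R g x)) = (\<lambda>x. indicator K x *\<^sub>R g x)"
    using K by (auto simp: fun_eq_iff indicator_def)
  ultimately show "g absolutely_integrable_on K" by (simp add: set_integrable_def)
qed

section \<open>Weak derivatives, the Sobolev norm and the completion\<close>

lemma has_weak_deriv_weak_deriv: "has_weak_deriv \<Omega> is v w \<Longrightarrow> has_weak_deriv \<Omega> is v (weak_deriv \<Omega> is v)"
  unfolding weak_deriv_def by (rule someI[where P="has_weak_deriv \<Omega> is v"])

lemma weak_deriv_AE_eq:
  assumes "open \<Omega>" "has_weak_deriv \<Omega> is v w"
  shows "AE x in lebesgue_on \<Omega>. weak_deriv \<Omega> is v x = w x"
  using has_weak_deriv_unique[OF assms(1) has_weak_deriv_weak_deriv] assms by blast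

lemma has_weak_deriv_measurable:
  assumes "open \<Omega>" "has_weak_deriv \<Omega> is v w"
  shows "w \<in> borel_measurable (lebesgue_on \<Omega>)"
  using assms locally_integrable_measurable by (auto simp: has_weak_deriv_def)

lemma locally_integrable_lincomb:
  "f locally_integrable_on \<Omega> \<Longrightarrow> g locally_integrable_on \<Omega> \<Longrightarrow> (\<lambda>x. c * f x + e * g x) locally_integrable_on \<Omega>"
  by (auto simp: locally_integrable_on_def)

lemma has_weak_deriv_lincomb:
  assumes "open \<Omega>" "has_weak_deriv \<Omega> is v w" "has_weak_deriv \<Omega> is v' w'"
  shows "has_weak_deriv \<Omega> is (\<lambda>x. c * v x + e * v' x) (\<lambda>x. c * w x + e * w' x)"
  unfolding has_weak_deriv_def
proof (intro conjI ballI locally_integrable_lincomb)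
  fix \<phi> assume \<phi>: "\<phi> \<in> test_functions \<Omega>"
  note d = assms(2,3)[unfolded has_weak_deriv_def]
  have [simp]: "integrable (lebesgue_on \<Omega>) (\<lambda>x. w x * \<phi> x)" "integrable (lebesgue_on \<Omega>) (\<lambda>x. w' x * \<phi> x)"
     "integrable (lebesgue_on \<Omega>) (\<lambda>x. v x * pderivs is \<phi> x)" "integrable (lebesgue_on \<Omega>) (\<lambda>x. v' x * pderivs is \<phi> x)"
    using d \<phi> by (auto intro: locally_integrable_times_test test_functions_pderivs assms(1))
  have "(LINT x|lebesgue_on \<Omega>. (c * v x + e * v' x) * pderivs is \<phi> x) =
     c * (LINT x|lebesgue_on \<Omega>. v x * pderivs is \<phi> x) + e * (LINT x|lebesgue_on \<Omega>. v' x * pderivs is \<phi> x)"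
    by (simp add: distrib_right mult.assoc)
  also have "\<dots> = (- 1) ^ length is * (LINT x|lebesgue_on \<Omega>. (c * w x + e * w' x) * \<phi> x)"
  proof -
    have "(LINT x|lebesgue_on \<Omega>. (c * w x + e * w' x) * \<phi> x) =
        c * (LINT x|lebesgue_on \<Omega>. w x * \<phi> x) + e * (LINT x|lebesgue_on \<Omega>. w' x * \<phi> x)"
      by (simp add: distrib_right mult.assoc)
    then show ?thesis using d \<phi> by (simp add: distrib_left mult.left_commute)
  qed
  finally show "(LINT x|lebesgue_on \<Omega>. (c * v x + e * v' x) * pderivs is \<phi> x) =
    (- 1) ^ length is * (LINT x|lebesgue_on \<Omega>. (c * w x + e * w' x) * \<phi> x)" .
qed (use assms in \<open>auto simp: has_weak_deriv_def\<close>)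

lemma has_weak_deriv_diff_smooth:
  assumes "open \<Omega>" "has_weak_deriv \<Omega> is v w" "smooth \<phi>"
  shows "has_weak_deriv \<Omega> is (\<lambda>x. v x - \<phi> x) (\<lambda>x. w x - pderivs (rev is) \<phi> x)"
  using has_weak_deriv_lincomb[OF assms(1,2) smooth_has_weak_deriv[OF assms(3,1)], of 1 "-1"] by simp

lemma weighted_Lp_AE_cong:
  assumes "f \<in> weighted_Lp \<Omega> p s" "AE x in lebesgue_on \<Omega>. g x = f x" "g \<in> borel_measurable (lebesgue_on \<Omega>)"
  shows "g \<in> weighted_Lp \<Omega> p s"
  using assms weighted_nn_integral_cong_AE[OF assms(2)] by (simp add: weighted_Lp_iff)

lemma finite_lists_length: "finite {is :: 'n::finite list. length is = k}"
  using finite_lists_length_eq[of "UNIV :: 'n set" k] by simp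

lemma weak_derivs_AE_eq:
  assumes "open \<Omega>" "\<And>is. length is = k \<Longrightarrow> has_weak_deriv \<Omega> is v (W is)"
  shows "AE x in lebesgue_on \<Omega>. \<forall>is. length is = k \<longrightarrow> weak_deriv \<Omega> is v x = W is x"
proof -
  have "AE x in lebesgue_on \<Omega>. \<forall>is\<in>{is. length is = k}. weak_deriv \<Omega> is v x = W is x"
    using weak_deriv_AE_eq[OF assms(1) assms(2)]
    by (subst AE_ball_countable) (auto intro: countable_finite finite_lists_length)
  then show ?thesis by simp
qed

text \<open>The Euclidean length of the derivative tensor lies between each single entry and the sum
  of the absolute values of all entries. Since \<open>W\<close> may be any choice of
  representatives, later arguments can work entry by entry and forget the choice made in
  \<open>weak_deriv\<close>.\<close>

lemma weighted_nn_integral_grad_abs: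
  fixes v :: "real ^ 'n::finite \<Rightarrow> real"
  assumes "open \<Omega>" "0 < p" and W: "\<And>is. length is = k \<Longrightarrow> has_weak_deriv \<Omega> is v (W is)"
  shows "weighted_nn_integral \<Omega> p s (grad_abs \<Omega> k v) \<le>
     ennreal (real (card {is :: 'n list. length is = k}) powr p) *
     (\<Sum>is | length is = k. weighted_nn_integral \<Omega> p s (W is))"
    and "length is = k \<Longrightarrow> weighted_nn_integral \<Omega> p s (W is) \<le> weighted_nn_integral \<Omega> p s (grad_abs \<Omega> k v)"
    and "grad_abs \<Omega> k v \<in> borel_measurable (lebesgue_on \<Omega>)"
proof -
  note eq = weak_derivs_AE_eq[OF assms(1) W]
  have "AE x in lebesgue_on \<Omega>. \<bar>grad_abs \<Omega> k v x\<bar> \<le> \<bar>\<Sum>is | length is = k. \<bar>W is x\<bar>\<bar>"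
    using eq
  proof (rule eventually_mono)
    fix x assume "\<forall>is. length is = k \<longrightarrow> weak_deriv \<Omega> is v x = W is x"
    then have "grad_abs \<Omega> k v x = L2_set (\<lambda>is. W is x) {is. length is = k}"
      by (simp add: grad_abs_def L2_set_def)
    then show "\<bar>grad_abs \<Omega> k v x\<bar> \<le> \<bar>\<Sum>is | length is = k. \<bar>W is x\<bar>\<bar>"
      using L2_set_le_sum_abs[of "\<lambda>is. W is x" "{is. length is = k}"] by simp
  qed
  then have "weighted_nn_integral \<Omega> p s (grad_abs \<Omega> k v) \<le> weighted_nn_integral \<Omega> p s (\<lambda>x. \<Sum>is | length is = k. \<bar>W is x\<bar>)"
    using assms(2) by (intro weighted_nn_integral_mono_AE) auto
  also have "\<dots> \<le> ennreal (real (card {is :: 'n list. length is = k}) powr p) *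
     (\<Sum>is | length is = k. weighted_nn_integral \<Omega> p s (W is))"
    using has_weak_deriv_measurable[OF assms(1) W] assms(2)
    by (intro weighted_nn_integral_sum finite_lists_length) auto
  finally show "weighted_nn_integral \<Omega> p s (grad_abs \<Omega> k v) \<le>
     ennreal (real (card {is :: 'n list. length is = k}) powr p) *
     (\<Sum>is | length is = k. weighted_nn_integral \<Omega> p s (W is))" .
  show "weighted_nn_integral \<Omega> p s (W is) \<le> weighted_nn_integral \<Omega> p s (grad_abs \<Omega> k v)" if l: "length is = k"
  proof (intro weighted_nn_integral_mono_AE)
    show "AE x in lebesgue_on \<Omega>. \<bar>W is x\<bar> \<le> \<bar>grad_abs \<Omega> k v x\<bar>"
      using eq
    proof (rule eventually_mono)
      fix x assume eq: "\<forall>is. length is = k \<longrightarrow> weak_deriv \<Omega> is v x = W is x"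
      have "(W is x)\<^sup>2 \<le> (\<Sum>is | length is = k. (W is x)\<^sup>2)"
        using l by (intro member_le_sum[where f="\<lambda>is. (W is x)\<^sup>2"]) (auto simp: finite_lists_length)
      then show "\<bar>W is x\<bar> \<le> \<bar>grad_abs \<Omega> k v x\<bar>"
        using eq by (simp add: grad_abs_def real_le_rsqrt sum_nonneg flip: real_sqrt_abs)
    qed
  qed (use assms in auto)
  have "weak_deriv \<Omega> is v \<in> borel_measurable (lebesgue_on \<Omega>)" if "length is = k" for "is"
    using has_weak_deriv_measurable[OF assms(1) has_weak_deriv_weak_deriv[OF W[OF that]]] .
  then have [measurable]: "(\<lambda>x. \<Sum>is | length is = k. (weak_deriv \<Omega> is v x)\<^sup>2) \<in> borel_measurable (lebesgue_on \<Omega>)"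
    by (intro borel_measurable_sum borel_measurable_power) auto
  show "grad_abs \<Omega> k v \<in> borel_measurable (lebesgue_on \<Omega>)"
    unfolding grad_abs_def[abs_def] by measurable
qed

lemma weighted_Lp_norm_tendsto_0_iff:
  assumes "0 < p" "\<And>j. g j \<in> weighted_Lp \<Omega> p s"
  shows "(\<lambda>j. weighted_Lp_norm \<Omega> p s (g j)) \<longlonglongrightarrow> 0 \<longleftrightarrow>
    (\<lambda>j. weighted_nn_integral \<Omega> p s (g j)) \<longlonglongrightarrow> 0"
proof -
  define t where "t j = enn2real (weighted_nn_integral \<Omega> p s (g j))" for j
  have t: "weighted_nn_integral \<Omega> p s (g j) = ennreal (t j)" for j
    using assms(2)[of j] by (simp add: t_def weighted_Lp_iff)
  have n: "weighted_Lp_norm \<Omega> p s (g j) = t j powr (1 / p)" for j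
    using assms(2)[of j] by (simp add: t_def weighted_Lp_norm_eq weighted_Lp_iff)
  have t0: "0 \<le> t j" for j by (simp add: t_def)
  have "(\<lambda>j. t j powr (1 / p)) \<longlonglongrightarrow> 0 \<longleftrightarrow> t \<longlonglongrightarrow> 0"
  proof
    assume "(\<lambda>j. t j powr (1 / p)) \<longlonglongrightarrow> 0"
    then have "(\<lambda>j. (t j powr (1 / p)) powr p) \<longlonglongrightarrow> 0"
      using tendsto_zero_powrI[of "\<lambda>j. t j powr (1 / p)" sequentially "\<lambda>_. p" p] assms(1) by auto
    then show "t \<longlonglongrightarrow> 0" using assms(1) t0 by (simp add: powr_powr)
  next
    assume "t \<longlonglongrightarrow> 0"
    then show "(\<lambda>j. t j powr (1 / p)) \<longlonglongrightarrow> 0"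
      using tendsto_zero_powrI[of t sequentially "\<lambda>_. 1 / p" "1 / p"] assms(1) t0 by auto
  qed
  also have "t \<longlonglongrightarrow> 0 \<longleftrightarrow> (\<lambda>j. ennreal (t j)) \<longlonglongrightarrow> ennreal 0"
    using t0 by (subst tendsto_ennreal_iff) auto
  finally show ?thesis by (simp add: n t)
qed

lemma ennreal_tendsto_0_le:
  fixes f g :: "'a \<Rightarrow> ennreal"
  assumes "(g \<longlongrightarrow> 0) F" "\<And>j. f j \<le> g j"
  shows "(f \<longlongrightarrow> 0) F"
  by (rule tendsto_sandwich[OF _ _ tendsto_const assms(1)]) (auto intro: always_eventually assms(2))

lemma weighted_Lp_lincomb:
  assumes "f \<in> weighted_Lp \<Omega> p s" "g \<in> weighted_Lp \<Omega> p s" "0 < p"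
  shows "(\<lambda>x. c * f x + e * g x) \<in> weighted_Lp \<Omega> p s"
proof -
  have [measurable]: "f \<in> borel_measurable (lebesgue_on \<Omega>)" "g \<in> borel_measurable (lebesgue_on \<Omega>)"
    using assms by (auto simp: weighted_Lp_iff)
  have "weighted_nn_integral \<Omega> p s (\<lambda>x. c * f x + e * g x) \<le> ennreal (2 powr p) *
     (weighted_nn_integral \<Omega> p s (\<lambda>x. c * f x) + weighted_nn_integral \<Omega> p s (\<lambda>x. e * g x))"
    using assms(3) by (intro weighted_nn_integral_add) auto
  also have "\<dots> < \<infinity>"
    using assms by (simp add: weighted_nn_integral_cmult weighted_Lp_iff ennreal_mult_less_top)
  finally show ?thesis by (simp add: weighted_Lp_iff)
qed

lemma test_functions_weighted_Lp:
  assumes "open \<Omega>" "\<Omega> \<noteq> UNIV" "0 < p" and f: "f \<in> test_functions \<Omega>"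
  shows "f \<in> weighted_Lp \<Omega> p s"
proof -
  define K where "K = closure {x. f x \<noteq> 0}"
  have K: "compact K" "K \<subseteq> \<Omega>" "\<And>x. x \<notin> K \<Longrightarrow> f x = 0"
    using test_functionsD[OF f] closure_subset[of "{x. f x \<noteq> 0}"] by (auto simp: K_def)
  have fm: "f \<in> borel_measurable borel" using test_functionsD(1)[OF f] by (rule smooth_borel_measurable)
  have "continuous_on K (\<lambda>x. \<bar>f x\<bar> powr p)"
    using assms(3) by (intro continuous_on_powr' continuous_intros smooth_continuous_on test_functionsD(1)[OF f]) auto
  then have "continuous_on K (\<lambda>x. \<bar>f x\<bar> powr p * bdist \<Omega> x powr s)"
    by (intro continuous_on_mult continuous_on_bdist_powr assms K)
  then have "integrable lborel (\<lambda>x. indicator K x *\<^sub>R (\<bar>f x\<bar> powr p * bdist \<Omega> x powr s))"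
    by (intro borel_integrable_compact K)
  moreover have "(\<lambda>x. indicator K x *\<^sub>R (\<bar>f x\<bar> powr p * bdist \<Omega> x powr s)) =
     (\<lambda>x. indicator \<Omega> x *\<^sub>R (\<bar>f x\<bar> powr p * bdist \<Omega> x powr s))"
    using K by (auto simp: fun_eq_iff indicator_def)
  ultimately have *: "integrable lborel (\<lambda>x. indicator \<Omega> x *\<^sub>R (\<bar>f x\<bar> powr p * bdist \<Omega> x powr s))" by simp
  then have "integrable lebesgue (\<lambda>x. indicator \<Omega> x *\<^sub>R (\<bar>f x\<bar> powr p * bdist \<Omega> x powr s))"
    by (subst integrable_completion) auto
  then have "integrable (lebesgue_on \<Omega>) (\<lambda>x. \<bar>f x\<bar> powr p * bdist \<Omega> x powr s)"
    using assms(1) by (subst integrable_restrict_space) auto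
  then show ?thesis
    using borel_measurable_lebesgue_onI[OF fm] by (simp add: weighted_Lp_def)
qed

text \<open>A certificate for membership in \<open>weighted_Sobolev0\<close>: explicit
  representatives, an explicit approximating sequence, and one convergence condition per derivative
  in place of the norm. The reversal in \<open>pderivs (rev is)\<close> is the one caused by
  integrating by parts.\<close>

definition sobolev_approx ::
    "(real ^ 'n::finite) set \<Rightarrow> nat \<Rightarrow> real \<Rightarrow> real \<Rightarrow> (real ^ 'n \<Rightarrow> real) \<Rightarrow>
     ('n list \<Rightarrow> real ^ 'n \<Rightarrow> real) \<Rightarrow> (nat \<Rightarrow> real ^ 'n \<Rightarrow> real) \<Rightarrow> bool" where
  "sobolev_approx \<Omega> m p s v W \<phi> \<longleftrightarrow>
     (\<forall>is. length is \<le> m \<longrightarrow> has_weak_deriv \<Omega> is v (W is) \<and> W is \<in> weighted_Lp \<Omega> p s \<and>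
        (\<lambda>j. weighted_nn_integral \<Omega> p s (\<lambda>x. W is x - pderivs (rev is) (\<phi> j) x)) \<longlonglongrightarrow> 0) \<and>
     (\<forall>j. \<phi> j \<in> test_functions \<Omega>)"

lemma sobolev_approxD:
  assumes "sobolev_approx \<Omega> m p s v W \<phi>"
  shows "length is \<le> m \<Longrightarrow> has_weak_deriv \<Omega> is v (W is)"
    and "length is \<le> m \<Longrightarrow> W is \<in> weighted_Lp \<Omega> p s"
    and "length is \<le> m \<Longrightarrow>
        (\<lambda>j. weighted_nn_integral \<Omega> p s (\<lambda>x. W is x - pderivs (rev is) (\<phi> j) x)) \<longlonglongrightarrow> 0"
    and "\<phi> j \<in> test_functions \<Omega>"
  using assms by (simp_all add: sobolev_approx_def)

lemma sobolev_approxI: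
  assumes "\<And>is. length is \<le> m \<Longrightarrow> has_weak_deriv \<Omega> is v (W is)"
    and "\<And>is. length is \<le> m \<Longrightarrow> W is \<in> weighted_Lp \<Omega> p s"
    and "\<And>j. \<phi> j \<in> test_functions \<Omega>"
    and "\<And>is. length is \<le> m \<Longrightarrow>
        (\<lambda>j. weighted_nn_integral \<Omega> p s (\<lambda>x. W is x - pderivs (rev is) (\<phi> j) x)) \<longlonglongrightarrow> 0"
  shows "sobolev_approx \<Omega> m p s v W \<phi>"
  using assms by (simp add: sobolev_approx_def)

text \<open>A finite sum of nonnegative terms tends to 0 exactly when each term does; the two-sided
  estimate of \<open>grad_abs\<close> then turns each term into conditions on single
  derivatives.\<close>

lemma Sobolev_norm_tendsto_0_iff:
  fixes v :: "real ^ 'n::finite \<Rightarrow> real"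
  assumes \<Omega>: "open \<Omega>" "\<Omega> \<noteq> UNIV" and p: "0 < p"
    and W: "\<And>is. length is \<le> m \<Longrightarrow> has_weak_deriv \<Omega> is v (W is)"
    and Lp: "\<And>is. length is \<le> m \<Longrightarrow> W is \<in> weighted_Lp \<Omega> p s"
    and \<phi>: "\<And>j. \<phi> j \<in> test_functions \<Omega>"
  shows "(\<lambda>j. Sobolev_norm \<Omega> m p s (\<lambda>x. v x - \<phi> j x)) \<longlonglongrightarrow> 0 \<longleftrightarrow>
    (\<forall>is. length is \<le> m \<longrightarrow>
      (\<lambda>j. weighted_nn_integral \<Omega> p s (\<lambda>x. W is x - pderivs (rev is) (\<phi> j) x)) \<longlonglongrightarrow> 0)"
proof -
  define g where "g k j = grad_abs \<Omega> k (\<lambda>x. v x - \<phi> j x)" for k j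
  define D where "D j is = (\<lambda>x. W is x - pderivs (rev is) (\<phi> j) x)" for j "is"
  have D: "has_weak_deriv \<Omega> is (\<lambda>x. v x - \<phi> j x) (D j is)" if "length is \<le> m" for j "is"
    unfolding D_def using that
    by (intro has_weak_deriv_diff_smooth \<Omega> W test_functionsD(1)[OF \<phi>]) auto
  have DLp: "D j is \<in> weighted_Lp \<Omega> p s" if "length is \<le> m" for j "is"
    using weighted_Lp_lincomb[OF Lp test_functions_weighted_Lp[OF \<Omega> p test_functions_pderivs[OF \<phi>]] p, of "is" 1 "-1" "rev is" j] that
    by (simp add: D_def)
  define C where "C k = ennreal (real (card {is :: 'n list. length is = k}) powr p)" for k
  have g1: "weighted_nn_integral \<Omega> p s (g k j) \<le> C k * (\<Sum>is | length is = k. weighted_nn_integral \<Omega> p s (D j is))"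
    if "k \<le> m" for k j
    unfolding g_def C_def using that by (intro weighted_nn_integral_grad_abs(1)[OF \<Omega>(1) p] D) simp
  have g2: "weighted_nn_integral \<Omega> p s (D j is) \<le> weighted_nn_integral \<Omega> p s (g (length is) j)"
    if "length is \<le> m" for j "is"
    unfolding g_def using that by (intro weighted_nn_integral_grad_abs(2)[OF \<Omega>(1) p] D) auto
  have gLp: "g k j \<in> weighted_Lp \<Omega> p s" if k: "k \<le> m" for k j
  proof -
    have M: "g k j \<in> borel_measurable (lebesgue_on \<Omega>)"
      unfolding g_def using k by (intro weighted_nn_integral_grad_abs(3)[where W="D j", OF \<Omega>(1) p] D) simp
    have "(\<Sum>is | length is = k. weighted_nn_integral \<Omega> p s (D j is)) < \<infinity>"
      using DLp[of _ j] k finite_lists_length[of k, where 'n='n] by (auto simp: weighted_Lp_iff less_top)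
    then have "C k * (\<Sum>is | length is = k. weighted_nn_integral \<Omega> p s (D j is)) < \<infinity>"
      by (simp add: C_def ennreal_mult_less_top)
    then show ?thesis using M le_less_trans[OF g1[OF k]] by (simp add: weighted_Lp_iff)
  qed
  note iff = weighted_Lp_norm_tendsto_0_iff[OF p gLp]
  have S: "Sobolev_norm \<Omega> m p s (\<lambda>x. v x - \<phi> j x) = (\<Sum>k\<le>m. weighted_Lp_norm \<Omega> p s (g k j))" for j
    by (simp add: Sobolev_norm_def g_def)
  have n0: "0 \<le> weighted_Lp_norm \<Omega> p s (g k j)" for k j by (simp add: weighted_Lp_norm_def)
  show ?thesis
    unfolding S D_def[symmetric]
  proof (intro iffI allI impI)
    fix "is" :: "'n list"
    assume lim: "(\<lambda>j. \<Sum>k\<le>m. weighted_Lp_norm \<Omega> p s (g k j)) \<longlonglongrightarrow> 0" and l: "length is \<le> m"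
    have le: "weighted_Lp_norm \<Omega> p s (g (length is) j) \<le> (\<Sum>k\<le>m. weighted_Lp_norm \<Omega> p s (g k j))" for j
      using l n0 by (intro member_le_sum) auto
    have "(\<lambda>j. weighted_Lp_norm \<Omega> p s (g (length is) j)) \<longlonglongrightarrow> 0"
      by (rule tendsto_sandwich[OF _ _ tendsto_const lim]) (simp_all add: n0 le)
    then have "(\<lambda>j. weighted_nn_integral \<Omega> p s (g (length is) j)) \<longlonglongrightarrow> 0"
      by (simp only: iff[OF l])
    then show "(\<lambda>j. weighted_nn_integral \<Omega> p s (D j is)) \<longlonglongrightarrow> 0"
      by (rule ennreal_tendsto_0_le[OF _ g2[OF l]])
  next
    assume lim: "\<forall>is. length is \<le> m \<longrightarrow> (\<lambda>j. weighted_nn_integral \<Omega> p s (D j is)) \<longlonglongrightarrow> 0"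
    have "(\<lambda>j. weighted_Lp_norm \<Omega> p s (g k j)) \<longlonglongrightarrow> 0" if k: "k \<le> m" for k
    proof -
      have "(\<lambda>j. C k * (\<Sum>is | length is = k. weighted_nn_integral \<Omega> p s (D j is))) \<longlonglongrightarrow> C k * (\<Sum>is :: 'n list | length is = k. 0)"
      proof (intro ennreal_tendsto_cmult tendsto_sum)
        show "(\<lambda>j. weighted_nn_integral \<Omega> p s (D j is)) \<longlonglongrightarrow> 0" if "is \<in> {is. length is = k}" for "is"
          using that k lim by simp
      qed (simp add: C_def)
      then have "(\<lambda>j. C k * (\<Sum>is | length is = k. weighted_nn_integral \<Omega> p s (D j is))) \<longlonglongrightarrow> 0"
        by simp
      then have "(\<lambda>j. weighted_nn_integral \<Omega> p s (g k j)) \<longlonglongrightarrow> 0"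
        by (rule ennreal_tendsto_0_le[OF _ g1[OF k]])
      then show ?thesis by (simp only: iff[OF k])
    qed
    then have "(\<lambda>j. \<Sum>k\<le>m. weighted_Lp_norm \<Omega> p s (g k j)) \<longlonglongrightarrow> (\<Sum>k\<le>m. 0)"
      by (intro tendsto_sum) simp
    then show "(\<lambda>j. \<Sum>k\<le>m. weighted_Lp_norm \<Omega> p s (g k j)) \<longlonglongrightarrow> 0" by simp
  qed
qed

lemma weighted_Sobolev0I:
  fixes v :: "real ^ 'n::finite \<Rightarrow> real"
  assumes \<Omega>: "open \<Omega>" "\<Omega> \<noteq> UNIV" and p: "1 \<le> p"
    and A: "sobolev_approx \<Omega> m p s v W \<phi>"
  shows "v \<in> weighted_Sobolev0 \<Omega> m p s"
proof -
  have p0: "0 < p" using p by simp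
  note W = sobolev_approxD(1)[OF A] and Lp = sobolev_approxD(2)[OF A]
    and lim = sobolev_approxD(3)[OF A] and \<phi> = sobolev_approxD(4)[OF A]
  have "v \<in> weighted_Sobolev \<Omega> m p s"
    unfolding weighted_Sobolev_def
  proof (intro CollectI allI impI conjI)
    fix "is" :: "'n list" assume l: "length is \<le> m"
    show "\<exists>w. has_weak_deriv \<Omega> is v w" using W[OF l] by blast
    show "weak_deriv \<Omega> is v \<in> weighted_Lp \<Omega> p s"
      using weighted_Lp_AE_cong[OF Lp[OF l] weak_deriv_AE_eq[OF \<Omega>(1) W[OF l]]]
        has_weak_deriv_measurable[OF \<Omega>(1) has_weak_deriv_weak_deriv[OF W[OF l]]] by blast
  qed
  moreover have "(\<lambda>j. Sobolev_norm \<Omega> m p s (\<lambda>x. v x - \<phi> j x)) \<longlonglongrightarrow> 0"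
    by (subst Sobolev_norm_tendsto_0_iff[OF \<Omega> p0 W Lp \<phi>]) (simp_all add: lim)
  ultimately show ?thesis unfolding weighted_Sobolev0_def using \<phi> by auto
qed

lemma weighted_Sobolev0E:
  fixes v :: "real ^ 'n::finite \<Rightarrow> real"
  assumes \<Omega>: "open \<Omega>" "\<Omega> \<noteq> UNIV" and p: "1 \<le> p" and v: "v \<in> weighted_Sobolev0 \<Omega> m p s"
  obtains W \<phi> where "sobolev_approx \<Omega> m p s v W \<phi>"
proof -
  have p0: "0 < p" using p by simp
  obtain \<phi> where \<phi>: "\<And>j. \<phi> j \<in> test_functions \<Omega>"
    and lim: "(\<lambda>j. Sobolev_norm \<Omega> m p s (\<lambda>x. v x - \<phi> j x)) \<longlonglongrightarrow> 0"
    using v by (auto simp: weighted_Sobolev0_def)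
  define W where "W is = weak_deriv \<Omega> is v" for "is"
  have W: "has_weak_deriv \<Omega> is v (W is)" and Lp: "W is \<in> weighted_Lp \<Omega> p s"
    if "length is \<le> m" for "is"
  proof -
    from v that obtain w where "has_weak_deriv \<Omega> is v w" "weak_deriv \<Omega> is v \<in> weighted_Lp \<Omega> p s"
      by (auto simp: weighted_Sobolev0_def weighted_Sobolev_def)
    then show "has_weak_deriv \<Omega> is v (W is)" "W is \<in> weighted_Lp \<Omega> p s"
      using has_weak_deriv_weak_deriv by (auto simp: W_def)
  qed
  note lim' = iffD1[OF Sobolev_norm_tendsto_0_iff[OF \<Omega> p0 W Lp \<phi>] lim, rule_format]
  have "sobolev_approx \<Omega> m p s v W \<phi>"
    by (rule sobolev_approxI[OF W Lp \<phi> lim'])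
  then show ?thesis by (rule that)
qed

lemma weighted_Sobolev0_lincomb:
  fixes v v' :: "real ^ 'n::finite \<Rightarrow> real"
  assumes \<Omega>: "open \<Omega>" "\<Omega> \<noteq> UNIV" and p1: "1 \<le> p"
    and v: "v \<in> weighted_Sobolev0 \<Omega> m p s" and v': "v' \<in> weighted_Sobolev0 \<Omega> m p s"
  shows "(\<lambda>x. c * v x + e * v' x) \<in> weighted_Sobolev0 \<Omega> m p s"
proof -
  have p: "0 < p" using p1 by simp
  obtain W \<phi> where A: "sobolev_approx \<Omega> m p s v W \<phi>"
    using weighted_Sobolev0E[OF \<Omega> p1 v] by blast
  obtain W' \<phi>' where A': "sobolev_approx \<Omega> m p s v' W' \<phi>'"
    using weighted_Sobolev0E[OF \<Omega> p1 v'] by blast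
  note W = sobolev_approxD(1,2)[OF A] and lim = sobolev_approxD(3)[OF A] and \<phi> = sobolev_approxD(4)[OF A]
  note W' = sobolev_approxD(1,2)[OF A'] and lim' = sobolev_approxD(3)[OF A'] and \<phi>' = sobolev_approxD(4)[OF A']
  show ?thesis
  proof (rule weighted_Sobolev0I[OF \<Omega> p1 sobolev_approxI, where W="\<lambda>is x. c * W is x + e * W' is x"
        and \<phi>="\<lambda>j x. c * \<phi> j x + e * \<phi>' j x"])
    fix "is" :: "'n list" assume l: "length is \<le> m"
    show "has_weak_deriv \<Omega> is (\<lambda>x. c * v x + e * v' x) (\<lambda>x. c * W is x + e * W' is x)"
      by (intro has_weak_deriv_lincomb \<Omega> W W' l)
    show "(\<lambda>x. c * W is x + e * W' is x) \<in> weighted_Lp \<Omega> p s"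
      by (intro weighted_Lp_lincomb W W' l p)
    define D where "D j = (\<lambda>x. W is x - pderivs (rev is) (\<phi> j) x)" for j
    define D' where "D' j = (\<lambda>x. W' is x - pderivs (rev is) (\<phi>' j) x)" for j
    have [measurable]: "D j \<in> borel_measurable (lebesgue_on \<Omega>)" "D' j \<in> borel_measurable (lebesgue_on \<Omega>)" for j
      unfolding D_def D'_def
      using W(2)[OF l] W'(2)[OF l] test_functions_weighted_Lp[OF \<Omega> p test_functions_pderivs[OF \<phi>]]
        test_functions_weighted_Lp[OF \<Omega> p test_functions_pderivs[OF \<phi>']]
      by (auto simp: weighted_Lp_iff intro!: borel_measurable_diff)
    have eq: "(\<lambda>x. c * W is x + e * W' is x - pderivs (rev is) (\<lambda>x. c * \<phi> j x + e * \<phi>' j x) x)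
       = (\<lambda>x. c * D j x + e * D' j x)" for j
    proof -
      have sm: "smooth (\<lambda>x. c * \<phi> j x)" "smooth (\<lambda>x. e * \<phi>' j x)"
        using test_functionsD(1)[OF \<phi>] test_functionsD(1)[OF \<phi>'] by (auto intro: smooth_mult smooth_const)
      show ?thesis
        unfolding pderivs_add[OF sm] pderivs_cmult[OF test_functionsD(1)[OF \<phi>]] pderivs_cmult[OF test_functionsD(1)[OF \<phi>']]
        by (auto simp: D_def D'_def algebra_simps)
    qed
    have le: "weighted_nn_integral \<Omega> p s (\<lambda>x. c * D j x + e * D' j x) \<le> ennreal (2 powr p) *
       (ennreal (\<bar>c\<bar> powr p) * weighted_nn_integral \<Omega> p s (D j) + ennreal (\<bar>e\<bar> powr p) * weighted_nn_integral \<Omega> p s (D' j))" for j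
      using weighted_nn_integral_add[of "\<lambda>x. c * D j x" \<Omega> "\<lambda>x. e * D' j x" p s] p
      by (simp add: weighted_nn_integral_cmult)
    have "(\<lambda>j. ennreal (2 powr p) *
       (ennreal (\<bar>c\<bar> powr p) * weighted_nn_integral \<Omega> p s (D j) + ennreal (\<bar>e\<bar> powr p) * weighted_nn_integral \<Omega> p s (D' j)))
      \<longlonglongrightarrow> ennreal (2 powr p) * (ennreal (\<bar>c\<bar> powr p) * 0 + ennreal (\<bar>e\<bar> powr p) * 0)"
      unfolding D_def D'_def using lim[OF l] lim'[OF l] by (intro ennreal_tendsto_cmult tendsto_add) auto
    then have "(\<lambda>j. ennreal (2 powr p) *
       (ennreal (\<bar>c\<bar> powr p) * weighted_nn_integral \<Omega> p s (D j) + ennreal (\<bar>e\<bar> powr p) * weighted_nn_integral \<Omega> p s (D' j)))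
      \<longlonglongrightarrow> 0" by simp
    then have "(\<lambda>j. weighted_nn_integral \<Omega> p s (\<lambda>x. c * D j x + e * D' j x)) \<longlonglongrightarrow> 0"
      by (rule ennreal_tendsto_0_le[OF _ le])
    then show "(\<lambda>j. weighted_nn_integral \<Omega> p s (\<lambda>x. c * W is x + e * W' is x -
         pderivs (rev is) (\<lambda>x. c * \<phi> j x + e * \<phi>' j x) x)) \<longlonglongrightarrow> 0"
      by (simp only: eq)
  qed (intro test_functions_add test_functions_cmult \<phi> \<phi>')
qed

text \<open>The common majorant \<open>G\<close> lets both the weak derivative identities and the
  weighted norms pass to the limit by dominated convergence. This is the device that places an
  infinite sum of bumps in the completion. \<open>V\<close> is indexed in the classical order of
  directions, hence the reversals in the proof.\<close>

lemma weighted_Sobolev0_dominated: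
  fixes f :: "nat \<Rightarrow> real ^ 'n::finite \<Rightarrow> real"
  assumes \<Omega>: "open \<Omega>" "\<Omega> \<noteq> UNIV" and p1: "1 \<le> p"
    and f: "\<And>j. f j \<in> test_functions \<Omega>"
    and G: "G \<in> weighted_Lp \<Omega> p s"
    and bound: "\<And>is j. length is \<le> m \<Longrightarrow> AE x in lebesgue_on \<Omega>. \<bar>pderivs is (f j) x\<bar> \<le> G x"
    and V: "\<And>is. length is \<le> m \<Longrightarrow> V is \<in> borel_measurable (lebesgue_on \<Omega>)"
    and lim: "\<And>is. length is \<le> m \<Longrightarrow> AE x in lebesgue_on \<Omega>. (\<lambda>j. pderivs is (f j) x) \<longlonglongrightarrow> V is x"
  shows "V [] \<in> weighted_Sobolev0 \<Omega> m p s"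
proof -
  have p: "0 < p" using p1 by simp
  have Vb: "AE x in lebesgue_on \<Omega>. \<bar>V is x\<bar> \<le> G x" if l: "length is \<le> m" for "is"
  proof -
    have "AE x in lebesgue_on \<Omega>. \<forall>j. \<bar>pderivs is (f j) x\<bar> \<le> G x"
      using bound[OF l] by (simp add: AE_all_countable)
    then show ?thesis using lim[OF l]
    proof eventually_elim
      case (elim x)
      then have "(\<lambda>j. \<bar>pderivs is (f j) x\<bar>) \<longlonglongrightarrow> \<bar>V is x\<bar>" by (intro tendsto_intros)
      then show ?case using elim(1) by (intro LIMSEQ_le_const2) auto
    qed
  qed
  have VLp: "V is \<in> weighted_Lp \<Omega> p s" if l: "length is \<le> m" for "is"
  proof -
    have "AE x in lebesgue_on \<Omega>. \<bar>V is x\<bar> \<le> \<bar>G x\<bar>" using Vb[OF l] by eventually_elim auto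
    then have "weighted_nn_integral \<Omega> p s (V is) \<le> weighted_nn_integral \<Omega> p s G"
      using p by (intro weighted_nn_integral_mono_AE) auto
    then show ?thesis using V[OF l] G by (auto simp: weighted_Lp_iff dest: le_less_trans)
  qed
  have pm: "pderivs is (f j) \<in> borel_measurable (lebesgue_on \<Omega>)" for "is" j
    by (intro borel_measurable_lebesgue_onI smooth_borel_measurable smooth_pderivs test_functionsD(1)[OF f])
  have conv: "(\<lambda>j. LINT x|lebesgue_on \<Omega>. pderivs is (f j) x * \<psi> x) \<longlonglongrightarrow> (LINT x|lebesgue_on \<Omega>. V is x * \<psi> x)"
    if l: "length is \<le> m" and \<psi>: "\<psi> \<in> test_functions \<Omega>" for "is" \<psi>
  proof (rule integral_dominated_convergence[where w="\<lambda>x. \<bar>G x * \<psi> x\<bar>"])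
    have \<psi>m: "\<psi> \<in> borel_measurable (lebesgue_on \<Omega>)"
      by (intro borel_measurable_lebesgue_onI smooth_borel_measurable test_functionsD(1)[OF \<psi>])
    show "(\<lambda>x. V is x * \<psi> x) \<in> borel_measurable (lebesgue_on \<Omega>)"
      "(\<lambda>x. pderivs is (f j) x * \<psi> x) \<in> borel_measurable (lebesgue_on \<Omega>)" for j
      using V[OF l] \<psi>m pm by (auto intro: borel_measurable_times)
    show "integrable (lebesgue_on \<Omega>) (\<lambda>x. \<bar>G x * \<psi> x\<bar>)"
      by (intro integrable_abs locally_integrable_times_test weighted_Lp_locally_integrable[OF \<Omega> G p1] \<psi> \<Omega>)
    show "AE x in lebesgue_on \<Omega>. (\<lambda>j. pderivs is (f j) x * \<psi> x) \<longlonglongrightarrow> V is x * \<psi> x"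
      using lim[OF l] by eventually_elim (intro tendsto_intros)
    show "AE x in lebesgue_on \<Omega>. norm (pderivs is (f j) x * \<psi> x) \<le> \<bar>G x * \<psi> x\<bar>" for j
      using bound[OF l, of j] by eventually_elim (auto simp: abs_mult intro!: mult_right_mono)
  qed
  show ?thesis
  proof (rule weighted_Sobolev0I[OF \<Omega> p1 sobolev_approxI, where W="\<lambda>is. V (rev is)" and \<phi>=f])
    fix "is" :: "'n list" assume l: "length is \<le> m"
    then have l': "length (rev is) \<le> m" by simp
    show "V (rev is) \<in> weighted_Lp \<Omega> p s" by (rule VLp[OF l'])
    show "has_weak_deriv \<Omega> is (V []) (V (rev is))"
      unfolding has_weak_deriv_def
    proof (intro conjI ballI weighted_Lp_locally_integrable[OF \<Omega> VLp p1] l')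
      fix \<psi> assume \<psi>: "\<psi> \<in> test_functions \<Omega>"
      have c1: "(\<lambda>j. LINT x|lebesgue_on \<Omega>. pderivs [] (f j) x * pderivs is \<psi> x) \<longlonglongrightarrow> (LINT x|lebesgue_on \<Omega>. V [] x * pderivs is \<psi> x)"
        by (rule conv) (auto intro: test_functions_pderivs[OF \<psi>])
      have c2: "(LINT x|lebesgue_on \<Omega>. pderivs [] (f j) x * pderivs is \<psi> x) =
          (- 1) ^ length is * (LINT x|lebesgue_on \<Omega>. pderivs (rev is) (f j) x * \<psi> x)" for j
        using smooth_has_weak_deriv[OF test_functionsD(1)[OF f] \<Omega>(1), of "is" j] \<psi>
        by (simp add: has_weak_deriv_def)
      have c3: "(\<lambda>j. (- 1) ^ length is * (LINT x|lebesgue_on \<Omega>. pderivs (rev is) (f j) x * \<psi> x)) \<longlonglongrightarrow>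
          (- 1) ^ length is * (LINT x|lebesgue_on \<Omega>. V (rev is) x * \<psi> x)"
        by (intro tendsto_mult_left conv l' \<psi>)
      show "(LINT x|lebesgue_on \<Omega>. V [] x * pderivs is \<psi> x) =
          (- 1) ^ length is * (LINT x|lebesgue_on \<Omega>. V (rev is) x * \<psi> x)"
        by (rule LIMSEQ_unique[OF c1[unfolded c2] c3])
    qed simp
    have [measurable]: "V (rev is) \<in> borel_measurable (lebesgue_on \<Omega>)" "pderivs (rev is) (f j) \<in> borel_measurable (lebesgue_on \<Omega>)"
        "G \<in> borel_measurable (lebesgue_on \<Omega>)" for j
      using V[OF l'] pm G by (auto simp: weighted_Lp_iff)
    have "(\<lambda>j. \<integral>\<^sup>+ x. ennreal (\<bar>V (rev is) x - pderivs (rev is) (f j) x\<bar> powr p * bdist \<Omega> x powr s) \<partial>lebesgue_on \<Omega>)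
       \<longlonglongrightarrow> (\<integral>\<^sup>+ x. 0 \<partial>lebesgue_on \<Omega>)"
    \<comment> \<open>The approximant and the limit are both bounded by \<open>G\<close>, so
      \<open>2 * G\<close> dominates their difference.\<close>
    proof (rule nn_integral_dominated_convergence[where w="\<lambda>x. ennreal (\<bar>2 * G x\<bar> powr p * bdist \<Omega> x powr s)"])
      have "(\<lambda>x. 2 * G x + 0 * G x) \<in> weighted_Lp \<Omega> p s" by (intro weighted_Lp_lincomb G p)
      then show "(\<integral>\<^sup>+ x. ennreal (\<bar>2 * G x\<bar> powr p * bdist \<Omega> x powr s) \<partial>lebesgue_on \<Omega>) < \<infinity>"
        by (simp add: weighted_Lp_iff weighted_nn_integral_def)
      show "AE x in lebesgue_on \<Omega>. ennreal (\<bar>V (rev is) x - pderivs (rev is) (f j) x\<bar> powr p * bdist \<Omega> x powr s)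
         \<le> ennreal (\<bar>2 * G x\<bar> powr p * bdist \<Omega> x powr s)" for j
        using bound[OF l', of j] Vb[OF l']
        by eventually_elim (use p in \<open>auto intro!: ennreal_leI mult_right_mono powr_mono2\<close>)
      show "AE x in lebesgue_on \<Omega>. (\<lambda>j. ennreal (\<bar>V (rev is) x - pderivs (rev is) (f j) x\<bar> powr p * bdist \<Omega> x powr s)) \<longlonglongrightarrow> 0"
        using lim[OF l']
      proof eventually_elim
        case (elim x)
        then have "(\<lambda>j. \<bar>V (rev is) x - pderivs (rev is) (f j) x\<bar>) \<longlonglongrightarrow> \<bar>V (rev is) x - V (rev is) x\<bar>"
          by (intro tendsto_intros)
        then have "(\<lambda>j. \<bar>V (rev is) x - pderivs (rev is) (f j) x\<bar> powr p) \<longlonglongrightarrow> 0"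
          using p by (intro tendsto_zero_powrI[where b=p]) auto
        then have "(\<lambda>j. \<bar>V (rev is) x - pderivs (rev is) (f j) x\<bar> powr p * bdist \<Omega> x powr s) \<longlonglongrightarrow> 0"
          by (rule tendsto_mult_left_zero)
        then show ?case by (intro tendsto_ennrealI[where x=0, simplified])
      qed
    qed auto
    then show "(\<lambda>j. weighted_nn_integral \<Omega> p s (\<lambda>x. V (rev is) x - pderivs (rev is) (f j) x)) \<longlonglongrightarrow> 0"
      by (simp add: weighted_nn_integral_def)
  qed (rule f)
qed

section \<open>Whitney bumps\<close>

lemma finite_lists_of_length_le: "finite {is :: 'n::finite list. length is \<le> m}"
  using finite_lists_length_le[of "UNIV :: 'n set" m] by simp

lemma flat0_mono: "a \<le> b \<Longrightarrow> flat 0 a \<le> flat 0 b"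
  by (auto simp: flat_def frac_le)

text \<open>Volume comparison: the disjoint balls of radius \<open>\<epsilon>\<close> all lie in the
  ball of radius \<open>2 * R\<close> about \<open>x\<close>.\<close>

lemma card_le_dist_disjoint_balls:
  fixes x :: "'a::euclidean_space"
  assumes "finite F" "0 < \<epsilon>" "\<epsilon> \<le> R" "\<And>z. z \<in> F \<Longrightarrow> dist x z \<le> R"
    and disj: "pairwise (\<lambda>y z. disjnt (ball y \<epsilon>) (ball z \<epsilon>)) F"
  shows "real (card F) \<le> (2 * R / \<epsilon>) ^ DIM('a)"
proof -
  let ?v = "measure lborel (ball (0::'a) 1)"
  have v: "?v > 0" by (simp add: content_ball_pos)
  have "real (card F) * (\<epsilon> ^ DIM('a) * ?v) = (\<Sum>z\<in>F. measure lebesgue (ball z \<epsilon>))"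
    using assms(2) by (simp add: content_ball_conv_unit_ball[of \<epsilon>])
  also have "\<dots> = measure lebesgue (\<Union>z\<in>F. ball z \<epsilon>)"
    using assms(1) disj
    by (intro measure_negligible_finite_Union_image[symmetric]) (auto simp: pairwise_def disjnt_def)
  also have "\<dots> \<le> measure lebesgue (ball x (2 * R))"
  proof (intro measure_mono_fmeasurable)
    show "(\<Union>z\<in>F. ball z \<epsilon>) \<subseteq> ball x (2 * R)"
    proof
      fix y assume "y \<in> (\<Union>z\<in>F. ball z \<epsilon>)"
      then obtain z where "z \<in> F" "dist z y < \<epsilon>" by auto
      then show "y \<in> ball x (2 * R)" using assms(3) assms(4)[of z] dist_triangle[of x y z] by auto
    qed
  qed (use assms(1) in auto)
  also have "\<dots> = (2 * R) ^ DIM('a) * ?v"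
    using assms(2,3) by (simp add: content_ball_conv_unit_ball[of "2 * R"])
  finally have "real (card F) * \<epsilon> ^ DIM('a) \<le> (2 * R) ^ DIM('a)"
    using v by (simp add: mult.assoc[symmetric])
  then show ?thesis using assms(2) by (simp add: power_divide field_simps)
qed

text \<open>The cap keeps the surplus powers of the distance bounded when fewer than
  \<open>m\<close> derivatives are taken. For \<open>E = UNIV\<close> the complement is empty and
  \<open>infdist\<close> is 0 by convention, which is why positivity is stated for
  \<open>E \<noteq> UNIV\<close>.\<close>

definition capped_dist :: "'a::euclidean_space set \<Rightarrow> 'a \<Rightarrow> real" where
  "capped_dist E x = min 1 (infdist x (- E))"

lemma capped_dist_nonneg: "0 \<le> capped_dist E x"
  by (simp add: capped_dist_def infdist_nonneg)

lemma capped_dist_lipschitz: "capped_dist E x \<le> capped_dist E y + dist x y"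
  using infdist_triangle[of x "- E" y] zero_le_dist[of x y] unfolding capped_dist_def by linarith

lemma capped_dist_pos:
  assumes "open E" "E \<noteq> UNIV" "x \<in> E"
  shows "0 < capped_dist E x"
  using assms infdist_pos_not_in_closed[of "- E" x] by (auto simp: capped_dist_def closed_Compl)

lemma capped_dist_ball_subset:
  assumes "dist x y < capped_dist E x"
  shows "y \<in> E"
proof (rule ccontr)
  assume "y \<notin> E"
  then have "infdist x (- E) \<le> dist x y" by (intro infdist_le) auto
  then show False using assms by (simp add: capped_dist_def)
qed

lemma ball_subset_imp_le_capped_dist:
  assumes "ball x t \<subseteq> E" "t \<le> 1" "E \<noteq> UNIV"
  shows "t \<le> capped_dist E x"
proof -
  have "t \<le> infdist x (- E)"
  proof -
    have "t \<le> dist x y" if "y \<in> - E" for y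
      using assms(1) that by (meson ComplD in_mono mem_ball not_le)
    then show ?thesis
      using assms(3) by (subst infdist_notempty) (auto intro!: cINF_greatest)
  qed
  then show ?thesis using assms(2) by (simp add: capped_dist_def)
qed

lemma model_bump:
  obtains \<eta> :: "real ^ 'n::finite \<Rightarrow> real" where
    "smooth \<eta>" "\<And>x. 0 \<le> \<eta> x" "{x. \<eta> x \<noteq> 0} \<subseteq> cball 0 (1 / 2)"
    "\<And>x. norm x \<le> 1 / (4 * real CARD('n)) \<Longrightarrow> 1 \<le> \<eta> x"
proof -
  define N where "N = real CARD('n)"
  have N: "1 \<le> N" unfolding N_def by (simp add: Suc_leI)
  \<comment> \<open>Chosen so that the absolute values of the coordinates of a point of the box add
    up to at most 1/2, which puts the box inside the ball of radius 1/2.\<close>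
  define h :: "real ^ 'n" where "h = (\<chi> i. 1 / (2 * N))"
  \<comment> \<open>A lower bound for the box bump on the inner ball, where each coordinate keeps
    distance \<open>1 / (4 * N)\<close> from both faces; dividing by it normalises the bump to be at
    least 1 there.\<close>
  define \<kappa> where "\<kappa> = (\<Prod>i\<in>(UNIV::'n set). flat 0 (1 / (4 * N)) * flat 0 (1 / (4 * N)))"
  have \<kappa>: "\<kappa> > 0" unfolding \<kappa>_def using N by (intro prod_pos) (auto simp: flat_def)
  define \<eta> where "\<eta> x = (1 / \<kappa>) * box_bump 1 (- h) h x" for x
  show ?thesis
  proof (rule that)
    show "smooth \<eta>" unfolding \<eta>_def by (intro smooth_mult smooth_const smooth_box_bump)
    show "0 \<le> \<eta> x" for x using \<kappa> box_bump_nonneg[of 1 "- h" h x] by (simp add: \<eta>_def)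
    show "{x. \<eta> x \<noteq> 0} \<subseteq> cball 0 (1 / 2)"
    proof
      fix x assume "x \<in> {x. \<eta> x \<noteq> 0}"
      then have "x \<in> box (- h) h" using box_bump_eq_0[of 1 x "- h" h] by (auto simp: \<eta>_def)
      then have "\<bar>x $ i\<bar> \<le> 1 / (2 * N)" for i by (smt (verit) h_def mem_box_cart(1) vec_lambda_beta vector_uminus_component)
      then have "(\<Sum>i\<in>UNIV. \<bar>x $ i\<bar>) \<le> (\<Sum>i\<in>(UNIV::'n set). 1 / (2 * N))" by (intro sum_mono)
      also have "\<dots> = 1 / 2" using N by (simp add: N_def)
      finally show "x \<in> cball 0 (1 / 2)" using norm_le_l1_cart[of x] by simp
    qed
    fix x :: "real ^ 'n" assume "norm x \<le> 1 / (4 * real CARD('n))"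
    then have "\<bar>x $ i\<bar> \<le> 1 / (4 * N)" for i
      using component_le_norm_cart[of x i] by (simp add: N_def)
    moreover have "1 / (4 * N) + 1 / (4 * N) = 1 / (2 * N)" by simp
    ultimately have *: "1 / (4 * N) \<le> x $ i + 1 / (2 * N)" "1 / (4 * N) \<le> 1 / (2 * N) - x $ i" for i
      by (smt (verit))+
    have "\<kappa> \<le> box_bump 1 (- h) h x"
      unfolding \<kappa>_def box_bump_def
      using * by (intro prod_mono conjI mult_mono mult_nonneg_nonneg flat0_mono flat0_bounds) (auto simp: h_def)
    then show "1 \<le> \<eta> x" using \<kappa> by (simp add: \<eta>_def)
  qed
qed

lemma smooth_bounded_derivs:
  fixes f :: "real ^ 'n::finite \<Rightarrow> real"
  assumes "f \<in> test_functions \<Omega>"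
  obtains B where "B > 0" "\<And>is x. length is \<le> m \<Longrightarrow> \<bar>pderivs is f x\<bar> \<le> B"
proof -
  have "\<forall>is. \<exists>B>0. \<forall>x. \<bar>pderivs is f x\<bar> \<le> B"
    using test_functions_bounded[OF test_functions_pderivs[OF assms]] by metis
  then obtain b where b: "\<And>is. b is > 0" "\<And>is x. \<bar>pderivs is f x\<bar> \<le> b is" by metis
  note fin = finite_lists_of_length_le[of m, where 'n='n]
  show ?thesis
  proof (rule that)
    show "(\<Sum>is | length is \<le> m. b is) > 0"
      using b(1) fin by (intro sum_pos) (auto intro: exI[of _ "[]"])
    fix "is" :: "'n list" and x assume "length is \<le> m"
    then have "b is \<le> (\<Sum>is | length is \<le> m. b is)"
      using b(1) fin by (intro member_le_sum) (auto intro: less_imp_le)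
    then show "\<bar>pderivs is f x\<bar> \<le> (\<Sum>is | length is \<le> m. b is)"
      using b(2)[of "is" x] by linarith
  qed
qed

text \<open>Each ball of a Vitali cover of \<open>E\<close> carries a copy of the model bump,
  rescaled to the size \<open>\<delta> z\<close> of its centre and with height of order
  \<open>\<delta> z ^ m\<close>; a derivative of order \<open>k\<close> costs
  \<open>\<delta> z ^ k\<close>, which the height can pay. Only boundedly many bumps are alive at
  one point, because the balls are disjoint and those that matter are comparable in size and close
  by. That \<open>C\<close> does not depend on \<open>E\<close> allows one constant for all level
  sets.\<close>

lemma whitney_bumps:
  fixes m :: nat
  obtains C where "C > 0"
    "\<And>E :: (real ^ 'n::finite) set. open E \<Longrightarrow> E \<noteq> UNIV \<Longrightarrow>
      \<exists>b :: nat \<Rightarrow> real ^ 'n \<Rightarrow> real.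
        (\<forall>n. b n \<in> test_functions E) \<and> (\<forall>n x. 0 \<le> b n x) \<and>
        (\<forall>is x M. length is \<le> m \<longrightarrow> (\<Sum>n<M. \<bar>pderivs is (b n) x\<bar>) \<le> C * indicator E x) \<and>
        (\<forall>x\<in>E. \<exists>n. capped_dist E x ^ m \<le> b n x)"
proof -
  define N where "N = real CARD('n)"
  have N: "1 \<le> N" unfolding N_def by (simp add: Suc_leI)
  obtain \<eta> :: "real ^ 'n \<Rightarrow> real" where sm: "smooth \<eta>" and \<eta>0: "\<And>x. 0 \<le> \<eta> x"
    and supp: "{x. \<eta> x \<noteq> 0} \<subseteq> cball 0 (1 / 2)"
    and \<eta>1: "\<And>x. norm x \<le> 1 / (4 * real CARD('n)) \<Longrightarrow> 1 \<le> \<eta> x"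
    using model_bump by blast
  have \<eta>T: "\<eta> \<in> test_functions UNIV"
    using supp by (intro test_functionsI[OF sm, where K="cball 0 (1/2)"]) auto
  obtain B where B: "B > 0" "\<And>is x. length is \<le> m \<Longrightarrow> \<bar>pderivs is \<eta> x\<bar> \<le> B"
    using smooth_bounded_derivs[OF \<eta>T] by blast
  have supp': "pderivs is \<eta> x = 0" if "norm x > 1 / 2" for "is" x
  proof -
    have "closure {x. \<eta> x \<noteq> 0} \<subseteq> cball 0 (1 / 2)" using supp by (intro closure_minimal) auto
    then show ?thesis using that by (intro pderivs_eq_0_outside) auto
  qed
  \<comment> \<open>The packing bound for balls of radius \<open>\<delta> x / (30 * N)\<close> whose
    centres lie within \<open>\<delta> x\<close> of \<open>x\<close>.\<close>
  define Q where "Q = (60 * N) ^ CARD('n)"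
  define C where "C = Q * (2 ^ m * B)"
  have Q: "Q > 0" using N by (simp add: Q_def)
  have C: "C > 0" using Q B by (simp add: C_def)
  have key: "\<exists>b :: nat \<Rightarrow> real ^ 'n \<Rightarrow> real.
        (\<forall>n. b n \<in> test_functions E) \<and> (\<forall>n x. 0 \<le> b n x) \<and>
        (\<forall>is x M. length is \<le> m \<longrightarrow> (\<Sum>n<M. \<bar>pderivs is (b n) x\<bar>) \<le> C * indicator E x) \<and>
        (\<forall>x\<in>E. \<exists>n. capped_dist E x ^ m \<le> b n x)"
    if E: "open E" "E \<noteq> UNIV" for E :: "(real ^ 'n) set"
  proof -
    define \<delta> where "\<delta> = capped_dist E"
    have \<delta>pos: "0 < \<delta> z" if "z \<in> E" for z using that E capped_dist_pos by (simp add: \<delta>_def)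
    have \<delta>1: "\<delta> z \<le> 1" for z by (simp add: \<delta>_def capped_dist_def)
    have lip: "\<delta> x \<le> \<delta> y + dist x y" for x y unfolding \<delta>_def by (rule capped_dist_lipschitz)
    \<comment> \<open>The fivefold ball then has radius \<open>\<delta> z / (4 * N)\<close>, which
      is where the rescaled model bump is at least 1.\<close>
    define r where "r z = \<delta> z / (20 * N)" for z
    have rpos: "0 < r z" if "z \<in> E" for z using \<delta>pos[OF that] N by (simp add: r_def)
    obtain D where D: "countable D" "D \<subseteq> E"
      and disj: "pairwise (\<lambda>i j. disjnt (ball i (r i)) (ball j (r j))) D"
      and cov: "E \<subseteq> (\<Union>i\<in>D. ball i (5 * r i))"
    proof (rule Vitali_covering_lemma_balls[where S=E and K=E and a="\<lambda>z. z" and r=r and B=1])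
      show "E \<subseteq> (\<Union>i\<in>E. ball i (r i))" using rpos by force
      show "0 < r i \<and> r i \<le> 1" if "i \<in> E" for i
      proof -
        have "\<delta> i \<le> 20 * N" using \<delta>1[of i] N by linarith
        then show ?thesis using rpos[OF that] N by (simp add: r_def)
      qed
    qed (rule that; assumption)
    \<comment> \<open>The factor 2 in the height is needed because a point \<open>x\<close> of the
      fivefold ball is only known to satisfy \<open>\<delta> x \<le> 2 * \<delta> z\<close>.\<close>
    define \<beta> where "\<beta> z x = (2 * \<delta> z) ^ m * \<eta> ((1 / \<delta> z) *\<^sub>R (x - z))" for z x
    have \<beta>0: "0 \<le> \<beta> z x" for z x
      using \<eta>0 capped_dist_nonneg[of E z] by (simp add: \<beta>_def \<delta>_def)
    have nrm: "norm ((1 / \<delta> z) *\<^sub>R (x - z)) = dist x z / \<delta> z" if "z \<in> E" for x z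
      using \<delta>pos[OF that] by (simp only: norm_scaleR dist_norm) simp
    have \<beta>T: "\<beta> z \<in> test_functions E" if z: "z \<in> E" for z
    proof (rule test_functionsI[where K="cball z (\<delta> z / 2)"])
      show "smooth (\<beta> z)" unfolding \<beta>_def by (intro smooth_mult smooth_const smooth_affine sm)
      show "{x. \<beta> z x \<noteq> 0} \<subseteq> cball z (\<delta> z / 2)"
      proof
        fix x assume "x \<in> {x. \<beta> z x \<noteq> 0}"
        then have "norm ((1 / \<delta> z) *\<^sub>R (x - z)) \<le> 1 / 2" using supp by (auto simp: \<beta>_def simp del: scaleR_diff_right norm_scaleR)
        then show "x \<in> cball z (\<delta> z / 2)" using \<delta>pos[OF z] unfolding nrm[OF z] by (simp add: dist_commute field_simps)
      qed
      show "cball z (\<delta> z / 2) \<subseteq> E"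
        using capped_dist_ball_subset[of z _ E] \<delta>pos[OF z] by (force simp: \<delta>_def)
    qed auto
    have \<beta>d: "\<bar>pderivs is (\<beta> z) x\<bar> \<le> (if dist x z \<le> \<delta> z / 2 then 2 ^ m * B else 0)"
      if z: "z \<in> E" and l: "length is \<le> m" for z "is" x
    proof -
      have eq: "pderivs is (\<beta> z) x = (2 * \<delta> z) ^ m * ((1 / \<delta> z) ^ length is * pderivs is \<eta> ((1 / \<delta> z) *\<^sub>R (x - z)))"
        unfolding \<beta>_def pderivs_cmult[OF smooth_affine[OF sm]] pderivs_affine[OF sm] ..
      show ?thesis
      proof (cases "dist x z \<le> \<delta> z / 2")
        case True
        \<comment> \<open>The height pays for \<open>length is \<le> m\<close> derivatives; the
          surplus power of \<open>\<delta> z \<le> 1\<close> is dropped.\<close>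
        have "(2 * \<delta> z) ^ m * (1 / \<delta> z) ^ length is = 2 ^ m * \<delta> z ^ (m - length is)"
          using \<delta>pos[OF z] l by (simp add: power_mult_distrib power_one_over power_diff)
        also have "\<dots> \<le> 2 ^ m * 1" using \<delta>1[of z] \<delta>pos[OF z] by (intro mult_left_mono power_le_one) auto
        finally have c: "(2 * \<delta> z) ^ m * (1 / \<delta> z) ^ length is \<le> 2 ^ m" by simp
        have "\<bar>pderivs is (\<beta> z) x\<bar> = ((2 * \<delta> z) ^ m * (1 / \<delta> z) ^ length is) * \<bar>pderivs is \<eta> ((1 / \<delta> z) *\<^sub>R (x - z))\<bar>"
          using \<delta>pos[OF z] by (simp add: eq abs_mult)
        also have "\<dots> \<le> 2 ^ m * B" using c B(2)[OF l] B(1) by (intro mult_mono) auto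
        finally show ?thesis using True by simp
      next
        case False
        then have "norm ((1 / \<delta> z) *\<^sub>R (x - z)) > 1 / 2"
          using \<delta>pos[OF z] unfolding nrm[OF z] by (simp add: field_simps)
        then show ?thesis using False by (simp add: eq supp' del: scaleR_diff_right)
      qed
    qed
    have overlap: "real (card {z \<in> F. dist x z \<le> \<delta> z / 2}) \<le> Q * indicator E x"
      if F: "finite F" "F \<subseteq> D" for F x
    proof (cases "{z \<in> F. dist x z \<le> \<delta> z / 2} = {}")
      case True
      then show ?thesis using Q by (simp only: True) simp
    next
      case False
      then obtain z0 where z0: "z0 \<in> F" "dist x z0 \<le> \<delta> z0 / 2" by auto
      then have z0E: "z0 \<in> E" using F D by auto
      have xE: "x \<in> E"
        using z0 \<delta>pos[OF z0E] capped_dist_ball_subset[of z0 x E] by (simp add: \<delta>_def dist_commute)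
      have \<delta>x: "0 < \<delta> x" by (rule \<delta>pos[OF xE])
      \<comment> \<open>If the bump of \<open>z\<close> is alive at \<open>x\<close>, then
        \<open>\<delta> x \<le> 3 / 2 * \<delta> z\<close>, so this common radius fits into each of
        the disjoint Vitali balls concerned.\<close>
      define \<epsilon> where "\<epsilon> = \<delta> x / (30 * N)"
      have "real (card {z \<in> F. dist x z \<le> \<delta> z / 2}) \<le> (2 * \<delta> x / \<epsilon>) ^ DIM(real ^ 'n)"
      proof (rule card_le_dist_disjoint_balls)
        show "finite {z \<in> F. dist x z \<le> \<delta> z / 2}" using F by simp
        show "0 < \<epsilon>" using \<delta>x N by (simp add: \<epsilon>_def)
        show "\<epsilon> \<le> \<delta> x" using \<delta>x N by (simp add: \<epsilon>_def field_simps)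
        show "dist x z \<le> \<delta> x" if "z \<in> {z \<in> F. dist x z \<le> \<delta> z / 2}" for z
          using that lip[of z x] by (simp add: dist_commute)
        have \<epsilon>r: "\<epsilon> \<le> r z" if "z \<in> {z \<in> F. dist x z \<le> \<delta> z / 2}" for z
        proof -
          have "\<delta> x \<le> 3 / 2 * \<delta> z" using that lip[of x z] by simp
          then show ?thesis using N by (simp add: \<epsilon>_def r_def field_simps)
        qed
        show "pairwise (\<lambda>y z. disjnt (ball y \<epsilon>) (ball z \<epsilon>)) {z \<in> F. dist x z \<le> \<delta> z / 2}"
          unfolding pairwise_def
        proof (intro ballI impI)
          fix y z assume yz: "y \<in> {z \<in> F. dist x z \<le> \<delta> z / 2}" "z \<in> {z \<in> F. dist x z \<le> \<delta> z / 2}" "y \<noteq> z"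
          then have "disjnt (ball y (r y)) (ball z (r z))"
            using disj F(2) by (auto simp: pairwise_def)
          then show "disjnt (ball y \<epsilon>) (ball z \<epsilon>)"
            using subset_ball[OF \<epsilon>r[OF yz(1)], of y] subset_ball[OF \<epsilon>r[OF yz(2)], of z]
            unfolding disjnt_def by blast
        qed
      qed
      also have "2 * \<delta> x / \<epsilon> = 60 * N" using \<delta>x N by (simp add: \<epsilon>_def)
      finally show ?thesis using xE by (simp add: Q_def)
    qed
    \<comment> \<open>\<open>D\<close> may be finite or even empty, so indices outside its
      enumeration receive the zero function.\<close>
    define I where "I = to_nat_on D ` D"
    define b where "b n = (if n \<in> I then \<beta> (from_nat_into D n) else (\<lambda>x. 0))" for n
    have fD: "from_nat_into D n \<in> D" if "n \<in> I" for n
      using that D(1) by (auto simp: I_def)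
    have inj: "inj_on (from_nat_into D) I"
      using D(1) by (auto simp: I_def inj_on_def)
    show ?thesis
    proof (intro exI[of _ b] conjI allI ballI impI)
      show "b n \<in> test_functions E" for n
        using fD[of n] D(2) \<beta>T by (auto simp: b_def test_functions_zero)
      show "0 \<le> b n x" for n x using \<beta>0 by (simp add: b_def)
      show "\<exists>n. capped_dist E x ^ m \<le> b n x" if x: "x \<in> E" for x
      proof -
        obtain z where z: "z \<in> D" "x \<in> ball z (5 * r z)" using cov x by auto
        have zE: "z \<in> E" using z D by auto
        have dz: "dist x z < \<delta> z / (4 * N)" using z(2) by (simp add: r_def dist_commute)
        also have "\<dots> \<le> \<delta> z" using N \<delta>pos[OF zE] by (simp add: field_simps)
        finally have "\<delta> x \<le> 2 * \<delta> z" using lip[of x z] by simp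
        have "norm ((1 / \<delta> z) *\<^sub>R (x - z)) \<le> 1 / (4 * N)"
          using dz \<delta>pos[OF zE] N unfolding nrm[OF zE] by (simp add: field_simps)
        then have "1 \<le> \<eta> ((1 / \<delta> z) *\<^sub>R (x - z))" unfolding N_def by (rule \<eta>1)
        then have "(2 * \<delta> z) ^ m * 1 \<le> \<beta> z x"
          unfolding \<beta>_def using \<delta>pos[OF zE] by (intro mult_left_mono) auto
        moreover have "\<delta> x ^ m \<le> (2 * \<delta> z) ^ m"
          using \<open>\<delta> x \<le> 2 * \<delta> z\<close> \<delta>pos[OF x] by (intro power_mono) auto
        moreover have "b (to_nat_on D z) = \<beta> z" using z D(1) by (simp add: b_def I_def)
        ultimately show ?thesis unfolding \<delta>_def by (intro exI[of _ "to_nat_on D z"]) simp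
      qed
      fix "is" :: "'n list" and x M assume l: "length is \<le> m"
      define F where "F = from_nat_into D ` ({..<M} \<inter> I)"
      have F: "finite F" "F \<subseteq> D" using fD by (auto simp: F_def)
      have "(\<Sum>n<M. \<bar>pderivs is (b n) x\<bar>) = (\<Sum>n\<in>{..<M} \<inter> I. \<bar>pderivs is (\<beta> (from_nat_into D n)) x\<bar>)"
        by (subst sum.inter_restrict) (auto simp: b_def pderivs_zero intro!: sum.cong)
      also have "\<dots> = (\<Sum>z\<in>F. \<bar>pderivs is (\<beta> z) x\<bar>)"
        unfolding F_def using inj by (subst sum.reindex) (auto intro: inj_on_subset)
      also have "\<dots> \<le> (\<Sum>z\<in>F. if dist x z \<le> \<delta> z / 2 then 2 ^ m * B else 0)"
        using F D l by (intro sum_mono \<beta>d) auto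
      also have "\<dots> = real (card {z \<in> F. dist x z \<le> \<delta> z / 2}) * (2 ^ m * B)"
        using F(1) by (simp add: sum.If_cases Int_def)
      also have "\<dots> \<le> (Q * indicator E x) * (2 ^ m * B)"
        using overlap[OF F] B by (intro mult_right_mono) auto
      finally show "(\<Sum>n<M. \<bar>pderivs is (b n) x\<bar>) \<le> C * indicator E x"
        by (simp add: C_def mult.commute mult.left_commute)
    qed
  qed
  show ?thesis by (rule that[OF C key])
qed

section \<open>A local maximal theorem\<close>

text \<open>\<open>bdist\<close> refers to the frontier and not to the complement; connectedness
  bridges the gap, since a ball meeting both \<open>\<Omega>\<close> and its complement meets the
  frontier.\<close>

lemma ball_bdist_subset:
  assumes "open \<Omega>" "x \<in> \<Omega>"
  shows "ball x (bdist \<Omega> x) \<subseteq> \<Omega>"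
proof (rule ccontr)
  assume "\<not> ball x (bdist \<Omega> x) \<subseteq> \<Omega>"
  then have "ball x (bdist \<Omega> x) - \<Omega> \<noteq> {}" by auto
  moreover from this have "0 < bdist \<Omega> x" using ball_empty[of "bdist \<Omega> x" x] by (cases "bdist \<Omega> x \<le> 0") auto
  ultimately have "ball x (bdist \<Omega> x) \<inter> frontier \<Omega> \<noteq> {}"
    using assms(2) centre_in_ball[of x "bdist \<Omega> x"] by (intro connected_Int_frontier connected_ball) blast+
  then obtain z where "z \<in> frontier \<Omega>" "dist x z < bdist \<Omega> x" by auto
  then show False using infdist_le[of z "frontier \<Omega>" x] by (simp add: bdist_def)
qed

lemma bdist_lipschitz: "\<bar>bdist \<Omega> x - bdist \<Omega> y\<bar> \<le> dist x y"
  unfolding bdist_def by (rule infdist_triangle_abs)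

text \<open>For negative \<open>s\<close> the power is decreasing and the lower bound on
  \<open>b\<close> becomes the relevant one; \<open>\<bar>s\<bar>\<close> covers both signs.\<close>

lemma powr_comparable:
  fixes a b s :: real
  assumes "0 < a" "a / 2 \<le> b" "b \<le> 2 * a"
  shows "b powr s \<le> 2 powr \<bar>s\<bar> * a powr s"
proof (cases "s \<ge> 0")
  case True
  have "b powr s \<le> (2 * a) powr s" using assms True by (intro powr_mono2) auto
  then show ?thesis using True assms by (simp add: powr_mult)
next
  case False
  have "b powr s \<le> (a / 2) powr s" using assms False by (intro powr_mono2') auto
  also have "\<dots> = 2 powr (- s) * a powr s" using assms by (simp add: powr_divide powr_minus field_simps)
  finally show ?thesis using False by simp
qed

text \<open>
  The factor \<open>20\<close> keeps the distance to the boundary comparable to its value at the centre on the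
  fivefold enlargements in Vitali's covering lemma.
\<close>

definition avg_level :: "(real ^ 'n::finite) set \<Rightarrow> (real ^ 'n \<Rightarrow> real) \<Rightarrow> real \<Rightarrow> (real ^ 'n) set" where
  "avg_level \<Omega> g c = (\<Union>(y, t) \<in> {(y, t). y \<in> \<Omega> \<and> 0 < t \<and> 20 * t \<le> min 1 (bdist \<Omega> y) \<and>
      ennreal c * emeasure lborel (ball y t) < (\<integral>\<^sup>+ x. ennreal (g x) * indicator (ball y t) x \<partial>lborel)}. ball y t)"

lemma avg_level_open: "open (avg_level \<Omega> g c)"
  unfolding avg_level_def by (intro open_UN) auto

lemma avg_level_subset:
  assumes "open \<Omega>"
  shows "avg_level \<Omega> g c \<subseteq> \<Omega>"
proof
  fix x assume "x \<in> avg_level \<Omega> g c"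
  then obtain y t where "y \<in> \<Omega>" "0 < t" "20 * t \<le> bdist \<Omega> y" "x \<in> ball y t"
    by (auto simp: avg_level_def)
  then show "x \<in> \<Omega>" using ball_bdist_subset[OF assms, of y] by (auto simp: subset_iff)
qed

text \<open>The part of \<open>g\<close> below \<open>c / 2\<close> accounts for at most half of the
  mass \<open>c\<close> times volume. Discarding it is what later makes the bounds for the different
  levels summable.\<close>

lemma truncated_average:
  fixes g :: "'a::euclidean_space \<Rightarrow> real"
  assumes g: "g \<in> borel_measurable borel" and c: "0 < c"
    and lev: "ennreal c * emeasure lborel (ball y t) < (\<integral>\<^sup>+ x. ennreal (g x) * indicator (ball y t) x \<partial>lborel)"
  shows "ennreal (c / 2) * emeasure lborel (ball y t) \<le>
    (\<integral>\<^sup>+ x. ennreal (g x) * indicator {x. c / 2 < g x} x * indicator (ball y t) x \<partial>lborel)" (is "_ \<le> ?X")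
proof -
  have [measurable]: "g \<in> borel_measurable borel" by (rule g)
  have [measurable]: "{x. c / 2 < g x} \<in> sets borel" by measurable
  have [measurable]: "ball y t \<in> sets borel" by simp
  define V where "V = measure lborel (ball y t)"
  have V: "emeasure lborel (ball y t) = ennreal V"
    unfolding V_def using emeasure_lborel_ball_finite[of y t] by (intro emeasure_eq_ennreal_measure) auto
  have V0: "0 \<le> V" by (simp add: V_def)
  have "(\<integral>\<^sup>+ x. ennreal (g x) * indicator (ball y t) x \<partial>lborel) \<le>
     (\<integral>\<^sup>+ x. ennreal (g x) * indicator {x. c / 2 < g x} x * indicator (ball y t) x + ennreal (c / 2) * indicator (ball y t) x \<partial>lborel)"
    by (intro nn_integral_mono) (auto simp: indicator_def ennreal_leI)
  also have "\<dots> = ?X + ennreal (c / 2) * ennreal V"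
    by (subst nn_integral_add) (measurable, simp add: nn_integral_cmult_indicator V)
  finally have "ennreal (c * V) < ?X + ennreal (c / 2 * V)"
    using lev c V0 unfolding V by (simp add: ennreal_mult' less_le_trans del: times_divide_eq_left)
  then show ?thesis
    using c V0 by (cases ?X rule: ennreal_cases)
      (auto simp: V ennreal_mult'[symmetric] ennreal_plus[symmetric] ennreal_less_iff simp del: ennreal_plus intro!: ennreal_leI)
qed

lemma nn_integral_count_space_disjoint_le:
  fixes a :: ennreal
  assumes "\<And>i j. i \<in> C \<Longrightarrow> j \<in> C \<Longrightarrow> x \<in> B i \<Longrightarrow> x \<in> B j \<Longrightarrow> i = j"
    and "\<And>i. i \<in> C \<Longrightarrow> B i \<subseteq> S"
  shows "(\<integral>\<^sup>+ i. a * indicator (B i) x \<partial>count_space C) \<le> a * indicator S x"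
proof (cases "\<exists>i\<in>C. x \<in> B i")
  case True
  then obtain i where i: "i \<in> C" "x \<in> B i" by blast
  have "(\<integral>\<^sup>+ j. a * indicator (B j) x \<partial>count_space C) = (\<integral>\<^sup>+ j. a * indicator {i} j \<partial>count_space C)"
    using assms(1) i by (intro nn_integral_cong) (auto simp: indicator_def)
  also have "\<dots> = a" using i by (subst nn_integral_cmult_indicator) auto
  finally show ?thesis using i assms(2)[OF i(1)] by (auto simp: indicator_def subset_iff)
next
  case False
  then have "(\<integral>\<^sup>+ j. a * indicator (B j) x \<partial>count_space C) = (\<integral>\<^sup>+ j. 0 \<partial>count_space C)"
    by (intro nn_integral_cong) (auto simp: indicator_def)
  then show ?thesis by simp
qed

text \<open>By Vitali's lemma the fivefold balls cover the level set, while the disjoint balls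
  themselves carry enough mass of the truncated \<open>g\<close>. In the constant, 2 comes from the
  truncation at \<open>c / 2\<close>, \<open>5 ^ CARD('n)\<close> from the enlargement, and one
  factor \<open>2 powr \<bar>s\<bar>\<close> each from freezing the weight at the centre and from
  releasing it again.\<close>

lemma avg_level_weak_type:
  fixes \<Omega> :: "(real ^ 'n::finite) set"
  assumes \<Omega>: "open \<Omega>" "\<Omega> \<noteq> UNIV" and g: "g \<in> borel_measurable borel" and c: "0 < c"
  shows "(\<integral>\<^sup>+ x. ennreal (bdist \<Omega> x powr s) * indicator (avg_level \<Omega> g c) x \<partial>lborel) \<le>
    ennreal (2 * 5 ^ CARD('n) * (2 powr \<bar>s\<bar>)\<^sup>2 / c) *
    (\<integral>\<^sup>+ x. ennreal (g x) * indicator {x. c / 2 < g x} x * ennreal (bdist \<Omega> x powr s) * indicator \<Omega> x \<partial>lborel)"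
proof -
  define K where "K = 2 powr \<bar>s\<bar>"
  have K: "K > 0" by (simp add: K_def)
  define d where "d = bdist \<Omega>"
  have [measurable]: "d \<in> borel_measurable borel" unfolding d_def by (rule bdist_measurable)
  have [measurable]: "g \<in> borel_measurable borel" by (rule g)
  have [measurable]: "{x. c / 2 < g x} \<in> sets borel" by measurable
  have [measurable]: "\<Omega> \<in> sets borel" using \<Omega> by auto
  have [measurable]: "ball y t \<in> sets borel" for y :: "real ^ 'n" and t by simp
  define h where "h x = ennreal (g x) * indicator {x. c / 2 < g x} x" for x
  have [measurable]: "h \<in> borel_measurable borel" unfolding h_def by measurable
  define G where "G = {(y, t). y \<in> \<Omega> \<and> 0 < t \<and> 20 * t \<le> min 1 (d y) \<and>
      ennreal c * emeasure lborel (ball y t) < (\<integral>\<^sup>+ x. ennreal (g x) * indicator (ball y t) x \<partial>lborel)}"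
  define E where "E = (\<Union>i\<in>G. ball (fst i) (snd i))"
  have E: "avg_level \<Omega> g c = E" unfolding avg_level_def E_def G_def d_def by (auto simp: case_prod_beta)
  obtain C where C: "countable C" "C \<subseteq> G"
     "pairwise (\<lambda>i j. disjnt (ball (fst i) (snd i)) (ball (fst j) (snd j))) C"
     "E \<subseteq> (\<Union>i\<in>C. ball (fst i) (5 * snd i))"
  proof (rule Vitali_covering_lemma_balls[where S=E and K=G and a=fst and r=snd and B=1])
    show "E \<subseteq> (\<Union>i\<in>G. ball (fst i) (snd i))" by (simp add: E_def)
    show "0 < snd i \<and> snd i \<le> 1" if "i \<in> G" for i using that by (auto simp: G_def)
  qed (rule that; assumption)
  \<comment> \<open>The enlarged radius is at most a quarter of the distance of the centre to the
    boundary, so that distance changes by at most a quarter on the enlarged ball.\<close>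
  have near: "d z powr s \<le> K * d (fst i) powr s" "d (fst i) powr s \<le> K * d z powr s"
    if i: "i \<in> C" and z: "z \<in> ball (fst i) (5 * snd i)" for i z
  proof -
    have "\<bar>d (fst i) - d z\<bar> \<le> 5 * snd i"
      using z bdist_lipschitz[of \<Omega> "fst i" z] by (simp add: d_def)
    moreover have "20 * snd i \<le> d (fst i)" "0 < snd i" using i C(2) by (auto simp: G_def)
    ultimately have "d (fst i) / 2 \<le> d z" "d z \<le> 2 * d (fst i)" "d z / 2 \<le> d (fst i)" "d (fst i) \<le> 2 * d z"
      "0 < d z" "0 < d (fst i)" by linarith+
    then show "d z powr s \<le> K * d (fst i) powr s" "d (fst i) powr s \<le> K * d z powr s"
      unfolding K_def by (auto intro: powr_comparable)
  qed
  have sub: "ball (fst i) (snd i) \<subseteq> \<Omega>" if "i \<in> C" for i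
  proof -
    have "snd i \<le> d (fst i)" "fst i \<in> \<Omega>" using that C(2) by (auto simp: G_def)
    then show ?thesis using ball_bdist_subset[OF \<Omega>(1)] unfolding d_def by (meson subset_ball subset_trans)
  qed
  have step: "(\<integral>\<^sup>+ x. ennreal (d x powr s) * indicator (ball (fst i) (5 * snd i)) x \<partial>lborel) \<le>
     ennreal (2 * 5 ^ CARD('n) * K\<^sup>2 / c) * (\<integral>\<^sup>+ x. h x * ennreal (d x powr s) * indicator (ball (fst i) (snd i)) x \<partial>lborel)"
    if i: "i \<in> C" for i
  proof -
    obtain y t where yt: "i = (y, t)" by force
    have t: "0 < t" and lev: "ennreal c * emeasure lborel (ball y t) < (\<integral>\<^sup>+ x. ennreal (g x) * indicator (ball y t) x \<partial>lborel)"
      using i C(2) yt by (auto simp: G_def)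
    define V where "V = measure lborel (ball y t)"
    have V: "emeasure lborel (ball y t) = ennreal V"
      unfolding V_def using emeasure_lborel_ball_finite[of y t] by (intro emeasure_eq_ennreal_measure) auto
    have V0: "0 \<le> V" by (simp add: V_def)
    have "emeasure lborel (ball y (5 * t)) = ennreal (measure lborel (ball y (5 * t)))"
      using emeasure_lborel_ball_finite[of y "5 * t"] by (intro emeasure_eq_ennreal_measure) auto
    also have "measure lborel (ball y (5 * t)) = 5 ^ CARD('n) * V"
      unfolding V_def using t by (simp add: content_ball_conv_unit_ball[of "5 * t"] content_ball_conv_unit_ball[of t] power_mult_distrib)
    finally have V5: "emeasure lborel (ball y (5 * t)) = ennreal (5 ^ CARD('n) * V)" .
    have "(\<integral>\<^sup>+ x. ennreal (d x powr s) * indicator (ball y (5 * t)) x \<partial>lborel) \<le>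
       (\<integral>\<^sup>+ x. ennreal (K * d y powr s) * indicator (ball y (5 * t)) x \<partial>lborel)"
      using near(1)[OF i] by (intro nn_integral_mono) (auto simp: yt indicator_def intro!: ennreal_leI)
    also have "\<dots> = ennreal (K * d y powr s) * ennreal (5 ^ CARD('n) * V)"
      by (subst nn_integral_cmult_indicator) (auto simp: V5)
    also have "\<dots> = ennreal (2 * 5 ^ CARD('n) * K / c) * (ennreal (d y powr s) * (ennreal (c / 2) * ennreal V))"
      using K c V0 by (simp add: ennreal_mult'[symmetric] ennreal_mult''[symmetric] mult.assoc)
    also have "\<dots> \<le> ennreal (2 * 5 ^ CARD('n) * K / c) * (ennreal (d y powr s) * (\<integral>\<^sup>+ x. h x * indicator (ball y t) x \<partial>lborel))"
      using truncated_average[OF g c lev] unfolding h_def V by (intro mult_left_mono) auto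
    also have "ennreal (d y powr s) * (\<integral>\<^sup>+ x. h x * indicator (ball y t) x \<partial>lborel) =
        (\<integral>\<^sup>+ x. ennreal (d y powr s) * (h x * indicator (ball y t) x) \<partial>lborel)"
      by (subst nn_integral_cmult) auto
    also have "\<dots> \<le> (\<integral>\<^sup>+ x. ennreal K * (h x * ennreal (d x powr s) * indicator (ball y t) x) \<partial>lborel)"
    proof (intro nn_integral_mono)
      fix x
      show "ennreal (d y powr s) * (h x * indicator (ball y t) x) \<le> ennreal K * (h x * ennreal (d x powr s) * indicator (ball y t) x)"
      proof (cases "x \<in> ball y t")
        case True
        then have "d y powr s \<le> K * d x powr s" using near(2)[OF i, of x] t by (auto simp: yt)
        then have "ennreal (d y powr s) \<le> ennreal K * ennreal (d x powr s)"
          using K by (simp add: ennreal_mult'[symmetric] ennreal_leI)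
        then have "ennreal (d y powr s) * h x \<le> ennreal K * ennreal (d x powr s) * h x"
          by (rule mult_right_mono) simp
        then show ?thesis using True by (simp add: mult.assoc mult.commute[of "h x"])
      qed simp
    qed
    also have "\<dots> = ennreal K * (\<integral>\<^sup>+ x. h x * ennreal (d x powr s) * indicator (ball y t) x \<partial>lborel)"
      by (subst nn_integral_cmult) auto
    also have "ennreal (2 * 5 ^ CARD('n) * K / c) * (ennreal K * (\<integral>\<^sup>+ x. h x * ennreal (d x powr s) * indicator (ball y t) x \<partial>lborel))
       = ennreal (2 * 5 ^ CARD('n) * K\<^sup>2 / c) * (\<integral>\<^sup>+ x. h x * ennreal (d x powr s) * indicator (ball y t) x \<partial>lborel)"
      using K c by (simp add: ennreal_mult'[symmetric] ennreal_mult''[symmetric] mult.assoc[symmetric] power2_eq_square)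
    finally show ?thesis by (simp add: yt mult_left_mono)
  qed
  have "(\<integral>\<^sup>+ x. ennreal (d x powr s) * indicator E x \<partial>lborel) \<le>
     (\<integral>\<^sup>+ x. \<integral>\<^sup>+ i. ennreal (d x powr s) * indicator (ball (fst i) (5 * snd i)) x \<partial>count_space C \<partial>lborel)"
  proof (intro nn_integral_mono)
    fix x
    show "ennreal (d x powr s) * indicator E x \<le> (\<integral>\<^sup>+ i. ennreal (d x powr s) * indicator (ball (fst i) (5 * snd i)) x \<partial>count_space C)"
    proof (cases "x \<in> E")
      case True
      then obtain i where i: "i \<in> C" "x \<in> ball (fst i) (5 * snd i)" using C(4) by blast
      show ?thesis
        using nn_integral_ge_point[OF i(1), of "\<lambda>i. ennreal (d x powr s) * indicator (ball (fst i) (5 * snd i)) x"] i(2) True by simp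
    qed simp
  qed
  \<comment> \<open>Sums over the chosen balls are written as integrals over
    \<open>count_space C\<close>, so exchanging them with the integral is Tonelli's theorem and
    needs no enumeration of \<open>C\<close>.\<close>
  also have "\<dots> = (\<integral>\<^sup>+ i. \<integral>\<^sup>+ x. ennreal (d x powr s) * indicator (ball (fst i) (5 * snd i)) x \<partial>lborel \<partial>count_space C)"
    using C(1) by (intro nn_integral_count_space_nn_integral) auto
  also have "\<dots> \<le> (\<integral>\<^sup>+ i. ennreal (2 * 5 ^ CARD('n) * K\<^sup>2 / c) * (\<integral>\<^sup>+ x. h x * ennreal (d x powr s) * indicator (ball (fst i) (snd i)) x \<partial>lborel) \<partial>count_space C)"
    using step by (intro nn_integral_mono) auto
  also have "\<dots> = ennreal (2 * 5 ^ CARD('n) * K\<^sup>2 / c) * (\<integral>\<^sup>+ i. (\<integral>\<^sup>+ x. h x * ennreal (d x powr s) * indicator (ball (fst i) (snd i)) x \<partial>lborel) \<partial>count_space C)"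
    by (subst nn_integral_cmult) auto
  also have "(\<integral>\<^sup>+ i. (\<integral>\<^sup>+ x. h x * ennreal (d x powr s) * indicator (ball (fst i) (snd i)) x \<partial>lborel) \<partial>count_space C) =
     (\<integral>\<^sup>+ x. (\<integral>\<^sup>+ i. h x * ennreal (d x powr s) * indicator (ball (fst i) (snd i)) x \<partial>count_space C) \<partial>lborel)"
    using C(1) by (intro nn_integral_count_space_nn_integral[symmetric]) auto
  also have "\<dots> \<le> (\<integral>\<^sup>+ x. h x * ennreal (d x powr s) * indicator \<Omega> x \<partial>lborel)"
  proof (intro nn_integral_mono nn_integral_count_space_disjoint_le sub)
    fix x i j assume "i \<in> C" "j \<in> C" "x \<in> ball (fst i) (snd i)" "x \<in> ball (fst j) (snd j)"
    then show "i = j" using C(3) unfolding pairwise_def disjnt_def by blast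
  qed
  finally show ?thesis
    unfolding E by (simp add: K_def d_def h_def mult_left_mono)
qed

section \<open>Dyadic levels and the strong-type estimate\<close>

lemma sum_powr_int_le:
  fixes r :: real
  assumes "1 < r" "finite J" "\<And>i::int. i \<in> J \<Longrightarrow> i \<le> b"
  shows "(\<Sum>i\<in>J. r powr of_int i) \<le> r / (r - 1) * r powr of_int b"
  using assms(2,3)
proof (induction J arbitrary: b rule: finite_linorder_max_induct)
  case empty
  then show ?case using assms(1) by simp
next
  case (insert a A)
  have "(\<Sum>i\<in>A. r powr of_int i) \<le> r / (r - 1) * r powr of_int (a - 1)"
    using insert.hyps by (intro insert.IH) auto
  also have "r powr of_int (a - 1) = r powr of_int a / r"
    using assms(1) by (simp add: powr_diff)
  finally have "(\<Sum>i\<in>insert a A. r powr of_int i) \<le> r powr of_int a + r / (r - 1) * (r powr of_int a / r)"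
    using insert.hyps by (subst sum.insert) auto
  moreover have "r powr of_int a + r / (r - 1) * (r powr of_int a / r) = r / (r - 1) * r powr of_int a"
    using assms(1) by (simp add: field_simps)
  moreover have "r / (r - 1) * r powr of_int a \<le> r / (r - 1) * r powr of_int b"
    using insert.prems[of a] assms(1) by (intro mult_left_mono powr_mono) auto
  ultimately show ?case by linarith
qed

text \<open>Omitting terms of a geometric series or listing them in another order does not spoil the
  bound by its top term, so the order of \<open>int_decode\<close> is irrelevant.\<close>

lemma sum_int_decode_le:
  fixes r :: real
  assumes "1 < r" "\<And>k. k < n \<Longrightarrow> P k \<Longrightarrow> int_decode k \<le> b"
  shows "(\<Sum>k<n. if P k then r powr of_int (int_decode k) else 0) \<le> r / (r - 1) * r powr of_int b"
proof -
  have "(\<Sum>k<n. if P k then r powr of_int (int_decode k) else 0) = (\<Sum>k | k < n \<and> P k. r powr of_int (int_decode k))"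
    by (subst sum.inter_filter[symmetric]) auto
  also have "\<dots> = (\<Sum>i\<in>int_decode ` {k. k < n \<and> P k}. r powr of_int i)"
    by (subst sum.reindex) (auto simp: inj_on_def inj_int_decode[THEN inj_eq])
  also have "\<dots> \<le> r / (r - 1) * r powr of_int b"
    using assms by (intro sum_powr_int_le) auto
  finally show ?thesis .
qed

text \<open>The levels \<open>2\<^sup>i\<close> for integers \<open>i\<close>, enumerated by the natural numbers.\<close>

definition avg_level_seq :: "(real ^ 'n::finite) set \<Rightarrow> (real ^ 'n \<Rightarrow> real) \<Rightarrow> nat \<Rightarrow> (real ^ 'n) set" where
  "avg_level_seq \<Omega> g k = avg_level \<Omega> g (2 powr of_int (int_decode k))"

text \<open>A discrete layer-cake argument: multiplying the weak-type bound at level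
  \<open>2 ^ i\<close> by \<open>2 powr (p * i)\<close> leaves \<open>2 powr ((p - 1) * i)\<close>,
  to be summed at \<open>x\<close> over the levels with \<open>2 ^ i < 2 * g x\<close>. For
  \<open>p > 1\<close> this geometric sum is governed by its top term, of order
  \<open>g x powr (p - 1)\<close>, and the factor \<open>g x\<close> in the weak-type bound
  completes the \<open>p\<close>-th power.\<close>

lemma avg_level_strong_type:
  fixes \<Omega> :: "(real ^ 'n::finite) set"
  assumes \<Omega>: "open \<Omega>" "\<Omega> \<noteq> UNIV" and g: "g \<in> borel_measurable borel" and p: "1 < p"
    and fin: "(\<integral>\<^sup>+ x. ennreal (\<bar>g x\<bar> powr p * bdist \<Omega> x powr s) * indicator \<Omega> x \<partial>lborel) < \<infinity>"
  shows "(\<Sum>k. ennreal (2 powr (p * of_int (int_decode k))) *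
      (\<integral>\<^sup>+ x. ennreal (bdist \<Omega> x powr s) * indicator (avg_level_seq \<Omega> g k) x \<partial>lborel)) < \<infinity>"
proof -
  define i where "i k = real_of_int (int_decode k)" for k
  define A where "A = 2 * 5 ^ CARD('n) * (2 powr \<bar>s\<bar>)\<^sup>2"
  have A: "A > 0" by (simp add: A_def)
  have [measurable]: "g \<in> borel_measurable borel" by (rule g)
  have [measurable]: "bdist \<Omega> \<in> borel_measurable borel" by (rule bdist_measurable)
  have [measurable]: "\<Omega> \<in> sets borel" using \<Omega> by auto
  have [measurable]: "{x. c / 2 < g x} \<in> sets borel" for c by measurable
  define r where "r = 2 powr (p - 1)"
  have r: "r > 1" using p by (simp add: r_def)
  \<comment> \<open>The factor of the geometric series, times \<open>2 powr (p - 1)\<close> because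
    the levels reach up to \<open>2 * g x\<close> instead of \<open>g x\<close>.\<close>
  define S where "S = r / (r - 1) * 2 powr (p - 1)"
  have S: "S \<ge> 0" using r by (simp add: S_def)
  define F where "F k x = ennreal (A * r powr i k) * (ennreal (g x) * indicator {x. 2 powr i k / 2 < g x} x * ennreal (bdist \<Omega> x powr s) * indicator \<Omega> x)" for k x
  have [measurable]: "F k \<in> borel_measurable borel" for k unfolding F_def by measurable
  have "ennreal (2 powr (p * i k)) * (\<integral>\<^sup>+ x. ennreal (bdist \<Omega> x powr s) * indicator (avg_level_seq \<Omega> g k) x \<partial>lborel)
     \<le> (\<integral>\<^sup>+ x. F k x \<partial>lborel)" for k
  proof -
    have "ennreal (2 powr (p * i k)) * (\<integral>\<^sup>+ x. ennreal (bdist \<Omega> x powr s) * indicator (avg_level_seq \<Omega> g k) x \<partial>lborel) \<le>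
      ennreal (2 powr (p * i k)) * (ennreal (A / 2 powr i k) * (\<integral>\<^sup>+ x. ennreal (g x) * indicator {x. 2 powr i k / 2 < g x} x * ennreal (bdist \<Omega> x powr s) * indicator \<Omega> x \<partial>lborel))"
      using avg_level_weak_type[OF \<Omega> g, of "2 powr i k" s]
      by (intro mult_left_mono) (auto simp: avg_level_seq_def i_def A_def)
    also have "\<dots> = ennreal (2 powr (p * i k) * (A / 2 powr i k)) * (\<integral>\<^sup>+ x. ennreal (g x) * indicator {x. 2 powr i k / 2 < g x} x * ennreal (bdist \<Omega> x powr s) * indicator \<Omega> x \<partial>lborel)"
      using A by (subst ennreal_mult[of "2 powr (p * i k)" "A / 2 powr i k"]) (auto simp only: mult.assoc powr_ge_zero divide_nonneg_nonneg less_imp_le)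
    also have "2 powr (p * i k) * (A / 2 powr i k) = A * r powr i k"
    proof -
      have "r powr i k = 2 powr (p * i k - i k)" unfolding r_def powr_powr by (simp add: left_diff_distrib)
      then show ?thesis by (simp add: powr_diff)
    qed
    also have "ennreal (A * r powr i k) * (\<integral>\<^sup>+ x. ennreal (g x) * indicator {x. 2 powr i k / 2 < g x} x * ennreal (bdist \<Omega> x powr s) * indicator \<Omega> x \<partial>lborel) = (\<integral>\<^sup>+ x. F k x \<partial>lborel)"
      unfolding F_def by (subst nn_integral_cmult) auto
    finally show ?thesis .
  qed
  then have "(\<Sum>k. ennreal (2 powr (p * i k)) * (\<integral>\<^sup>+ x. ennreal (bdist \<Omega> x powr s) * indicator (avg_level_seq \<Omega> g k) x \<partial>lborel))
     \<le> (\<Sum>k. \<integral>\<^sup>+ x. F k x \<partial>lborel)"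
    by (intro suminf_le) auto
  also have "\<dots> = (\<integral>\<^sup>+ x. (\<Sum>k. F k x) \<partial>lborel)"
    by (subst nn_integral_suminf) auto
  also have "\<dots> \<le> (\<integral>\<^sup>+ x. ennreal (A * S) * (ennreal (\<bar>g x\<bar> powr p * bdist \<Omega> x powr s) * indicator \<Omega> x) \<partial>lborel)"
  proof (intro nn_integral_mono suminf_le_const)
    fix x n
    show "(\<Sum>k<n. F k x) \<le> ennreal (A * S) * (ennreal (\<bar>g x\<bar> powr p * bdist \<Omega> x powr s) * indicator \<Omega> x)"
    proof (cases "0 < g x \<and> x \<in> \<Omega>")
      case False
      then have "F k x = 0" for k
        by (auto simp: F_def ennreal_neg indicator_def)
      then show ?thesis by simp
    next
      case True
      define b where "b = \<lfloor>log 2 (2 * g x)\<rfloor>"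
      have "(\<Sum>k<n. if 2 powr i k / 2 < g x then r powr of_int (int_decode k) else 0) \<le> r / (r - 1) * r powr of_int b"
      proof (rule sum_int_decode_le[OF r])
        fix k assume "2 powr i k / 2 < g x"
        then have "2 powr i k < 2 * g x" by simp
        then have "i k < log 2 (2 * g x)" using True by (subst less_log_iff) auto
        then show "int_decode k \<le> b" unfolding b_def i_def by (simp add: le_floor_iff less_imp_le)
      qed
      also have "\<dots> \<le> r / (r - 1) * r powr log 2 (2 * g x)"
        using r by (intro mult_left_mono powr_mono) (auto simp: b_def)
      also have "r powr log 2 (2 * g x) = (2 * g x) powr (p - 1)"
      proof -
        have "2 powr log 2 (2 * g x) = 2 * g x" using True by simp
        then show ?thesis unfolding r_def by (metis powr_powr mult.commute)
      qed
      also have "r / (r - 1) * (2 * g x) powr (p - 1) = S * g x powr (p - 1)"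
        using True by (simp add: S_def powr_mult)
      finally have sum: "(\<Sum>k<n. if 2 powr i k / 2 < g x then r powr real_of_int (int_decode k) else 0) \<le> S * g x powr (p - 1)" .
      have "F k x = ennreal (A * g x * bdist \<Omega> x powr s * (if 2 powr i k / 2 < g x then r powr i k else 0))" for k
        using True A by (simp add: F_def ennreal_mult'[symmetric] ennreal_mult''[symmetric] ac_simps)
      then have "(\<Sum>k<n. F k x) = ennreal (A * g x * bdist \<Omega> x powr s * (\<Sum>k<n. if 2 powr i k / 2 < g x then r powr i k else 0))"
        using True A by (simp add: sum_distrib_left)
      also have "\<dots> \<le> ennreal (A * g x * bdist \<Omega> x powr s * (S * g x powr (p - 1)))"
        using sum[folded i_def] True A by (intro ennreal_leI mult_left_mono) auto
      also have "A * g x * bdist \<Omega> x powr s * (S * g x powr (p - 1)) = A * S * (\<bar>g x\<bar> powr p * bdist \<Omega> x powr s)"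
        using True by (simp add: powr_diff)
      also have "ennreal (A * S * (\<bar>g x\<bar> powr p * bdist \<Omega> x powr s)) = ennreal (A * S) * ennreal (\<bar>g x\<bar> powr p * bdist \<Omega> x powr s)"
        using A S by (intro ennreal_mult) auto
      finally show ?thesis using True by simp
    qed
  qed auto
  also have "\<dots> = ennreal (A * S) * (\<integral>\<^sup>+ x. ennreal (\<bar>g x\<bar> powr p * bdist \<Omega> x powr s) * indicator \<Omega> x \<partial>lborel)"
    by (subst nn_integral_cmult) auto
  also have "\<dots> < \<infinity>" using fin by (simp add: ennreal_mult_less_top)
  finally show ?thesis by (simp add: i_def)
qed

text \<open>Distinct powers of 2 add up to at most twice the largest, so the \<open>p\<close>-th
  power can be moved inside the sum with a constant independent of the number of levels.\<close>

lemma powr_sum_levels_le: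
  fixes p :: real
  assumes "0 < p"
  shows "(\<Sum>k<n. 2 powr of_int (int_decode k) * indicator (E k) x) powr p \<le>
     2 powr p * (\<Sum>k<n. 2 powr (p * of_int (int_decode k)) * indicator (E k) x)"
proof (cases "\<exists>k<n. x \<in> E k")
  case False
  then have "(\<Sum>k<n. 2 powr of_int (int_decode k) * indicator (E k) x :: real) = 0"
    by (intro sum.neutral) auto
  then show ?thesis by (simp add: sum_nonneg)
next
  case True
  define J where "J = int_decode ` {k. k < n \<and> x \<in> E k}"
  have "Max J \<in> J" using True by (intro Max_in) (auto simp: J_def)
  then obtain l where l: "l < n" "x \<in> E l" "int_decode l = Max J" by (auto simp: J_def)
  have "(\<Sum>k<n. 2 powr of_int (int_decode k) * indicator (E k) x) = (\<Sum>k<n. if x \<in> E k then 2 powr of_int (int_decode k) else (0::real))"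
    by (intro sum.cong) auto
  also have "\<dots> \<le> 2 / (2 - 1) * 2 powr of_int (Max J)"
    by (intro sum_int_decode_le) (auto simp: J_def intro!: Max_ge)
  finally have "(\<Sum>k<n. 2 powr of_int (int_decode k) * indicator (E k) x) powr p \<le> (2 * 2 powr of_int (int_decode l)) powr p"
    using assms l by (intro powr_mono2) (auto intro!: sum_nonneg)
  also have "\<dots> = 2 powr p * (2 powr (p * of_int (int_decode l)) * indicator (E l) x)"
    using l by (simp add: powr_mult powr_powr mult.commute)
  also have "\<dots> \<le> 2 powr p * (\<Sum>k<n. 2 powr (p * of_int (int_decode k)) * indicator (E k) x)"
    using l by (intro mult_left_mono member_le_sum[where f="\<lambda>k. 2 powr (p * of_int (int_decode k)) * indicator (E k) x"]) auto
  finally show ?thesis .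
qed

lemma ennreal_le_suminf: "f k \<le> (\<Sum>k. f k)" for f :: "nat \<Rightarrow> ennreal"
  using sum_le_suminf[of f "{k}"] by simp

text \<open>If the average of \<open>g\<close> over the ball exceeds \<open>2 ^ i\<close>, the ball
  is part of the level set, so \<open>t\<close> is at most the distance to its complement and the
  term of level \<open>i\<close> is present. The largest such \<open>i\<close> recovers the average
  up to a factor 2.\<close>

lemma integral_ball_le_levels:
  fixes \<Omega> :: "(real ^ 'n::finite) set"
  assumes \<Omega>: "open \<Omega>" "\<Omega> \<noteq> UNIV" and y: "y \<in> \<Omega>" and t: "0 < t" "20 * t \<le> min 1 (bdist \<Omega> y)"
  shows "(\<integral>\<^sup>+ x. ennreal (g x) * indicator (ball y t) x \<partial>lborel) \<le>
    2 * emeasure lborel (ball y t) *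
    (\<Sum>k. ennreal (2 powr of_int (int_decode k)) * indicator {t. t \<le> capped_dist (avg_level_seq \<Omega> g k) y} t)"
    (is "?X \<le> 2 * ?V * (\<Sum>k. ?F k)")
proof -
  define v where "v = measure lborel (ball y t)"
  have V: "?V = ennreal v"
    unfolding v_def using emeasure_lborel_ball_finite[of y t] by (intro emeasure_eq_ennreal_measure) auto
  have v: "v > 0" unfolding v_def using t by (simp add: content_ball_pos)
  have lev: "ennreal (2 powr of_int i) \<le> (\<Sum>k. ?F k)" if "ennreal (2 powr of_int i) * ?V < ?X" for i
  proof -
    define k where "k = int_encode i"
    have k: "int_decode k = i" by (simp add: k_def)
    have "ball y t \<subseteq> avg_level_seq \<Omega> g k"
      using y t that unfolding avg_level_seq_def avg_level_def k by blast
    then have "t \<le> capped_dist (avg_level_seq \<Omega> g k) y"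
      using t avg_level_subset[OF \<Omega>(1), of g "2 powr of_int (int_decode k)"] \<Omega>(2)
      by (intro ball_subset_imp_le_capped_dist) (auto simp: avg_level_seq_def)
    then have "ennreal (2 powr of_int i) = ?F k" by (simp add: k)
    also have "\<dots> \<le> (\<Sum>k. ?F k)" by (rule ennreal_le_suminf)
    finally show ?thesis .
  qed
  show ?thesis
  proof (cases ?X rule: ennreal_cases)
    case top
    \<comment> \<open>An infinite average exceeds every level, so the sum is at least
      \<open>2 ^ n\<close> for every \<open>n\<close>.\<close>
    have "(\<Sum>k. ?F k) = top"
    proof (rule ccontr)
      assume "(\<Sum>k. ?F k) \<noteq> top"
      then obtain q where q: "(\<Sum>k. ?F k) = ennreal q" "0 \<le> q" by (cases "\<Sum>k. ?F k" rule: ennreal_cases) auto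
      obtain n where n: "q < 2 ^ n" using real_arch_pow[of 2 q] by auto
      have "ennreal (2 powr of_int (int n)) \<le> ennreal q"
        unfolding q(1)[symmetric] by (rule lev) (simp add: top V ennreal_mult_less_top)
      then show False using n q(2) by (simp add: powr_realpow)
    qed
    then show ?thesis using v by (simp add: V ennreal_mult_top)
  next
    case (real a)
    show ?thesis
    proof (cases "a = 0")
      case False
      define A where "A = a / v"
      have A: "A > 0" using False real v by (simp add: A_def)
      \<comment> \<open>The largest integer with \<open>2 ^ i\<close> strictly below the average;
        the ceiling minus 1 respects the strict inequality in \<open>avg_level\<close>.\<close>
      define i where "i = \<lceil>log 2 A\<rceil> - 1"
      have i: "real_of_int i < log 2 A" "log 2 A \<le> real_of_int i + 1"
        unfolding i_def by linarith+
      have "2 powr of_int i < A" using i(1) A by (subst (asm) less_log_iff) auto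
      then have "2 powr of_int i * v < a" using v by (simp add: A_def field_simps)
      then have "ennreal (2 powr of_int i) * ?V < ?X"
        using v by (simp add: real V ennreal_mult'[symmetric] ennreal_less_iff)
      then have l: "ennreal (2 powr of_int i) \<le> (\<Sum>k. ?F k)" by (rule lev)
      have "A \<le> 2 powr (of_int i + 1)" using i(2) A by (subst (asm) log_le_iff) auto
      then have "a \<le> 2 * v * 2 powr of_int i" using v by (simp add: A_def powr_add field_simps)
      then have "?X \<le> 2 * ennreal v * ennreal (2 powr of_int i)"
        using v by (simp add: real ennreal_mult'[symmetric] ennreal_leI flip: ennreal_numeral)
      also have "\<dots> \<le> 2 * ennreal v * (\<Sum>k. ?F k)" using l by (intro mult_left_mono) auto
      finally show ?thesis by (simp add: V)
    qed (simp add: real)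
  qed
qed

section \<open>Construction of the majorant\<close>

lemma nn_integral_lebesgue_on_eq_lborel:
  fixes \<Omega> :: "(real ^ 'n::finite) set"
  assumes "f \<in> borel_measurable borel" "open \<Omega>"
  shows "(\<integral>\<^sup>+ x. f x \<partial>lebesgue_on \<Omega>) = (\<integral>\<^sup>+ x. f x * indicator \<Omega> x \<partial>lborel)"
proof -
  have [measurable]: "f \<in> borel_measurable borel" "\<Omega> \<in> sets borel" using assms by auto
  have "(\<integral>\<^sup>+ x. f x \<partial>lebesgue_on \<Omega>) = (\<integral>\<^sup>+ x. f x * indicator \<Omega> x \<partial>lebesgue)"
    using assms by (subst nn_integral_restrict_space) auto
  also have "\<dots> = (\<integral>\<^sup>+ x. f x * indicator \<Omega> x \<partial>lborel)"
    by (intro nn_integral_completion)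
  finally show ?thesis .
qed

lemma summable_abs_if_bounded:
  fixes f :: "nat \<Rightarrow> real"
  assumes "\<And>n. (\<Sum>k<n. \<bar>f k\<bar>) \<le> B"
  shows "summable f"
proof (rule summable_rabs_cancel)
  show "summable (\<lambda>n. \<bar>f n\<bar>)"
    by (rule summableI_nonneg_bounded[where x=B]) (simp_all add: assms)
qed

definition level_sum :: "(real ^ 'n::finite) set \<Rightarrow> (real ^ 'n \<Rightarrow> real) \<Rightarrow> nat \<Rightarrow> real ^ 'n \<Rightarrow> ennreal" where
  "level_sum \<Omega> g m x = (\<Sum>k. ennreal (2 powr of_int (int_decode k) * capped_dist (avg_level_seq \<Omega> g k) x ^ m))"

text \<open>The double series of bumps, over levels and Whitney balls, is arranged as one series
  whose derivatives are absolutely summable with sum at most \<open>G\<close> wherever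
  \<open>T\<close> is finite. The strong-type estimate makes \<open>T\<close> integrable against the
  weight, hence finite almost everywhere, and puts \<open>G\<close> into \<open>weighted_Lp\<close>;
  closure under dominated convergence does the rest.\<close>

lemma maximal_majorant:
  fixes \<Omega> :: "(real ^ 'n::finite) set"
  assumes \<Omega>: "open \<Omega>" "\<Omega> \<noteq> UNIV" and p: "1 < p" and m: "0 < m"
    and g: "g \<in> borel_measurable borel"
    and fin: "(\<integral>\<^sup>+ x. ennreal (\<bar>g x\<bar> powr p * bdist \<Omega> x powr s) * indicator \<Omega> x \<partial>lborel) < \<infinity>"
  obtains w where "w \<in> weighted_Sobolev0 \<Omega> m p s" "AE x in lebesgue_on \<Omega>. 0 \<le> w x"
    "AE x in lebesgue_on \<Omega>. level_sum \<Omega> g m x \<le> ennreal (w x)"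
proof -
  have p0: "0 < p" using p by simp
  define E where "E = avg_level_seq \<Omega> g"
  define a where "a k = 2 powr real_of_int (int_decode k)" for k
  have a0: "0 \<le> a k" for k by (simp add: a_def)
  have E: "open (E k)" "E k \<subseteq> \<Omega>" for k
    by (simp_all add: E_def avg_level_seq_def avg_level_open avg_level_subset[OF \<Omega>(1)])
  then have EU: "E k \<noteq> UNIV" for k using \<Omega>(2) by blast
  have [measurable]: "E k \<in> sets borel" for k using E by auto
  have [measurable]: "bdist \<Omega> \<in> borel_measurable borel" by (rule bdist_measurable)
  obtain C where C: "C > 0" and bumps:
    "\<And>E :: (real ^ 'n) set. open E \<Longrightarrow> E \<noteq> UNIV \<Longrightarrow>
      \<exists>b :: nat \<Rightarrow> real ^ 'n \<Rightarrow> real.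
        (\<forall>n. b n \<in> test_functions E) \<and> (\<forall>n x. 0 \<le> b n x) \<and>
        (\<forall>is x M. length is \<le> m \<longrightarrow> (\<Sum>n<M. \<bar>pderivs is (b n) x\<bar>) \<le> C * indicator E x) \<and>
        (\<forall>x\<in>E. \<exists>n. capped_dist E x ^ m \<le> b n x)"
    using whitney_bumps[where m=m and 'n='n] by blast
  from bumps[OF E(1) EU] obtain b :: "nat \<Rightarrow> nat \<Rightarrow> real ^ 'n \<Rightarrow> real" where b':
    "\<And>k. (\<forall>n. b k n \<in> test_functions (E k)) \<and> (\<forall>n x. 0 \<le> b k n x) \<and>
        (\<forall>is x M. length is \<le> m \<longrightarrow> (\<Sum>n<M. \<bar>pderivs is (b k n) x\<bar>) \<le> C * indicator (E k) x) \<and>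
        (\<forall>x\<in>E k. \<exists>n. capped_dist (E k) x ^ m \<le> b k n x)"
    by metis
  note b1 = conjunct1[OF b'] and b2 = conjunct1[OF conjunct2[OF b']]
    and b3 = conjunct1[OF conjunct2[OF conjunct2[OF b']]] and b4 = conjunct2[OF conjunct2[OF conjunct2[OF b']]]
  have bT: "b k n \<in> test_functions \<Omega>" for k n
    by (rule test_functions_mono[OF b1[rule_format] E(2)])
  have b0: "0 \<le> b k n x" for k n x by (rule b2[rule_format])
  have bd: "(\<Sum>n<M. \<bar>pderivs is (b k n) x\<bar>) \<le> C * indicator (E k) x" if "length is \<le> m" for k M "is" x
    by (rule b3[rule_format, OF that])
  have bl: "\<exists>n. capped_dist (E k) x ^ m \<le> b k n x" if "x \<in> E k" for k x
    by (rule b4[rule_format, OF that])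
  define F where "F n x = (case prod_decode n of (k, l) \<Rightarrow> a k * b k l x)" for n x
  have F_eq: "F n = (\<lambda>x. a (fst (prod_decode n)) * b (fst (prod_decode n)) (snd (prod_decode n)) x)" for n
    by (auto simp: F_def case_prod_beta)
  have FT: "F n \<in> test_functions \<Omega>" for n unfolding F_eq by (intro test_functions_cmult bT)
  have F0: "0 \<le> F n x" for n x unfolding F_eq using a0 b0 by simp
  have dF: "pderivs is (F n) x = a (fst (prod_decode n)) * pderivs is (b (fst (prod_decode n)) (snd (prod_decode n))) x" for "is" n x
    unfolding F_eq pderivs_cmult[OF test_functionsD(1)[OF bT]] ..
  have sumF: "(\<Sum>n<M. \<bar>pderivs is (F n) x\<bar>) \<le> C * (\<Sum>k<M. a k * indicator (E k) x)" if l: "length is \<le> m" for "is" M x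
  proof -
    define h where "h = (\<lambda>(k, l). a k * \<bar>pderivs is (b k l) x\<bar>)"
    have "(\<Sum>n<M. \<bar>pderivs is (F n) x\<bar>) = (\<Sum>n<M. h (prod_decode n))"
      using a0 by (simp add: dF h_def case_prod_beta abs_mult)
    also have "\<dots> = (\<Sum>z\<in>prod_decode ` {..<M}. h z)"
      by (subst sum.reindex) (auto intro: inj_on_subset[OF inj_prod_decode])
    \<comment> \<open>A pairing code is at least as large as both of its components, so the first
      \<open>M\<close> codes fall into an \<open>M\<close> by \<open>M\<close> square; enlarging to
      the square separates levels from balls.\<close>
    also have "\<dots> \<le> (\<Sum>z\<in>{..<M} \<times> {..<M}. h z)"
    proof (intro sum_mono2)
      show "prod_decode ` {..<M} \<subseteq> {..<M} \<times> {..<M}"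
      proof
        fix z assume "z \<in> prod_decode ` {..<M}"
        then obtain n where n: "n < M" "z = prod_decode n" by auto
        then have "prod_encode (fst z, snd z) < M" by simp
        then have "fst z < M" "snd z < M"
          using le_prod_encode_1[of "fst z" "snd z"] le_prod_encode_2[of "snd z" "fst z"] by linarith+
        then show "z \<in> {..<M} \<times> {..<M}" by (cases z) auto
      qed
    qed (use a0 in \<open>auto simp: h_def\<close>)
    also have "\<dots> = (\<Sum>k<M. a k * (\<Sum>l<M. \<bar>pderivs is (b k l) x\<bar>))"
      by (simp add: sum.cartesian_product[symmetric] h_def sum_distrib_left)
    also have "\<dots> \<le> (\<Sum>k<M. a k * (C * indicator (E k) x))"
      using a0 bd[OF l] by (intro sum_mono mult_left_mono) auto
    also have "\<dots> = C * (\<Sum>k<M. a k * indicator (E k) x)"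
      by (simp only: sum_distrib_left mult.left_commute)
    finally show ?thesis .
  qed
  \<comment> \<open>Controls the \<open>p\<close>-th power of the sum of \<open>2 ^ i\<close> over
    the levels containing \<open>x\<close>, in a form that can be integrated term by term.\<close>
  define T where "T x = (\<Sum>k. ennreal (2 powr (p * of_int (int_decode k))) * indicator (E k) x)" for x
  have [measurable]: "T \<in> borel_measurable borel" unfolding T_def by measurable
  have Tfin: "(\<integral>\<^sup>+ x. T x * ennreal (bdist \<Omega> x powr s) \<partial>lebesgue_on \<Omega>) < \<infinity>"
  proof -
    have "(\<integral>\<^sup>+ x. T x * ennreal (bdist \<Omega> x powr s) \<partial>lebesgue_on \<Omega>)
       = (\<integral>\<^sup>+ x. T x * ennreal (bdist \<Omega> x powr s) * indicator \<Omega> x \<partial>lborel)"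
      by (intro nn_integral_lebesgue_on_eq_lborel \<Omega>) measurable
    also have "\<dots> \<le> (\<integral>\<^sup>+ x. (\<Sum>k. ennreal (2 powr (p * of_int (int_decode k))) * (ennreal (bdist \<Omega> x powr s) * indicator (E k) x)) \<partial>lborel)"
    proof (intro nn_integral_mono)
      fix x
      have "T x * ennreal (bdist \<Omega> x powr s) * indicator \<Omega> x \<le> T x * ennreal (bdist \<Omega> x powr s)"
        by (simp add: indicator_def)
      also have "\<dots> = (\<Sum>k. ennreal (2 powr (p * of_int (int_decode k))) * indicator (E k) x * ennreal (bdist \<Omega> x powr s))"
        unfolding T_def by (rule ennreal_suminf_multc[symmetric])
      finally show "T x * ennreal (bdist \<Omega> x powr s) * indicator \<Omega> x \<le>
        (\<Sum>k. ennreal (2 powr (p * of_int (int_decode k))) * (ennreal (bdist \<Omega> x powr s) * indicator (E k) x))"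
        by (simp only: mult.assoc mult.commute[of "indicator _ _"])
    qed
    also have "\<dots> = (\<Sum>k. \<integral>\<^sup>+ x. ennreal (2 powr (p * of_int (int_decode k))) * (ennreal (bdist \<Omega> x powr s) * indicator (E k) x) \<partial>lborel)"
      by (intro nn_integral_suminf) measurable
    also have "\<dots> = (\<Sum>k. ennreal (2 powr (p * of_int (int_decode k))) * (\<integral>\<^sup>+ x. ennreal (bdist \<Omega> x powr s) * indicator (E k) x \<partial>lborel))"
      by (subst nn_integral_cmult) auto
    also have "\<dots> < \<infinity>" unfolding E_def by (rule avg_level_strong_type[OF \<Omega> g p fin])
    finally show ?thesis .
  qed
  have Tm: "(\<lambda>x. T x * ennreal (bdist \<Omega> x powr s)) \<in> borel_measurable (lebesgue_on \<Omega>)"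
    by (intro borel_measurable_lebesgue_onI) measurable
  have AET: "AE x in lebesgue_on \<Omega>. T x < \<infinity>"
  proof -
    have "AE x in lebesgue_on \<Omega>. T x * ennreal (bdist \<Omega> x powr s) \<noteq> \<infinity>"
      using Tfin by (intro nn_integral_PInf_AE Tm) auto
    moreover have "AE x in lebesgue_on \<Omega>. x \<in> \<Omega>" by (intro AE_I2) (simp add: space_restrict_space)
    ultimately show ?thesis
    proof eventually_elim
      case (elim x)
      have "bdist \<Omega> x powr s > 0" using bdist_pos[OF \<Omega> elim(2)] by simp
      then have "ennreal (bdist \<Omega> x powr s) \<noteq> 0" by simp
      then show ?case using elim(1) by (cases "T x = top") (auto simp: ennreal_top_mult less_top)
    qed
  qed
  \<comment> \<open>\<open>enn2real\<close> sends an infinite \<open>T x\<close> to 0; the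
    domination by \<open>G\<close> is claimed only where \<open>T x\<close> is finite.\<close>
  define G where "G x = C * (2 * enn2real (T x) powr (1 / p))" for x
  have GLp: "G \<in> weighted_Lp \<Omega> p s"
    unfolding weighted_Lp_iff
  proof
    show "G \<in> borel_measurable (lebesgue_on \<Omega>)"
      unfolding G_def by (intro borel_measurable_lebesgue_onI) measurable
    have "weighted_nn_integral \<Omega> p s G \<le> (\<integral>\<^sup>+ x. ennreal ((2 * C) powr p) * (T x * ennreal (bdist \<Omega> x powr s)) \<partial>lebesgue_on \<Omega>)"
      unfolding weighted_nn_integral_def
    proof (intro nn_integral_mono)
      fix x
      have "\<bar>G x\<bar> powr p = (2 * C) powr p * enn2real (T x)"
        using C p0 by (simp add: G_def abs_mult powr_mult powr_powr)
      then have "ennreal (\<bar>G x\<bar> powr p * bdist \<Omega> x powr s) = ennreal ((2 * C) powr p) * (ennreal (enn2real (T x)) * ennreal (bdist \<Omega> x powr s))"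
        by (simp add: ennreal_mult'[symmetric] mult.assoc)
      also have "\<dots> \<le> ennreal ((2 * C) powr p) * (T x * ennreal (bdist \<Omega> x powr s))"
        by (intro mult_left_mono mult_right_mono) (auto simp: ennreal_enn2real_if)
      finally show "ennreal (\<bar>G x\<bar> powr p * bdist \<Omega> x powr s) \<le> ennreal ((2 * C) powr p) * (T x * ennreal (bdist \<Omega> x powr s))" .
    qed
    also have "\<dots> = ennreal ((2 * C) powr p) * (\<integral>\<^sup>+ x. T x * ennreal (bdist \<Omega> x powr s) \<partial>lebesgue_on \<Omega>)"
      by (intro nn_integral_cmult Tm)
    also have "\<dots> < \<infinity>" using Tfin by (simp add: ennreal_mult_less_top)
    finally show "weighted_nn_integral \<Omega> p s G < \<infinity>" .
  qed
  have FG: "(\<Sum>n<M. \<bar>pderivs is (F n) x\<bar>) \<le> G x" if x: "T x < \<infinity>" and l: "length is \<le> m" for "is" M x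
  proof -
    have "ennreal (\<Sum>k<M. 2 powr (p * of_int (int_decode k)) * indicator (E k) x) =
        (\<Sum>k<M. ennreal (2 powr (p * of_int (int_decode k))) * indicator (E k) x)"
      by (simp flip: sum_ennreal add: ennreal_mult' ennreal_indicator)
    also have "\<dots> \<le> T x" unfolding T_def by (intro sum_le_suminf) auto
    also have "\<dots> = ennreal (enn2real (T x))" using x by simp
    finally have le: "(\<Sum>k<M. 2 powr (p * of_int (int_decode k)) * indicator (E k) x) \<le> enn2real (T x)" by simp
    have "(\<Sum>k<M. a k * indicator (E k) x) = ((\<Sum>k<M. a k * indicator (E k) x) powr p) powr (1 / p)"
      using p0 a0 by (simp add: powr_powr sum_nonneg)
    also have "\<dots> \<le> (2 powr p * enn2real (T x)) powr (1 / p)"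
      using powr_sum_levels_le[OF p0, where n=M and E=E and x=x] le p0
      by (intro powr_mono2) (auto simp: a_def intro: order_trans)
    also have "\<dots> = 2 * enn2real (T x) powr (1 / p)"
      using p0 by (simp add: powr_mult powr_powr)
    finally have "C * (\<Sum>k<M. a k * indicator (E k) x) \<le> G x"
      unfolding G_def using C by (intro mult_left_mono) auto
    then show ?thesis using sumF[OF l, of x M] by linarith
  qed
  define V where "V is x = (\<Sum>n. pderivs is (F n) x)" for "is" x
  define f where "f M x = (\<Sum>n<M. F n x)" for M x
  have df: "pderivs is (f M) x = (\<Sum>n<M. pderivs is (F n) x)" for "is" M x
    unfolding f_def by (subst pderivs_sum) (auto intro: test_functionsD(1)[OF FT])
  have summ: "summable (\<lambda>n. pderivs is (F n) x)" if "T x < \<infinity>" "length is \<le> m" for "is" x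
    using FG[OF that] by (rule summable_abs_if_bounded)
  have W: "V [] \<in> weighted_Sobolev0 \<Omega> m p s"
  proof (rule weighted_Sobolev0_dominated[OF \<Omega> _ _ GLp, where f=f])
    show "1 \<le> p" using p by simp
    show "f j \<in> test_functions \<Omega>" for j unfolding f_def by (intro test_functions_sum FT)
    fix "is" :: "'n list" assume l: "length is \<le> m"
    show "AE x in lebesgue_on \<Omega>. \<bar>pderivs is (f j) x\<bar> \<le> G x" for j
      using AET
    proof eventually_elim
      case (elim x)
      have "\<bar>pderivs is (f j) x\<bar> \<le> (\<Sum>n<j. \<bar>pderivs is (F n) x\<bar>)" unfolding df by (rule sum_abs)
      then show ?case using FG[OF elim l, of j] by linarith
    qed
    show "V is \<in> borel_measurable (lebesgue_on \<Omega>)"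
      unfolding V_def
      by (intro borel_measurable_lebesgue_onI borel_measurable_suminf smooth_borel_measurable smooth_pderivs test_functionsD(1)[OF FT])
    show "AE x in lebesgue_on \<Omega>. (\<lambda>j. pderivs is (f j) x) \<longlonglongrightarrow> V is x"
      using AET
    proof eventually_elim
      case (elim x)
      show ?case unfolding df V_def by (rule summable_LIMSEQ[OF summ[OF elim l]])
    qed
  qed
  have S: "summable (\<lambda>n. F n x)" if "T x < \<infinity>" for x using summ[OF that, of "[]"] by simp
  have P: "AE x in lebesgue_on \<Omega>. 0 \<le> V [] x"
    using AET by eventually_elim (auto simp: V_def intro!: suminf_nonneg S F0)
  have L: "AE x in lebesgue_on \<Omega>. level_sum \<Omega> g m x \<le> ennreal (V [] x)"
    using AET
  proof eventually_elim
    case (elim x)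
    have "ennreal (V [] x) = (\<Sum>n. ennreal (F n x))"
      unfolding V_def using S[OF elim] F0 by (simp add: suminf_ennreal2)
    also have "\<dots> = (\<Sum>n. (\<lambda>(k, l). ennreal (a k * b k l x)) (prod_decode n))"
      by (simp add: F_def case_prod_beta)
    also have "\<dots> = (\<Sum>k. \<Sum>l. ennreal (a k * b k l x))"
      by (rule suminf_ennreal_2dimen) simp
    also have "\<dots> \<ge> (\<Sum>k. ennreal (a k * capped_dist (E k) x ^ m))"
    proof (rule suminf_le)
      show "ennreal (a k * capped_dist (E k) x ^ m) \<le> (\<Sum>l. ennreal (a k * b k l x))" for k
      proof (cases "x \<in> E k")
        case True
        then obtain l where "capped_dist (E k) x ^ m \<le> b k l x" using bl by blast
        then have "ennreal (a k * capped_dist (E k) x ^ m) \<le> ennreal (a k * b k l x)"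
          using a0 by (intro ennreal_leI mult_left_mono) auto
        also have "\<dots> \<le> (\<Sum>l. ennreal (a k * b k l x))" by (rule ennreal_le_suminf)
        finally show ?thesis .
      next
        case False
        \<comment> \<open>Outside the level set no bump is available, but the term to be bounded is
          then \<open>0 ^ m\<close>, which vanishes because \<open>m\<close> is positive.\<close>
        then have "capped_dist (E k) x = 0" by (simp add: capped_dist_def infdist_zero)
        then show ?thesis using m by (simp add: zero_power)
      qed
    qed auto
    finally show ?case by (simp add: a_def E_def level_sum_def)
  qed
  show ?thesis by (rule that[OF W P L])
qed

section \<open>Pointwise bounds by averages of derivatives\<close>

text \<open>An \<open>m\<close>-th order difference annihilates polynomials of degree below
  \<open>m\<close>, since each difference lowers the degree. The shift \<open>a\<close> is carried
  along because the Taylor polynomials below are based at 1.\<close>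

lemma alternating_binomial_sum_eq_0:
  assumes "j < m"
  shows "(\<Sum>k\<le>m. (-1) ^ k * real (m choose k) * (real k + a) ^ j) = 0"
  using assms
proof (induction m arbitrary: j a)
  case (Suc m)
  have shift: "(\<Sum>k\<le>Suc m. (-1) ^ k * real (Suc m choose k) * f k) =
      (\<Sum>k\<le>m. (-1) ^ k * real (m choose k) * (f k - f (Suc k)))" for f :: "nat \<Rightarrow> real"
  proof -
    have e: "(\<Sum>k\<le>Suc m. (-1) ^ k * real (m choose k) * f k) =
       f 0 + (\<Sum>k\<le>m. (-1) ^ Suc k * real (m choose Suc k) * f (Suc k))"
      by (subst sum.atMost_Suc_shift) simp
    have "(\<Sum>k\<le>Suc m. (-1) ^ k * real (Suc m choose k) * f k) =
       f 0 + (\<Sum>k\<le>m. (-1) ^ Suc k * real (Suc m choose Suc k) * f (Suc k))"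
      by (subst sum.atMost_Suc_shift) simp
    also have "(\<Sum>k\<le>m. (-1) ^ Suc k * real (Suc m choose Suc k) * f (Suc k)) =
       (\<Sum>k\<le>m. (-1) ^ Suc k * real (m choose k) * f (Suc k)) + (\<Sum>k\<le>m. (-1) ^ Suc k * real (m choose Suc k) * f (Suc k))"
      by (simp add: sum.distrib[symmetric] algebra_simps)
    also have "f 0 + ((\<Sum>k\<le>m. (-1) ^ Suc k * real (m choose k) * f (Suc k)) + (\<Sum>k\<le>m. (-1) ^ Suc k * real (m choose Suc k) * f (Suc k)))
       = (\<Sum>k\<le>m. (-1) ^ Suc k * real (m choose k) * f (Suc k)) + (\<Sum>k\<le>Suc m. (-1) ^ k * real (m choose k) * f k)"
      using e by simp
    also have "(\<Sum>k\<le>Suc m. (-1) ^ k * real (m choose k) * f k) = (\<Sum>k\<le>m. (-1) ^ k * real (m choose k) * f k)"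
      by simp
    finally show ?thesis by (simp add: sum.distrib[symmetric] algebra_simps)
  qed
  have pow: "(real k + a) ^ j - (real (Suc k) + a) ^ j = - (\<Sum>l<j. real (j choose l) * (real k + a) ^ l)" for k
  proof -
    have "(real (Suc k) + a) ^ j = ((real k + a) + 1) ^ j" by (simp add: algebra_simps)
    also have "\<dots> = (\<Sum>l\<le>j. real (j choose l) * (real k + a) ^ l)"
      by (subst binomial_ring) simp
    also have "\<dots> = (\<Sum>l<j. real (j choose l) * (real k + a) ^ l) + (real k + a) ^ j"
      by (simp add: lessThan_Suc_atMost[symmetric])
    finally show ?thesis by simp
  qed
  have "(\<Sum>k\<le>Suc m. (-1) ^ k * real (Suc m choose k) * (real k + a) ^ j) =
     (\<Sum>k\<le>m. (-1) ^ k * real (m choose k) * - (\<Sum>l<j. real (j choose l) * (real k + a) ^ l))"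
    unfolding shift pow ..
  also have "\<dots> = - (\<Sum>k\<le>m. \<Sum>l<j. real (j choose l) * ((-1) ^ k * real (m choose k) * (real k + a) ^ l))"
    by (simp add: sum_distrib_left sum_negf mult.left_commute mult.assoc)
  also have "\<dots> = - (\<Sum>l<j. real (j choose l) * (\<Sum>k\<le>m. (-1) ^ k * real (m choose k) * (real k + a) ^ l))"
    by (subst sum.swap) (simp add: sum_distrib_left)
  also have "\<dots> = 0" using Suc by simp
  finally show ?case .
qed simp

text \<open>
  The sum is the Taylor polynomial of \<open>G 0\<close> with base point \<open>\<tau>\<close>, evaluated at the fixed point \<open>c\<close>.
\<close>

lemma taylor_base_point_derivative:
  fixes G :: "nat \<Rightarrow> real \<Rightarrow> real"
  assumes "\<And>j t. (G j has_real_derivative G (Suc j) t) (at t)"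
  shows "((\<lambda>\<tau>. \<Sum>j<Suc n. (c - \<tau>) ^ j / fact j * G j \<tau>) has_real_derivative
    (c - \<tau>) ^ n / fact n * G (Suc n) \<tau>) (at \<tau>)"
proof (induction n)
  case 0
  then show ?case using assms[of 0] by simp
next
  case (Suc n)
  have "((\<lambda>\<tau>. (c - \<tau>) ^ Suc n / fact (Suc n) * G (Suc n) \<tau>) has_real_derivative
     - ((c - \<tau>) ^ n / fact n) * G (Suc n) \<tau> + (c - \<tau>) ^ Suc n / fact (Suc n) * G (Suc (Suc n)) \<tau>) (at \<tau>)"
  proof -
    have "((\<lambda>\<tau>. (c - \<tau>) ^ Suc n / fact (Suc n)) has_real_derivative - ((c - \<tau>) ^ n / fact n)) (at \<tau>)"
      by (rule derivative_eq_intros refl | simp add: field_simps del: of_nat_Suc)+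
    from DERIV_mult'[OF this assms[of "Suc n"]] show ?thesis by (simp add: algebra_simps)
  qed
  from DERIV_add[OF Suc this] show ?case by simp
qed

text \<open>The alternating binomial sum is applied to Taylor remainders with base point 1; the
  polynomial parts cancel, so no intermediate derivative survives. Base point 1 instead of 0
  produces the weight: for evaluation at 0 the kernel is \<open>\<tau> ^ (m - 1)\<close> up to a
  constant, and for evaluation at \<open>k \<ge> 1\<close> only \<open>\<tau> \<ge> 1\<close>
  occurs, where a bounded kernel is dominated by this weight. Integrating the weight over small
  radii is what later gives \<open>\<delta> ^ m\<close>.\<close>

lemma finite_difference_bound:
  fixes G :: "nat \<Rightarrow> real \<Rightarrow> real"
  assumes G: "\<And>j t. (G j has_real_derivative G (Suc j) t) (at t)" and m: "0 < m"
  shows "\<bar>G 0 0\<bar> \<le> (\<Sum>k\<in>{1..m}. real (m choose k) * \<bar>G 0 (real k)\<bar>) +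
    2 ^ m * real m ^ (m - 1) * integral {0..real m} (\<lambda>\<tau>. \<tau> ^ (m - 1) * \<bar>G m \<tau>\<bar>)"
proof -
  obtain n where n: "m = Suc n" using m by (cases m) auto
  define P where "P c \<tau> = (\<Sum>j<m. (c - \<tau>) ^ j / fact j * G j \<tau>)" for c \<tau>
  have P: "(P c has_real_derivative (c - \<tau>) ^ n / fact n * G m \<tau>) (at \<tau>)" for c \<tau>
    unfolding P_def n by (rule taylor_base_point_derivative[where G=G, OF G])
  have Pc: "P c c = G 0 c" for c unfolding P_def n
    by (subst sum.lessThan_Suc_shift) simp
  have cont: "continuous_on S (G m)" for S
    using G DERIV_continuous_on has_field_derivative_at_within by blast
  define R where "R = integral {0..real m} (\<lambda>\<tau>. \<tau> ^ n * \<bar>G m \<tau>\<bar>)"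
  have diff: "\<bar>P c b - P c a\<bar> \<le> real m ^ n * R"
    if ab: "0 \<le> a" "a \<le> b" "b \<le> real m" and le: "\<And>\<tau>. a \<le> \<tau> \<Longrightarrow> \<tau> \<le> b \<Longrightarrow> \<bar>c - \<tau>\<bar> ^ n \<le> real m ^ n * \<tau> ^ n" for a b c
  proof -
    have hi: "((\<lambda>\<tau>. (c - \<tau>) ^ n / fact n * G m \<tau>) has_integral (P c b - P c a)) {a..b}"
      using P ab by (intro fundamental_theorem_of_calculus)
        (auto simp: has_real_derivative_iff_has_vector_derivative[symmetric] intro: has_field_derivative_at_within)
    have "norm (integral {a..b} (\<lambda>\<tau>. (c - \<tau>) ^ n / fact n * G m \<tau>)) \<le> integral {a..b} (\<lambda>\<tau>. real m ^ n * (\<tau> ^ n * \<bar>G m \<tau>\<bar>))"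
    proof (rule integral_norm_bound_integral)
      show "(\<lambda>\<tau>. (c - \<tau>) ^ n / fact n * G m \<tau>) integrable_on {a..b}" using hi by blast
      show "(\<lambda>\<tau>. real m ^ n * (\<tau> ^ n * \<bar>G m \<tau>\<bar>)) integrable_on {a..b}"
        by (intro integrable_continuous_interval continuous_intros cont)
      fix \<tau> assume \<tau>: "\<tau> \<in> {a..b}"
      have "\<bar>c - \<tau>\<bar> ^ n / fact n \<le> \<bar>c - \<tau>\<bar> ^ n"
        by (simp add: divide_le_eq mult_le_cancel_left1 fact_ge_1)
      also have "\<dots> \<le> real m ^ n * \<tau> ^ n" using le \<tau> by auto
      finally have "\<bar>c - \<tau>\<bar> ^ n / fact n * \<bar>G m \<tau>\<bar> \<le> real m ^ n * \<tau> ^ n * \<bar>G m \<tau>\<bar>"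
        by (intro mult_right_mono) auto
      then show "norm ((c - \<tau>) ^ n / fact n * G m \<tau>) \<le> real m ^ n * (\<tau> ^ n * \<bar>G m \<tau>\<bar>)"
        by (simp add: abs_mult power_abs mult.assoc)
    qed
    also have "\<dots> \<le> integral {0..real m} (\<lambda>\<tau>. real m ^ n * (\<tau> ^ n * \<bar>G m \<tau>\<bar>))"
      using ab by (intro integral_subset_le integrable_continuous_interval continuous_intros cont) auto
    also have "\<dots> = real m ^ n * R" unfolding R_def by simp
    finally show ?thesis unfolding integral_unique[OF hi] by simp
  qed
  have rem: "\<bar>G 0 (real k) - P (real k) 1\<bar> \<le> real m ^ n * R" if k: "k \<le> m" for k
  proof (cases "k = 0")
    case True
    have "\<bar>0 - \<tau>\<bar> ^ n \<le> real m ^ n * \<tau> ^ n" if "0 \<le> \<tau>" for \<tau>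
    proof -
      have "1 * \<tau> ^ n \<le> real m ^ n * \<tau> ^ n" using that m by (intro mult_right_mono one_le_power) auto
      then show ?thesis using that by simp
    qed
    then have "\<bar>P 0 1 - P 0 0\<bar> \<le> real m ^ n * R" using m by (intro diff) auto
    then show ?thesis using True by (simp add: Pc abs_minus_commute)
  next
    case False
    have "\<bar>real k - \<tau>\<bar> ^ n \<le> real m ^ n * \<tau> ^ n" if "1 \<le> \<tau>" "\<tau> \<le> real k" for \<tau>
    proof -
      have "\<bar>real k - \<tau>\<bar> ^ n \<le> real m ^ n" using that k by (intro power_mono) auto
      also have "\<dots> \<le> real m ^ n * \<tau> ^ n"
        using that one_le_power[of \<tau> n] by (simp add: mult_le_cancel_left1)
      finally show ?thesis .
    qed
    then have "\<bar>P (real k) (real k) - P (real k) 1\<bar> \<le> real m ^ n * R" using False k by (intro diff) auto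
    then show ?thesis by (simp add: Pc)
  qed
  \<comment> \<open>\<open>P (real k) 1\<close> is a polynomial in \<open>k - 1\<close> of degree
    below \<open>m\<close>, with coefficients independent of \<open>k\<close>.\<close>
  have zero: "(\<Sum>k\<le>m. (-1) ^ k * real (m choose k) * P (real k) 1) = 0"
  proof -
    have "(\<Sum>k\<le>m. (-1) ^ k * real (m choose k) * P (real k) 1) =
       (\<Sum>j<m. G j 1 / fact j * (\<Sum>k\<le>m. (-1) ^ k * real (m choose k) * (real k + - 1) ^ j))"
      unfolding P_def sum_distrib_left by (subst sum.swap) (simp add: field_simps)
    also have "\<dots> = 0"
      by (intro sum.neutral ballI) (simp only: alternating_binomial_sum_eq_0 lessThan_iff mult_zero_right)
    finally show ?thesis .
  qed
  have "(\<Sum>k\<le>m. (-1) ^ k * real (m choose k) * (G 0 (real k) - P (real k) 1)) =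
      (\<Sum>k\<le>m. (-1) ^ k * real (m choose k) * G 0 (real k))"
    using zero by (simp add: right_diff_distrib sum_subtractf)
  also have "\<dots> = G 0 0 + (\<Sum>k\<in>{1..m}. (-1) ^ k * real (m choose k) * G 0 (real k))"
    by (simp add: atMost_atLeast0 sum.atLeast_Suc_atMost)
  finally have "G 0 0 = (\<Sum>k\<le>m. (-1) ^ k * real (m choose k) * (G 0 (real k) - P (real k) 1)) -
     (\<Sum>k\<in>{1..m}. (-1) ^ k * real (m choose k) * G 0 (real k))" by simp
  then have "\<bar>G 0 0\<bar> \<le> \<bar>\<Sum>k\<le>m. (-1) ^ k * real (m choose k) * (G 0 (real k) - P (real k) 1)\<bar> +
     \<bar>\<Sum>k\<in>{1..m}. (-1) ^ k * real (m choose k) * G 0 (real k)\<bar>" by linarith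
  also have "\<bar>\<Sum>k\<le>m. (-1) ^ k * real (m choose k) * (G 0 (real k) - P (real k) 1)\<bar> \<le>
     (\<Sum>k\<le>m. real (m choose k) * (real m ^ n * R))"
    by (rule order_trans[OF sum_abs]) (auto intro!: sum_mono mult_left_mono rem simp: abs_mult)
  also have "\<dots> = 2 ^ m * (real m ^ n * R)"
    using choose_row_sum[of m] by (simp flip: sum_distrib_right of_nat_sum)
  also have "\<bar>\<Sum>k\<in>{1..m}. (-1) ^ k * real (m choose k) * G 0 (real k)\<bar> \<le> (\<Sum>k\<in>{1..m}. real (m choose k) * \<bar>G 0 (real k)\<bar>)"
    by (rule order_trans[OF sum_abs]) (auto intro!: sum_mono simp: abs_mult)
  finally show ?thesis by (simp add: R_def n mult.assoc)
qed

section \<open>Differences along rays and averages over directions\<close>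

definition deriv_abs_sum :: "nat \<Rightarrow> (real ^ 'n::finite \<Rightarrow> real) \<Rightarrow> real ^ 'n \<Rightarrow> real" where
  "deriv_abs_sum m \<phi> y = (\<Sum>is | length is = m. \<bar>pderivs is \<phi> y\<bar>)"

lemma deriv_abs_sum_nonneg: "0 \<le> deriv_abs_sum m \<phi> y"
  by (simp add: deriv_abs_sum_def sum_nonneg)

lemma deriv_abs_sum_measurable:
  assumes "smooth \<phi>"
  shows "deriv_abs_sum m \<phi> \<in> borel_measurable borel"
  unfolding deriv_abs_sum_def
  by (intro borel_measurable_sum borel_measurable_abs smooth_borel_measurable smooth_pderivs assms)

lemma sum_lists_Suc:
  fixes f :: "'n::finite list \<Rightarrow> real"
  shows "(\<Sum>is | length is = Suc j. f is) = (\<Sum>is | length is = j. \<Sum>i\<in>UNIV. f (i # is))"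
proof -
  have "(\<Sum>is | length is = Suc j. f is) = (\<Sum>(is, i) \<in> {is. length is = j} \<times> UNIV. f (i # is))"
    by (rule sum.reindex_bij_witness[where j="\<lambda>is. (tl is, hd is)" and i="\<lambda>(is, i). i # is"])
       (auto simp: length_Suc_conv)
  then show ?thesis by (simp add: sum.cartesian_product)
qed

text \<open>Differentiating once more along the line puts a new direction at the head of the list,
  exactly where \<open>pderivs\<close> differentiates last, so no symmetry of mixed derivatives is
  invoked.\<close>

lemma ray_derivative:
  fixes \<phi> :: "real ^ 'n::finite \<Rightarrow> real" and x h :: "real ^ 'n"
  assumes "smooth \<phi>"
  defines "G \<equiv> \<lambda>j \<tau>. \<Sum>is | length is = j. (\<Prod>i\<leftarrow>is. h $ i) * pderivs is \<phi> (x + \<tau> *\<^sub>R h)"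
  shows "(G j has_real_derivative G (Suc j) \<tau>) (at \<tau>)"
proof -
  have d: "((\<lambda>\<tau>. f (x + \<tau> *\<^sub>R h)) has_real_derivative (\<Sum>i\<in>UNIV. h $ i * pderivs [i] f (x + \<tau> *\<^sub>R h))) (at \<tau>)"
    if f: "smooth f" for f
  proof -
    let ?D = "frechet_derivative f (at (x + \<tau> *\<^sub>R h))"
    have "((\<lambda>\<tau>. x + \<tau> *\<^sub>R h) has_derivative (\<lambda>s. s *\<^sub>R h)) (at \<tau>)"
      by (auto intro!: derivative_eq_intros)
    from has_derivative_compose[OF this smooth_differentiable[OF f, unfolded frechet_derivative_works]]
    have 1: "((\<lambda>\<tau>. f (x + \<tau> *\<^sub>R h)) has_derivative (\<lambda>s. ?D (s *\<^sub>R h))) (at \<tau>)" .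
    have lin: "linear ?D" using f by (simp add: linear_frechet_derivative smooth_differentiable)
    have "?D h = ?D (\<Sum>i\<in>UNIV. h $ i *\<^sub>R axis i 1)"
      using basis_expansion[of h] by (simp add: scalar_mult_eq_scaleR)
    also have "\<dots> = (\<Sum>i\<in>UNIV. h $ i * ?D (axis i 1))"
      using lin by (simp add: linear_sum linear_scale)
    finally have "?D (s *\<^sub>R h) = s * (\<Sum>i\<in>UNIV. h $ i * pderivs [i] f (x + \<tau> *\<^sub>R h))" for s
      using lin by (simp add: linear_scale)
    with 1 show ?thesis by (simp add: has_field_derivative_def mult_commute_abs)
  qed
  have "(G j has_real_derivative (\<Sum>is | length is = j. (\<Prod>i\<leftarrow>is. h $ i) * (\<Sum>i\<in>UNIV. h $ i * pderivs [i] (pderivs is \<phi>) (x + \<tau> *\<^sub>R h)))) (at \<tau>)"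
    unfolding G_def by (intro DERIV_sum DERIV_cmult d smooth_pderivs assms)
  also have "(\<Sum>is | length is = j. (\<Prod>i\<leftarrow>is. h $ i) * (\<Sum>i\<in>UNIV. h $ i * pderivs [i] (pderivs is \<phi>) (x + \<tau> *\<^sub>R h))) = G (Suc j) \<tau>"
    unfolding G_def sum_lists_Suc by (simp add: sum_distrib_left mult.assoc mult.left_commute)
  finally show ?thesis .
qed

lemma abs_prod_list_components_le: "\<bar>\<Prod>i\<leftarrow>is. (h :: real ^ 'n) $ i\<bar> \<le> norm h ^ length is"
  by (induction "is") (auto simp: abs_mult intro!: mult_mono component_le_norm_cart)

text \<open>The \<open>m\<close>-th derivative along the ray is homogeneous of degree
  \<open>m\<close> in \<open>h\<close>, which produces \<open>r ^ m\<close>. The extended reals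
  allow integrating the bound over \<open>h\<close> without integrability conditions.\<close>

lemma ray_bound:
  fixes \<phi> :: "real ^ 'n::finite \<Rightarrow> real"
  assumes \<phi>: "smooth \<phi>" and m: "0 < m" and h: "norm h \<le> r"
  shows "ennreal \<bar>\<phi> x\<bar> \<le> (\<Sum>k\<in>{1..m}. ennreal (real (m choose k)) * ennreal \<bar>\<phi> (x + real k *\<^sub>R h)\<bar>) +
    ennreal (2 ^ m * real m ^ (m - 1) * r ^ m) *
    (\<integral>\<^sup>+ \<tau>. ennreal (\<tau> ^ (m - 1)) * ennreal (deriv_abs_sum m \<phi> (x + \<tau> *\<^sub>R h)) * indicator {0..real m} \<tau> \<partial>lborel)"
proof -
  let ?F = "\<lambda>\<tau>. ennreal (\<tau> ^ (m - 1)) * ennreal (deriv_abs_sum m \<phi> (x + \<tau> *\<^sub>R h)) * indicator {0..real m} \<tau>"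
  let ?S = "\<Sum>k\<in>{1..m}. ennreal (real (m choose k)) * ennreal \<bar>\<phi> (x + real k *\<^sub>R h)\<bar>"
  let ?J = "\<integral>\<^sup>+ \<tau>. ?F \<tau> \<partial>lborel"
  define G where "G = (\<lambda>j \<tau>. \<Sum>is | length is = j. (\<Prod>i\<leftarrow>is. h $ i) * pderivs is \<phi> (x + \<tau> *\<^sub>R h))"
  have G: "(G j has_real_derivative G (Suc j) t) (at t)" for j t
    unfolding G_def by (rule ray_derivative[OF \<phi>])
  have G0: "G 0 \<tau> = \<phi> (x + \<tau> *\<^sub>R h)" for \<tau> by (simp add: G_def)
  have r: "0 \<le> r" using h norm_ge_zero[of h] by linarith
  have Gm: "\<bar>G m \<tau>\<bar> \<le> r ^ m * deriv_abs_sum m \<phi> (x + \<tau> *\<^sub>R h)" for \<tau>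
  proof -
    have "\<bar>G m \<tau>\<bar> \<le> (\<Sum>is | length is = m. \<bar>\<Prod>i\<leftarrow>is. h $ i\<bar> * \<bar>pderivs is \<phi> (x + \<tau> *\<^sub>R h)\<bar>)"
      unfolding G_def by (rule order_trans[OF sum_abs]) (simp add: abs_mult)
    also have "\<dots> \<le> (\<Sum>is | length is = m. r ^ m * \<bar>pderivs is \<phi> (x + \<tau> *\<^sub>R h)\<bar>)"
    proof (intro sum_mono mult_right_mono)
      fix "is" :: "'n list" assume "is \<in> {is. length is = m}"
      then have "\<bar>\<Prod>i\<leftarrow>is. h $ i\<bar> \<le> norm h ^ m" using abs_prod_list_components_le[of h "is"] by simp
      also have "\<dots> \<le> r ^ m" using h by (intro power_mono) auto
      finally show "\<bar>\<Prod>i\<leftarrow>is. h $ i\<bar> \<le> r ^ m" .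
    qed simp
    finally show ?thesis by (simp add: deriv_abs_sum_def sum_distrib_left)
  qed
  have cont: "continuous_on S (G m)" for S
    using G DERIV_continuous_on has_field_derivative_at_within by blast
  define I where "I = integral {0..real m} (\<lambda>\<tau>. \<tau> ^ (m - 1) * \<bar>G m \<tau>\<bar>)"
  have "ennreal I = (\<integral>\<^sup>+ \<tau>. ennreal (\<tau> ^ (m - 1) * \<bar>G m \<tau>\<bar>) * indicator {0..real m} \<tau> \<partial>lborel)"
  proof -
    have "((\<lambda>\<tau>. \<tau> ^ (m - 1) * \<bar>G m \<tau>\<bar>) has_integral I) {0..real m}"
      unfolding I_def by (intro integrable_integral integrable_continuous_interval continuous_intros cont)
    then show ?thesis
      by (intro nn_integral_has_integral_lebesgue'[symmetric]) auto
  qed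
  also have "\<dots> \<le> (\<integral>\<^sup>+ \<tau>. ennreal (r ^ m) * ?F \<tau> \<partial>lborel)"
  proof (intro nn_integral_mono)
    fix \<tau> :: real
    show "ennreal (\<tau> ^ (m - 1) * \<bar>G m \<tau>\<bar>) * indicator {0..real m} \<tau> \<le>
       ennreal (r ^ m) * ?F \<tau>"
    proof (cases "\<tau> \<in> {0..real m}")
      case True
      then have "\<tau> ^ (m - 1) * \<bar>G m \<tau>\<bar> \<le> r ^ m * (\<tau> ^ (m - 1) * deriv_abs_sum m \<phi> (x + \<tau> *\<^sub>R h))"
        using mult_left_mono[OF Gm[of \<tau>], of "\<tau> ^ (m - 1)"] by (simp add: mult.left_commute)
      then show ?thesis using True r deriv_abs_sum_nonneg[of m \<phi> "x + \<tau> *\<^sub>R h"]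
        by (simp add: ennreal_mult'[symmetric] ennreal_leI)
    qed simp
  qed
  also have "\<dots> = ennreal (r ^ m) * ?J"
  proof (intro nn_integral_cmult)
    have [measurable]: "deriv_abs_sum m \<phi> \<in> borel_measurable borel" by (rule deriv_abs_sum_measurable[OF \<phi>])
    show "?F \<in> borel_measurable lborel"
      by measurable
  qed
  finally have I: "ennreal I \<le> ennreal (r ^ m) * ?J" .
  have I0: "0 \<le> I" unfolding I_def by (intro integral_nonneg integrable_continuous_interval continuous_intros cont) auto
  have "\<bar>\<phi> x\<bar> \<le> (\<Sum>k\<in>{1..m}. real (m choose k) * \<bar>\<phi> (x + real k *\<^sub>R h)\<bar>) + 2 ^ m * real m ^ (m - 1) * I"
    using finite_difference_bound[where G=G, OF G m] by (simp add: G0 I_def)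
  then have "ennreal \<bar>\<phi> x\<bar> \<le> ennreal ((\<Sum>k\<in>{1..m}. real (m choose k) * \<bar>\<phi> (x + real k *\<^sub>R h)\<bar>) + 2 ^ m * real m ^ (m - 1) * I)"
    by (rule ennreal_leI)
  also have "\<dots> = ?S + ennreal (2 ^ m * real m ^ (m - 1)) * ennreal I"
    using I0 by (simp add: ennreal_mult' sum_nonneg flip: sum_ennreal)
  also have "\<dots> \<le> ?S +
     ennreal (2 ^ m * real m ^ (m - 1)) * (ennreal (r ^ m) * ?J)"
    using I by (intro add_left_mono mult_left_mono) auto
  finally show ?thesis using r by (simp add: ennreal_mult' mult.assoc)
qed

text \<open>Substitution \<open>y = x + \<tau> h\<close>: averaging over directions at parameter
  \<open>\<tau>\<close> becomes averaging over the ball of radius \<open>\<tau> * r\<close>.\<close>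

lemma nn_integral_ball_scale:
  fixes F :: "'a::euclidean_space \<Rightarrow> ennreal"
  assumes [measurable]: "F \<in> borel_measurable borel" and \<tau>: "0 < \<tau>"
  shows "(\<integral>\<^sup>+ y. F y * indicator (ball x (\<tau> * r)) y \<partial>lborel) =
    ennreal (\<tau> ^ DIM('a)) * (\<integral>\<^sup>+ h. F (x + \<tau> *\<^sub>R h) * indicator (ball 0 r) h \<partial>lborel)"
proof -
  have [measurable]: "ball y t \<in> sets borel" for y :: 'a and t by simp
  have ind: "indicator (ball x (\<tau> * r)) (x + \<tau> *\<^sub>R h) = (indicator (ball 0 r) h :: ennreal)" for h
    using \<tau> by (simp add: indicator_def dist_norm)
  have "(\<integral>\<^sup>+ y. F y * indicator (ball x (\<tau> * r)) y \<partial>lborel) =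
     (\<integral>\<^sup>+ y. F y * indicator (ball x (\<tau> * r)) y \<partial>density (distr lborel borel (\<lambda>h. x + \<tau> *\<^sub>R h)) (\<lambda>_. ennreal (\<bar>\<tau>\<bar> ^ DIM('a))))"
    using \<tau> by (subst (1) lborel_affine[of \<tau> x]) auto
  also have "\<dots> = (\<integral>\<^sup>+ h. ennreal (\<bar>\<tau>\<bar> ^ DIM('a)) * (F (x + \<tau> *\<^sub>R h) * indicator (ball x (\<tau> * r)) (x + \<tau> *\<^sub>R h)) \<partial>lborel)"
    by (simp add: nn_integral_density nn_integral_distr)
  also have "\<dots> = ennreal (\<tau> ^ DIM('a)) * (\<integral>\<^sup>+ h. F (x + \<tau> *\<^sub>R h) * indicator (ball 0 r) h \<partial>lborel)"
    using \<tau> unfolding ind by (simp add: nn_integral_cmult)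
  finally show ?thesis .
qed

lemma emeasure_ball_scale:
  fixes x :: "'a::euclidean_space"
  assumes "0 < \<tau>"
  shows "emeasure lborel (ball x (\<tau> * r)) = ennreal (\<tau> ^ DIM('a)) * emeasure lborel (ball (0::'a) r)"
  using nn_integral_ball_scale[where F="\<lambda>_. 1" and x=x and \<tau>=\<tau> and r=r] assms by simp

text \<open>Largest value of the integrand times length of the interval, which loses a factor
  \<open>m\<close> against \<open>c ^ m / m\<close> but suffices.\<close>

lemma nn_integral_power_level_le:
  assumes "0 \<le> c" "0 < m"
  shows "(\<integral>\<^sup>+ \<tau>. ennreal (\<tau> ^ (m - 1)) * indicator {0..real m} \<tau> * indicator {\<tau>. \<tau> \<le> c} \<tau> \<partial>lborel) \<le> ennreal (c ^ m)"
proof -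
  have "(\<integral>\<^sup>+ \<tau>. ennreal (\<tau> ^ (m - 1)) * indicator {0..real m} \<tau> * indicator {\<tau>. \<tau> \<le> c} \<tau> \<partial>lborel) \<le>
     (\<integral>\<^sup>+ \<tau>. ennreal (c ^ (m - 1)) * indicator {0..c} \<tau> \<partial>lborel)"
    by (intro nn_integral_mono) (auto simp: indicator_def intro!: ennreal_leI power_mono)
  also have "\<dots> = ennreal (c ^ (m - 1)) * ennreal c"
    using assms by (subst nn_integral_cmult_indicator) auto
  also have "\<dots> = ennreal (c ^ m)"
    using assms(1) power_minus_mult[OF assms(2), of c] by (simp flip: ennreal_mult')
  finally show ?thesis .
qed

text \<open>The ray bound is integrated over \<open>h\<close> in the ball of radius \<open>r\<close>
  and the integrals are exchanged. At parameter \<open>\<tau>\<close> this gives an integral over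
  the ball of radius \<open>\<tau> * r\<close>, to which a level contributes only if
  \<open>\<tau> * r \<le> \<delta>\<close>; integrating \<open>\<tau> ^ (m - 1)\<close> up to
  \<open>\<delta> / r\<close> gives \<open>(\<delta> / r) ^ m\<close>, and the \<open>r ^ m\<close>
  of the ray bound removes the scale. The condition on \<open>r\<close> makes all radii up to
  \<open>m * r\<close> admissible in \<open>avg_level\<close>.\<close>

lemma averaged_bound:
  fixes \<Omega> :: "(real ^ 'n::finite) set"
  assumes \<Omega>: "open \<Omega>" "\<Omega> \<noteq> UNIV" and \<phi>: "smooth \<phi>" and m: "0 < m" and r: "0 < r"
    and x: "x \<in> \<Omega>" and rx: "20 * real m * r \<le> min 1 (bdist \<Omega> x)"
    and g: "g \<in> borel_measurable borel"
    and le: "AE y in lebesgue_on \<Omega>. deriv_abs_sum m \<phi> y \<le> g y"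
  shows "emeasure lborel (ball (0::real^'n) r) * ennreal \<bar>\<phi> x\<bar> \<le>
    (\<Sum>k\<in>{1..m}. ennreal (real (m choose k)) * (\<integral>\<^sup>+ y. ennreal \<bar>\<phi> y\<bar> * indicator (ball x (real k * r)) y \<partial>lborel)) +
    ennreal (2 ^ m * real m ^ (m - 1)) * (2 * emeasure lborel (ball (0::real^'n) r) *
      (\<Sum>k. ennreal (2 powr of_int (int_decode k) * capped_dist (avg_level_seq \<Omega> g k) x ^ m)))"
proof -
  define V where "V = emeasure lborel (ball (0::real^'n) r)"
  define A where "A = deriv_abs_sum m \<phi>"
  define K where "K = 2 ^ m * real m ^ (m - 1)"
  have K0: "0 \<le> K" by (simp add: K_def)
  define a where "a k = 2 powr real_of_int (int_decode k)" for k
  define \<delta> where "\<delta> k = capped_dist (avg_level_seq \<Omega> g k) x" for k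
  have a0: "0 \<le> a k" and \<delta>0: "0 \<le> \<delta> k" for k by (simp_all add: a_def \<delta>_def capped_dist_nonneg)
  have [measurable]: "A \<in> borel_measurable borel" unfolding A_def by (rule deriv_abs_sum_measurable[OF \<phi>])
  have [measurable]: "\<phi> \<in> borel_measurable borel" by (rule smooth_borel_measurable[OF \<phi>])
  have [measurable]: "g \<in> borel_measurable borel" by (rule g)
  have [measurable]: "ball y t \<in> sets borel" for y :: "real^'n" and t by simp
  define L where "L t = (\<Sum>k. ennreal (a k) * indicator {t. t \<le> \<delta> k} t)" for t
  define J where "J h = (\<integral>\<^sup>+ \<tau>. ennreal (\<tau> ^ (m - 1)) * ennreal (A (x + \<tau> *\<^sub>R h)) * indicator {0..real m} \<tau> \<partial>lborel)" for h
  have [measurable]: "J \<in> borel_measurable borel" unfolding J_def by measurable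
  have "V * ennreal \<bar>\<phi> x\<bar> = (\<integral>\<^sup>+ h. ennreal \<bar>\<phi> x\<bar> * indicator (ball (0::real^'n) r) h \<partial>lborel)"
    by (subst nn_integral_cmult_indicator) (auto simp: V_def mult.commute)
  also have "\<dots> \<le> (\<integral>\<^sup>+ h. (\<Sum>k\<in>{1..m}. ennreal (real (m choose k)) * (ennreal \<bar>\<phi> (x + real k *\<^sub>R h)\<bar> * indicator (ball 0 r) h)) +
      ennreal (K * r ^ m) * (J h * indicator (ball 0 r) h) \<partial>lborel)"
  proof (intro nn_integral_mono)
    fix h :: "real ^ 'n"
    show "ennreal \<bar>\<phi> x\<bar> * indicator (ball 0 r) h \<le> (\<Sum>k\<in>{1..m}. ennreal (real (m choose k)) * (ennreal \<bar>\<phi> (x + real k *\<^sub>R h)\<bar> * indicator (ball 0 r) h)) +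
      ennreal (K * r ^ m) * (J h * indicator (ball 0 r) h)"
    proof (cases "h \<in> ball 0 r")
      case True
      then have "norm h \<le> r" by simp
      from ray_bound[OF \<phi> m this, of x] True show ?thesis
        by (simp add: J_def A_def K_def)
    qed simp
  qed
  also have "\<dots> = (\<Sum>k\<in>{1..m}. ennreal (real (m choose k)) * (\<integral>\<^sup>+ h. ennreal \<bar>\<phi> (x + real k *\<^sub>R h)\<bar> * indicator (ball 0 r) h \<partial>lborel)) +
      ennreal (K * r ^ m) * (\<integral>\<^sup>+ h. J h * indicator (ball 0 r) h \<partial>lborel)"
    by (simp add: nn_integral_add nn_integral_sum nn_integral_cmult)
  also have "\<dots> \<le> (\<Sum>k\<in>{1..m}. ennreal (real (m choose k)) * (\<integral>\<^sup>+ y. ennreal \<bar>\<phi> y\<bar> * indicator (ball x (real k * r)) y \<partial>lborel)) +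
      ennreal (K * r ^ m) * (2 * V * (\<Sum>k. ennreal (a k * (\<delta> k / r) ^ m)))"
  proof (intro add_mono sum_mono mult_left_mono)
    fix k assume k: "k \<in> {1..m}"
    \<comment> \<open>Since \<open>k \<ge> 1\<close>, the Jacobian \<open>k ^ CARD('n)\<close> is at
      least 1 and may be inserted.\<close>
    have "1 * (\<integral>\<^sup>+ h. ennreal \<bar>\<phi> (x + real k *\<^sub>R h)\<bar> * indicator (ball 0 r) h \<partial>lborel) \<le>
      ennreal (real k ^ DIM(real^'n)) * (\<integral>\<^sup>+ h. ennreal \<bar>\<phi> (x + real k *\<^sub>R h)\<bar> * indicator (ball 0 r) h \<partial>lborel)"
      using k by (intro mult_right_mono) (auto simp del: ennreal_1 simp flip: ennreal_1 intro!: ennreal_leI one_le_power)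
    also have "\<dots> = (\<integral>\<^sup>+ y. ennreal \<bar>\<phi> y\<bar> * indicator (ball x (real k * r)) y \<partial>lborel)"
      using k by (intro nn_integral_ball_scale[where F="\<lambda>y. ennreal \<bar>\<phi> y\<bar>", symmetric]) auto
    finally show "(\<integral>\<^sup>+ h. ennreal \<bar>\<phi> (x + real k *\<^sub>R h)\<bar> * indicator (ball 0 r) h \<partial>lborel) \<le>
        (\<integral>\<^sup>+ y. ennreal \<bar>\<phi> y\<bar> * indicator (ball x (real k * r)) y \<partial>lborel)" by simp
  next
    have inner: "(\<integral>\<^sup>+ h. ennreal (A (x + \<tau> *\<^sub>R h)) * indicator (ball 0 r) h \<partial>lborel) \<le> 2 * V * L (\<tau> * r)"
      if \<tau>: "0 < \<tau>" "\<tau> \<le> real m" for \<tau>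
    proof -
      have "20 * (\<tau> * r) \<le> 20 * real m * r" using \<tau> r by simp
      then have t: "0 < \<tau> * r" "20 * (\<tau> * r) \<le> min 1 (bdist \<Omega> x)"
        using \<tau> r order_trans[OF _ rx] by simp_all
      have sub: "ball x (\<tau> * r) \<subseteq> \<Omega>"
      proof -
        have "20 * (\<tau> * r) \<le> bdist \<Omega> x" using t(2) by simp
        then have "\<tau> * r \<le> bdist \<Omega> x" using t(1) by linarith
        then show ?thesis using ball_bdist_subset[OF \<Omega>(1) x] subset_ball by blast
      qed
      have "ennreal (\<tau> ^ CARD('n)) * (\<integral>\<^sup>+ h. ennreal (A (x + \<tau> *\<^sub>R h)) * indicator (ball 0 r) h \<partial>lborel) =
         (\<integral>\<^sup>+ y. ennreal (A y) * indicator (ball x (\<tau> * r)) y \<partial>lborel)"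
        using \<tau> by (subst nn_integral_ball_scale[where F="\<lambda>y. ennreal (A y)"]) auto
      also have "\<dots> \<le> (\<integral>\<^sup>+ y. ennreal (g y) * indicator (ball x (\<tau> * r)) y \<partial>lborel)"
      proof -
        have "AE y in lebesgue. y \<in> \<Omega> \<longrightarrow> A y \<le> g y"
          using le \<Omega>(1) by (subst (asm) AE_restrict_space_iff) (auto simp: A_def)
        then have "AE y in lborel. y \<in> \<Omega> \<longrightarrow> A y \<le> g y"
          by (simp add: AE_completion_iff)
        then show ?thesis
        proof (intro nn_integral_mono_AE, eventually_elim)
          case (elim y)
          then show ?case using sub by (cases "y \<in> ball x (\<tau> * r)") (auto intro!: ennreal_leI simp: subset_iff)
        qed
      qed
      also have "\<dots> \<le> 2 * emeasure lborel (ball x (\<tau> * r)) * L (\<tau> * r)"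
        unfolding L_def a_def \<delta>_def by (rule integral_ball_le_levels[OF \<Omega> x t])
      also have "\<dots> = ennreal (\<tau> ^ CARD('n)) * (2 * V * L (\<tau> * r))"
        using \<tau> by (subst emeasure_ball_scale) (auto simp: V_def ac_simps)
      finally show ?thesis
        using \<tau> by (subst (asm) ennreal_mult_le_mult_iff) auto
    qed
    have "(\<integral>\<^sup>+ h. J h * indicator (ball 0 r) h \<partial>lborel) =
      (\<integral>\<^sup>+ h. (\<integral>\<^sup>+ \<tau>. ennreal (\<tau> ^ (m - 1)) * indicator {0..real m} \<tau> * (ennreal (A (x + \<tau> *\<^sub>R h)) * indicator (ball 0 r) h) \<partial>lborel) \<partial>lborel)"
      unfolding J_def by (subst nn_integral_multc[symmetric]) (auto simp: ac_simps)
    also have "\<dots> = (\<integral>\<^sup>+ \<tau>. (\<integral>\<^sup>+ h. ennreal (\<tau> ^ (m - 1)) * indicator {0..real m} \<tau> * (ennreal (A (x + \<tau> *\<^sub>R h)) * indicator (ball 0 r) h) \<partial>lborel) \<partial>lborel)"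
      by (rule lborel_pair.Fubini') measurable
    also have "\<dots> = (\<integral>\<^sup>+ \<tau>. ennreal (\<tau> ^ (m - 1)) * indicator {0..real m} \<tau> * (\<integral>\<^sup>+ h. ennreal (A (x + \<tau> *\<^sub>R h)) * indicator (ball 0 r) h \<partial>lborel) \<partial>lborel)"
      by (subst nn_integral_cmult) auto
    also have "\<dots> \<le> (\<integral>\<^sup>+ \<tau>. 2 * V * (\<Sum>k. ennreal (a k) * (ennreal (\<tau> ^ (m - 1)) * indicator {0..real m} \<tau> * indicator {\<tau>. \<tau> \<le> \<delta> k / r} \<tau>)) \<partial>lborel)"
    \<comment> \<open>The null set \<open>\<tau> = 0\<close> is set aside because the rescaling of
      balls needs a positive factor.\<close>
    proof (intro nn_integral_mono_AE, use AE_lborel_singleton[of 0] in eventually_elim)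
      fix \<tau> :: real assume "\<tau> \<noteq> 0"
      show "ennreal (\<tau> ^ (m - 1)) * indicator {0..real m} \<tau> * (\<integral>\<^sup>+ h. ennreal (A (x + \<tau> *\<^sub>R h)) * indicator (ball 0 r) h \<partial>lborel)
        \<le> 2 * V * (\<Sum>k. ennreal (a k) * (ennreal (\<tau> ^ (m - 1)) * indicator {0..real m} \<tau> * indicator {\<tau>. \<tau> \<le> \<delta> k / r} \<tau>))"
      proof (cases "\<tau> \<in> {0..real m}")
        case True
        have "L (\<tau> * r) = (\<Sum>k. ennreal (a k) * indicator {\<tau>. \<tau> \<le> \<delta> k / r} \<tau>)"
          unfolding L_def using r by (intro suminf_cong) (simp add: indicator_def field_simps)
        then have "ennreal (\<tau> ^ (m - 1)) * (2 * V * L (\<tau> * r)) =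
           2 * V * (\<Sum>k. ennreal (\<tau> ^ (m - 1)) * (ennreal (a k) * indicator {\<tau>. \<tau> \<le> \<delta> k / r} \<tau>))"
          by (simp only: ennreal_suminf_cmult) (simp only: mult.left_commute)
        moreover have "ennreal (\<tau> ^ (m - 1)) * (\<integral>\<^sup>+ h. ennreal (A (x + \<tau> *\<^sub>R h)) * indicator (ball 0 r) h \<partial>lborel) \<le> ennreal (\<tau> ^ (m - 1)) * (2 * V * L (\<tau> * r))"
          using inner[of \<tau>] True \<open>\<tau> \<noteq> 0\<close> by (intro mult_left_mono) auto
        ultimately show ?thesis using True by (simp add: mult.left_commute)
      qed simp
    qed
    also have "\<dots> = 2 * V * (\<integral>\<^sup>+ \<tau>. (\<Sum>k. ennreal (a k) * (ennreal (\<tau> ^ (m - 1)) * indicator {0..real m} \<tau> * indicator {\<tau>. \<tau> \<le> \<delta> k / r} \<tau>)) \<partial>lborel)"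
      by (rule nn_integral_cmult) measurable
    also have "\<dots> = 2 * V * (\<Sum>k. \<integral>\<^sup>+ \<tau>. ennreal (a k) * (ennreal (\<tau> ^ (m - 1)) * indicator {0..real m} \<tau> * indicator {\<tau>. \<tau> \<le> \<delta> k / r} \<tau>) \<partial>lborel)"
      by (subst nn_integral_suminf) auto
    also have "\<dots> \<le> 2 * V * (\<Sum>k. ennreal (a k * (\<delta> k / r) ^ m))"
    proof (intro mult_left_mono suminf_le)
      fix k
      have "(\<integral>\<^sup>+ \<tau>. ennreal (a k) * (ennreal (\<tau> ^ (m - 1)) * indicator {0..real m} \<tau> * indicator {\<tau>. \<tau> \<le> \<delta> k / r} \<tau>) \<partial>lborel)
         = ennreal (a k) * (\<integral>\<^sup>+ \<tau>. ennreal (\<tau> ^ (m - 1)) * indicator {0..real m} \<tau> * indicator {\<tau>. \<tau> \<le> \<delta> k / r} \<tau> \<partial>lborel)"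
        by (rule nn_integral_cmult) measurable
      also have "\<dots> \<le> ennreal (a k) * ennreal ((\<delta> k / r) ^ m)"
        using \<delta>0[of k] r m by (intro mult_left_mono nn_integral_power_level_le) auto
      finally show "(\<integral>\<^sup>+ \<tau>. ennreal (a k) * (ennreal (\<tau> ^ (m - 1)) * indicator {0..real m} \<tau> * indicator {\<tau>. \<tau> \<le> \<delta> k / r} \<tau>) \<partial>lborel)
         \<le> ennreal (a k * (\<delta> k / r) ^ m)"
        using a0 by (simp add: ennreal_mult')
    qed auto
    finally show "(\<integral>\<^sup>+ h. J h * indicator (ball 0 r) h \<partial>lborel) \<le> 2 * V * (\<Sum>k. ennreal (a k * (\<delta> k / r) ^ m))" .
  qed auto
  also have "ennreal (K * r ^ m) * (2 * V * (\<Sum>k. ennreal (a k * (\<delta> k / r) ^ m))) = ennreal K * (2 * V * (\<Sum>k. ennreal (a k * \<delta> k ^ m)))"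
  proof -
    have "ennreal (r ^ m) * (\<Sum>k. ennreal (a k * (\<delta> k / r) ^ m)) = (\<Sum>k. ennreal (r ^ m) * ennreal (a k * (\<delta> k / r) ^ m))"
      by (rule ennreal_suminf_cmult[symmetric])
    also have "\<dots> = (\<Sum>k. ennreal (a k * \<delta> k ^ m))"
      using r by (intro suminf_cong) (simp add: ennreal_mult'[symmetric] power_divide)
    finally show ?thesis using K0 r by (simp add: ennreal_mult' ac_simps)
  qed
  finally show ?thesis unfolding V_def K_def a_def \<delta>_def .
qed

section \<open>The decomposition\<close>

lemma has_weak_deriv_Nil_AE_eq:
  assumes "open \<Omega>" "has_weak_deriv \<Omega> [] u w"
  shows "AE x in lebesgue_on \<Omega>. w x = u x"
proof -
  have "has_weak_deriv \<Omega> [] u u" using assms(2) by (simp add: has_weak_deriv_def)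
  then show ?thesis using has_weak_deriv_unique[OF assms(1) assms(2)] by blast
qed

text \<open>It takes the place of Hoelder's inequality: either \<open>\<bar>t\<bar>\<close> is below
  the threshold \<open>\<eta>\<close>, or the factor \<open>\<bar>t\<bar> powr (1 - p)\<close> is at
  most \<open>\<eta> powr (1 - p)\<close>. With \<open>\<eta>\<close> small it turns convergence in
  the \<open>p\<close>-th mean into local convergence in the mean.\<close>

lemma abs_le_add_powr:
  fixes t \<eta> p :: real
  assumes "0 < \<eta>" "1 \<le> p"
  shows "\<bar>t\<bar> \<le> \<eta> + \<eta> powr (1 - p) * \<bar>t\<bar> powr p"
proof (cases "\<bar>t\<bar> \<le> \<eta>")
  case True
  have "0 \<le> \<eta> powr (1 - p) * \<bar>t\<bar> powr p" by simp
  then show ?thesis using True by linarith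
next
  case False
  then have "\<bar>t\<bar> = \<bar>t\<bar> powr (1 - p) * \<bar>t\<bar> powr p" using assms by (simp flip: powr_add)
  also have "\<dots> \<le> \<eta> powr (1 - p) * \<bar>t\<bar> powr p"
    using False assms by (intro mult_right_mono powr_mono2') auto
  finally show ?thesis using assms by linarith
qed

lemma local_L1_tendsto_0:
  fixes f :: "nat \<Rightarrow> real ^ 'n::finite \<Rightarrow> real"
  assumes \<Omega>: "open \<Omega>" "\<Omega> \<noteq> UNIV" and p: "1 \<le> p"
    and f: "\<And>j. f j \<in> borel_measurable borel" and R: "cball x R \<subseteq> \<Omega>"
    and lim: "(\<lambda>j. weighted_nn_integral \<Omega> p s (f j)) \<longlonglongrightarrow> 0"
  shows "(\<lambda>j. \<integral>\<^sup>+ y. ennreal \<bar>f j y\<bar> * indicator (ball x R) y \<partial>lborel) \<longlonglongrightarrow> 0"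
proof -
  have [measurable]: "f j \<in> borel_measurable borel" for j by (rule f)
  have [measurable]: "bdist \<Omega> \<in> borel_measurable borel" by (rule bdist_measurable)
  have [measurable]: "\<Omega> \<in> sets borel" using \<Omega> by auto
  have [measurable]: "ball x R \<in> sets borel" by simp
  have "\<exists>c>0. \<forall>y\<in>cball x R. c \<le> bdist \<Omega> y powr s"
  proof (cases "cball x R = {}")
    case False
    then obtain y where "y \<in> cball x R" "\<forall>z\<in>cball x R. bdist \<Omega> y powr s \<le> bdist \<Omega> z powr s"
      using continuous_attains_inf[OF compact_cball False continuous_on_bdist_powr[OF \<Omega> R]] by blast
    then show ?thesis using bdist_pos[OF \<Omega>, of y] R by (intro exI[of _ "bdist \<Omega> y powr s"]) auto
  qed (auto intro: exI[of _ 1])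
  then obtain c where c: "c > 0" "\<And>y. y \<in> cball x R \<Longrightarrow> c \<le> bdist \<Omega> y powr s" by blast
  define V where "V = measure lborel (ball x R)"
  have V: "emeasure lborel (ball x R) = ennreal V"
    unfolding V_def using emeasure_lborel_ball_finite[of x R] by (intro emeasure_eq_ennreal_measure) auto
  have V0: "0 \<le> V" by (simp add: V_def)
  have est: "(\<integral>\<^sup>+ y. ennreal \<bar>f j y\<bar> * indicator (ball x R) y \<partial>lborel) \<le>
     ennreal (\<eta> * V) + ennreal (\<eta> powr (1 - p) / c) * weighted_nn_integral \<Omega> p s (f j)" if \<eta>: "0 < \<eta>" for \<eta> j
  proof -
    have "(\<integral>\<^sup>+ y. ennreal \<bar>f j y\<bar> * indicator (ball x R) y \<partial>lborel) \<le>
      (\<integral>\<^sup>+ y. ennreal \<eta> * indicator (ball x R) y + ennreal (\<eta> powr (1 - p) / c) * (ennreal (\<bar>f j y\<bar> powr p * bdist \<Omega> y powr s) * indicator \<Omega> y) \<partial>lborel)"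
    proof (intro nn_integral_mono)
      fix y
      show "ennreal \<bar>f j y\<bar> * indicator (ball x R) y \<le>
        ennreal \<eta> * indicator (ball x R) y + ennreal (\<eta> powr (1 - p) / c) * (ennreal (\<bar>f j y\<bar> powr p * bdist \<Omega> y powr s) * indicator \<Omega> y)"
      proof (cases "y \<in> ball x R")
        case True
        then have y: "y \<in> \<Omega>" "c \<le> bdist \<Omega> y powr s" using R c(2) by (auto simp: subset_iff)
        have "\<bar>f j y\<bar> \<le> \<eta> + \<eta> powr (1 - p) * \<bar>f j y\<bar> powr p" by (rule abs_le_add_powr[OF \<eta> p])
        also have "\<eta> powr (1 - p) * \<bar>f j y\<bar> powr p \<le> \<eta> powr (1 - p) / c * (\<bar>f j y\<bar> powr p * bdist \<Omega> y powr s)"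
          using mult_left_mono[OF y(2), of "\<eta> powr (1 - p) * \<bar>f j y\<bar> powr p"] c(1) by (simp add: field_simps)
        finally have "ennreal \<bar>f j y\<bar> \<le> ennreal (\<eta> + \<eta> powr (1 - p) / c * (\<bar>f j y\<bar> powr p * bdist \<Omega> y powr s))"
          by (intro ennreal_leI) simp
        also have "\<dots> = ennreal \<eta> + ennreal (\<eta> powr (1 - p) / c) * ennreal (\<bar>f j y\<bar> powr p * bdist \<Omega> y powr s)"
          using \<eta> c(1) by (simp add: ennreal_plus ennreal_mult del: times_divide_eq_left)
        finally show ?thesis using True y by simp
      qed simp
    qed
    also have "\<dots> = ennreal \<eta> * ennreal V + ennreal (\<eta> powr (1 - p) / c) * (\<integral>\<^sup>+ y. ennreal (\<bar>f j y\<bar> powr p * bdist \<Omega> y powr s) * indicator \<Omega> y \<partial>lborel)"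
      by (simp add: nn_integral_add nn_integral_cmult nn_integral_cmult_indicator V)
    also have "(\<integral>\<^sup>+ y. ennreal (\<bar>f j y\<bar> powr p * bdist \<Omega> y powr s) * indicator \<Omega> y \<partial>lborel) = weighted_nn_integral \<Omega> p s (f j)"
      unfolding weighted_nn_integral_def by (intro nn_integral_lebesgue_on_eq_lborel[symmetric] \<Omega>) measurable
    finally show ?thesis using \<eta> by (simp add: ennreal_mult')
  qed
  show ?thesis
  proof (rule tendsto_zero_ennreal)
    fix \<epsilon> :: real assume \<epsilon>: "0 < \<epsilon>"
    \<comment> \<open>Makes the threshold part at most \<open>\<epsilon> / 2\<close>;
      \<open>V + 1\<close> avoids a division by 0 when the ball is empty.\<close>
    define \<eta> where "\<eta> = \<epsilon> / (2 * (V + 1))"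
    have \<eta>: "0 < \<eta>" using \<epsilon> V0 by (simp add: \<eta>_def)
    have "\<eta> * V \<le> \<epsilon> / 2" using \<epsilon> V0 by (simp add: \<eta>_def field_simps)
    have "(\<lambda>j. ennreal (\<eta> powr (1 - p) / c) * weighted_nn_integral \<Omega> p s (f j)) \<longlonglongrightarrow> ennreal (\<eta> powr (1 - p) / c) * 0"
      by (intro ennreal_tendsto_cmult lim) simp
    then have "\<forall>\<^sub>F j in sequentially. ennreal (\<eta> powr (1 - p) / c) * weighted_nn_integral \<Omega> p s (f j) < ennreal (\<epsilon> / 2)"
      using \<epsilon> by (intro order_tendstoD(2)) auto
    then show "\<forall>\<^sub>F j in sequentially. (\<integral>\<^sup>+ y. ennreal \<bar>f j y\<bar> * indicator (ball x R) y \<partial>lborel) < ennreal \<epsilon>"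
    proof eventually_elim
      case (elim j)
      have "(\<integral>\<^sup>+ y. ennreal \<bar>f j y\<bar> * indicator (ball x R) y \<partial>lborel) \<le>
         ennreal (\<eta> * V) + ennreal (\<eta> powr (1 - p) / c) * weighted_nn_integral \<Omega> p s (f j)" by (rule est[OF \<eta>])
      also have "\<dots> \<le> ennreal (\<epsilon> / 2) + ennreal (\<eta> powr (1 - p) / c) * weighted_nn_integral \<Omega> p s (f j)"
        using \<open>\<eta> * V \<le> \<epsilon> / 2\<close> by (intro add_right_mono ennreal_leI)
      also have "\<dots> < ennreal (\<epsilon> / 2) + ennreal (\<epsilon> / 2)"
        using elim by (subst ennreal_add_left_cancel_less) simp
      also have "\<dots> = ennreal \<epsilon>" using \<epsilon> by (simp flip: ennreal_plus)
      finally show ?case .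
    qed
  qed
qed

text \<open>\<open>averaged_bound\<close> is used for \<open>\<phi> j\<close> and \<open>j\<close>
  tends to infinity. What remains besides the level sum are averages of
  \<open>\<bar>U\<bar> \<le> (2 * \<rho>) ^ m * g\<close> over balls of radius comparable to
  \<open>\<rho>\<close>; a level that contributes to them has distance at least a multiple of
  \<open>\<rho>\<close>, so \<open>\<rho> ^ m\<close> is absorbed by \<open>\<delta> ^ m\<close> and
  they too are bounded by the level sum.\<close>

lemma abs_le_level_sum:
  fixes \<Omega> :: "(real ^ 'n::finite) set"
  assumes \<Omega>: "open \<Omega>" "\<Omega> \<noteq> UNIV" and \<phi>: "\<And>j. smooth (\<phi> j)" and m: "0 < m" and x: "x \<in> \<Omega>"
    and g: "g \<in> borel_measurable borel" and g0: "\<And>y. 0 \<le> g y"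
    and le: "\<And>j. AE y in lebesgue_on \<Omega>. deriv_abs_sum m (\<phi> j) y \<le> g y"
    and U: "U \<in> borel_measurable borel"
    and Ug: "AE y in lebesgue_on \<Omega>. \<bar>U y\<bar> \<le> min 1 (bdist \<Omega> y) ^ m * g y"
    and lim: "(\<lambda>j. \<phi> j x) \<longlonglongrightarrow> U x"
    and L1: "\<And>R. cball x R \<subseteq> \<Omega> \<Longrightarrow> (\<lambda>j. \<integral>\<^sup>+ y. ennreal \<bar>\<phi> j y - U y\<bar> * indicator (ball x R) y \<partial>lborel) \<longlonglongrightarrow> 0"
  shows "ennreal \<bar>U x\<bar> \<le> ennreal (2 ^ m * (2 * real m ^ CARD('n) * (40 * real m) ^ m) + 2 * (2 ^ m * real m ^ (m - 1))) * level_sum \<Omega> g m x"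
proof -
  define \<rho> where "\<rho> = min 1 (bdist \<Omega> x)"
  have \<rho>: "0 < \<rho>" using bdist_pos[OF \<Omega> x] by (simp add: \<rho>_def)
  \<comment> \<open>The largest radius for which all sample balls, of radius up to
    \<open>m * r\<close>, satisfy the restriction in \<open>avg_level\<close>.\<close>
  define r where "r = \<rho> / (20 * real m)"
  have r: "0 < r" using \<rho> m by (simp add: r_def)
  have rm: "20 * real m * r = \<rho>" using m by (simp add: r_def)
  define K where "K = 2 ^ m * real m ^ (m - 1)"
  define V where "V = measure lborel (ball (0::real^'n) r)"
  have V: "emeasure lborel (ball (0::real^'n) r) = ennreal V"
    unfolding V_def using emeasure_lborel_ball_finite[of "0::real^'n" r] by (intro emeasure_eq_ennreal_measure) auto
  have V0: "0 < V" unfolding V_def using r by (simp add: content_ball_pos)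
  define S where "S = level_sum \<Omega> g m x"
  have [measurable]: "\<phi> j \<in> borel_measurable borel" for j by (rule smooth_borel_measurable[OF \<phi>])
  have [measurable]: "U \<in> borel_measurable borel" by (rule U)
  have [measurable]: "g \<in> borel_measurable borel" by (rule g)
  have [measurable]: "ball y t \<in> sets borel" for y :: "real^'n" and t by simp
  define Y where "Y k = (\<integral>\<^sup>+ y. ennreal \<bar>U y\<bar> * indicator (ball x (real k * r)) y \<partial>lborel)" for k
  define Z where "Z j k = (\<integral>\<^sup>+ y. ennreal \<bar>\<phi> j y - U y\<bar> * indicator (ball x (real k * r)) y \<partial>lborel)" for j k
  have kr: "0 < real k * r" "20 * (real k * r) \<le> \<rho>" if "k \<in> {1..m}" for k
  proof -
    show "0 < real k * r" using that r by simp
    have "real k * r \<le> real m * r" using that r by (intro mult_right_mono) auto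
    then show "20 * (real k * r) \<le> \<rho>" using rm by simp
  qed
  have sub: "cball x (real k * r) \<subseteq> \<Omega>" if "k \<in> {1..m}" for k
  proof -
    have "real k * r < bdist \<Omega> x" using kr[OF that] by (auto simp: \<rho>_def)
    then have "cball x (real k * r) \<subseteq> ball x (bdist \<Omega> x)" by auto
    then show ?thesis using ball_bdist_subset[OF \<Omega>(1) x] by blast
  qed
  have fd: "ennreal V * ennreal \<bar>\<phi> j x\<bar> \<le> (\<Sum>k\<in>{1..m}. ennreal (real (m choose k)) * (Z j k + Y k)) + ennreal K * (2 * ennreal V * S)" for j
  proof -
    have "ennreal V * ennreal \<bar>\<phi> j x\<bar> \<le> (\<Sum>k\<in>{1..m}. ennreal (real (m choose k)) * (\<integral>\<^sup>+ y. ennreal \<bar>\<phi> j y\<bar> * indicator (ball x (real k * r)) y \<partial>lborel)) + ennreal K * (2 * ennreal V * S)"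
      using averaged_bound[OF \<Omega> \<phi> m r x _ g le, of j] rm unfolding V S_def level_sum_def K_def \<rho>_def by simp
    also have "\<dots> \<le> (\<Sum>k\<in>{1..m}. ennreal (real (m choose k)) * (Z j k + Y k)) + ennreal K * (2 * ennreal V * S)"
    proof (intro add_right_mono sum_mono mult_left_mono)
      fix k
      have "(\<integral>\<^sup>+ y. ennreal \<bar>\<phi> j y\<bar> * indicator (ball x (real k * r)) y \<partial>lborel) \<le>
         (\<integral>\<^sup>+ y. ennreal \<bar>\<phi> j y - U y\<bar> * indicator (ball x (real k * r)) y + ennreal \<bar>U y\<bar> * indicator (ball x (real k * r)) y \<partial>lborel)"
        by (intro nn_integral_mono) (auto simp: indicator_def simp flip: ennreal_plus intro!: ennreal_leI)
      then show "(\<integral>\<^sup>+ y. ennreal \<bar>\<phi> j y\<bar> * indicator (ball x (real k * r)) y \<partial>lborel) \<le> Z j k + Y k"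
        unfolding Z_def Y_def by (subst (asm) nn_integral_add) auto
    qed auto
    finally show ?thesis .
  qed
  \<comment> \<open>On the left the sequence converges at the point \<open>x\<close>, on the right
    the sample terms converge in the mean; the level sum is independent of \<open>j\<close> because
    \<open>g\<close> is.\<close>
  have "ennreal V * ennreal \<bar>U x\<bar> \<le> (\<Sum>k\<in>{1..m}. ennreal (real (m choose k)) * (0 + Y k)) + ennreal K * (2 * ennreal V * S)"
  proof (rule LIMSEQ_le)
    show "(\<lambda>j. ennreal V * ennreal \<bar>\<phi> j x\<bar>) \<longlonglongrightarrow> ennreal V * ennreal \<bar>U x\<bar>"
      by (intro ennreal_tendsto_cmult tendsto_ennrealI tendsto_rabs lim) simp
    show "(\<lambda>j. (\<Sum>k\<in>{1..m}. ennreal (real (m choose k)) * (Z j k + Y k)) + ennreal K * (2 * ennreal V * S)) \<longlonglongrightarrow>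
       (\<Sum>k\<in>{1..m}. ennreal (real (m choose k)) * (0 + Y k)) + ennreal K * (2 * ennreal V * S)"
    proof (intro tendsto_add tendsto_const tendsto_sum ennreal_tendsto_cmult)
      show "(\<lambda>j. Z j k) \<longlonglongrightarrow> 0" if "k \<in> {1..m}" for k unfolding Z_def by (rule L1[OF sub[OF that]])
    qed simp
  qed (use fd in blast)
  also have "\<dots> \<le> (\<Sum>k\<in>{1..m}. ennreal (real (m choose k)) * (ennreal (2 * real m ^ CARD('n) * (40 * real m) ^ m) * (ennreal V * S))) + ennreal K * (2 * ennreal V * S)"
  proof (intro add_right_mono sum_mono mult_left_mono)
    fix k assume k: "k \<in> {1..m}"
    have "Y k \<le> (\<integral>\<^sup>+ y. ennreal ((2 * \<rho>) ^ m) * (ennreal (g y) * indicator (ball x (real k * r)) y) \<partial>lborel)"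
      unfolding Y_def
    proof (intro nn_integral_mono_AE)
      have "AE y in lebesgue. y \<in> \<Omega> \<longrightarrow> \<bar>U y\<bar> \<le> min 1 (bdist \<Omega> y) ^ m * g y"
        using Ug \<Omega>(1) by (subst (asm) AE_restrict_space_iff) auto
      then have "AE y in lborel. y \<in> \<Omega> \<longrightarrow> \<bar>U y\<bar> \<le> min 1 (bdist \<Omega> y) ^ m * g y"
        by (simp add: AE_completion_iff)
      then show "AE y in lborel. ennreal \<bar>U y\<bar> * indicator (ball x (real k * r)) y \<le> ennreal ((2 * \<rho>) ^ m) * (ennreal (g y) * indicator (ball x (real k * r)) y)"
      proof eventually_elim
        case (elim y)
        show ?case
        proof (cases "y \<in> ball x (real k * r)")
          case True
          then have d: "dist x y < real k * r" by simp
          have y: "y \<in> \<Omega>" using sub[OF k] True by auto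
          \<comment> \<open>The sample ball has radius at most \<open>\<rho> / 20\<close>, so the
            distance to the boundary hardly changes on it.\<close>
          have "min 1 (bdist \<Omega> y) \<le> 2 * \<rho>"
            using bdist_lipschitz[of \<Omega> x y] d kr[OF k] \<rho> unfolding \<rho>_def by linarith
          moreover have "0 \<le> min 1 (bdist \<Omega> y)" using bdist_pos[OF \<Omega> y] by simp
          ultimately have "min 1 (bdist \<Omega> y) ^ m * g y \<le> (2 * \<rho>) ^ m * g y"
            using g0 by (intro mult_right_mono power_mono) auto
          then have "\<bar>U y\<bar> \<le> (2 * \<rho>) ^ m * g y" using elim y by linarith
          then show ?thesis using True \<rho> by (simp add: ennreal_leI flip: ennreal_mult')
        qed simp
      qed
    qed
    also have "\<dots> = ennreal ((2 * \<rho>) ^ m) * (\<integral>\<^sup>+ y. ennreal (g y) * indicator (ball x (real k * r)) y \<partial>lborel)"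
      by (rule nn_integral_cmult) measurable
    also have "\<dots> \<le> ennreal ((2 * \<rho>) ^ m) * (2 * emeasure lborel (ball x (real k * r)) *
       (\<Sum>i. ennreal (2 powr of_int (int_decode i)) * indicator {t. t \<le> capped_dist (avg_level_seq \<Omega> g i) x} (real k * r)))"
      using kr[OF k] unfolding \<rho>_def by (intro mult_left_mono integral_ball_le_levels[OF \<Omega> x]) auto
    also have "emeasure lborel (ball x (real k * r)) = ennreal (real k ^ CARD('n)) * ennreal V"
      using k by (subst emeasure_ball_scale) (auto simp: V)
    also have "ennreal ((2 * \<rho>) ^ m) * (2 * (ennreal (real k ^ CARD('n)) * ennreal V) *
       (\<Sum>i. ennreal (2 powr of_int (int_decode i)) * indicator {t. t \<le> capped_dist (avg_level_seq \<Omega> g i) x} (real k * r)))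
      = 2 * ennreal (real k ^ CARD('n)) * ennreal V *
       (\<Sum>i. ennreal ((2 * \<rho>) ^ m) * (ennreal (2 powr of_int (int_decode i)) * indicator {t. t \<le> capped_dist (avg_level_seq \<Omega> g i) x} (real k * r)))"
      by (simp only: ennreal_suminf_cmult) (simp only: ac_simps)
    also have "\<dots> \<le> 2 * ennreal (real m ^ CARD('n)) * ennreal V * (ennreal ((40 * real m) ^ m) * S)"
    proof (intro mult_mono)
      show "ennreal (real k ^ CARD('n)) \<le> ennreal (real m ^ CARD('n))" using k by (intro ennreal_leI power_mono) auto
      show "(\<Sum>i. ennreal ((2 * \<rho>) ^ m) * (ennreal (2 powr of_int (int_decode i)) * indicator {t. t \<le> capped_dist (avg_level_seq \<Omega> g i) x} (real k * r))) \<le> ennreal ((40 * real m) ^ m) * S"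
        unfolding S_def level_sum_def ennreal_suminf_cmult[symmetric]
      proof (intro suminf_le)
        fix i
        let ?\<delta> = "capped_dist (avg_level_seq \<Omega> g i) x"
        show "ennreal ((2 * \<rho>) ^ m) * (ennreal (2 powr of_int (int_decode i)) * indicator {t. t \<le> ?\<delta>} (real k * r)) \<le>
          ennreal ((40 * real m) ^ m) * ennreal (2 powr of_int (int_decode i) * ?\<delta> ^ m)"
        proof (cases "real k * r \<le> ?\<delta>")
          case True
          \<comment> \<open>A contributing level has distance at least
            \<open>k * r \<ge> r = \<rho> / (20 * m)\<close>, so \<open>2 * \<rho>\<close> is at
            most \<open>40 * m\<close> times this distance; this is the origin of the constant
            40.\<close>
          have "1 * r \<le> real k * r" using k r by (intro mult_right_mono) auto
          then have "r \<le> ?\<delta>" using True by linarith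
          then have "r ^ m \<le> ?\<delta> ^ m" using r by (intro power_mono) auto
          then have "(40 * real m) ^ m * r ^ m * 2 powr of_int (int_decode i) \<le> (40 * real m) ^ m * ?\<delta> ^ m * 2 powr of_int (int_decode i)"
            by (intro mult_right_mono mult_left_mono) auto
          moreover have "(2 * \<rho>) ^ m = (40 * real m) ^ m * r ^ m" 
          proof -
            have "2 * \<rho> = 40 * real m * r" unfolding rm[symmetric] by simp
            then show ?thesis by (simp only: power_mult_distrib)
          qed
          ultimately have "(2 * \<rho>) ^ m * 2 powr of_int (int_decode i) \<le> (40 * real m) ^ m * (2 powr of_int (int_decode i) * ?\<delta> ^ m)"
            by (simp add: mult.assoc mult.commute mult.left_commute)
          then show ?thesis using True \<rho> by (simp add: ennreal_leI flip: ennreal_mult')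
        qed simp
      qed auto
    qed auto
    also have "\<dots> = ennreal (2 * real m ^ CARD('n) * (40 * real m) ^ m) * (ennreal V * S)"
    proof -
      have "ennreal (2 * real m ^ CARD('n) * (40 * real m) ^ m) = 2 * ennreal (real m ^ CARD('n)) * ennreal ((40 * real m) ^ m)"
        by (simp add: ennreal_mult)
      then show ?thesis by (simp only: ac_simps)
    qed
    finally show "0 + Y k \<le> ennreal (2 * real m ^ CARD('n) * (40 * real m) ^ m) * (ennreal V * S)" by simp
  qed auto
  also have "\<dots> = (\<Sum>k\<in>{1..m}. ennreal (real (m choose k))) * (ennreal (2 * real m ^ CARD('n) * (40 * real m) ^ m) * (ennreal V * S)) + ennreal K * (2 * ennreal V * S)"
    by (simp only: sum_distrib_right)
  also have "\<dots> \<le> ennreal (2 ^ m) * (ennreal (2 * real m ^ CARD('n) * (40 * real m) ^ m) * (ennreal V * S)) + ennreal K * (2 * ennreal V * S)"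
  proof (intro add_right_mono mult_right_mono)
    have "(\<Sum>k\<in>{1..m}. real (m choose k)) \<le> (\<Sum>k\<le>m. real (m choose k))" by (intro sum_mono2) auto
    also have "\<dots> = 2 ^ m" using choose_row_sum[of m] by (simp flip: of_nat_sum)
    finally show "(\<Sum>k\<in>{1..m}. ennreal (real (m choose k))) \<le> ennreal (2 ^ m)" by (simp add: ennreal_leI)
  qed auto
  also have "\<dots> = ennreal V * (ennreal (2 ^ m * (2 * real m ^ CARD('n) * (40 * real m) ^ m) + 2 * K) * S)"
  proof -
    have "ennreal (2 ^ m * (2 * real m ^ CARD('n) * (40 * real m) ^ m) + 2 * K) =
       ennreal (2 ^ m) * ennreal (2 * real m ^ CARD('n) * (40 * real m) ^ m) + 2 * ennreal K"
      by (simp add: ennreal_plus ennreal_mult K_def)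
    then show ?thesis by (simp only: distrib_left distrib_right) (simp only: ac_simps)
  qed
  finally show ?thesis
    using V0 unfolding S_def K_def by (subst (asm) ennreal_mult_le_mult_iff) auto
qed

text \<open>Only finitely many derivatives are involved, so for each \<open>n\<close> one index
  serves them all. The indices need not increase, since the geometric rate itself implies
  convergence. Summable rates are what yields one majorant for the whole sequence.\<close>

lemma sobolev_approx_fast:
  fixes \<Omega> :: "(real ^ 'n::finite) set"
  assumes "sobolev_approx \<Omega> m p s u W \<phi>"
  obtains \<psi> where "sobolev_approx \<Omega> m p s u W \<psi>"
    "\<And>is n. length is \<le> m \<Longrightarrow>
      weighted_nn_integral \<Omega> p s (\<lambda>x. W is x - pderivs (rev is) (\<psi> n) x) \<le> ennreal ((1 / 2) ^ n)"
proof -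
  have "\<exists>j. \<forall>is\<in>{is. length is \<le> m}. weighted_nn_integral \<Omega> p s (\<lambda>x. W is x - pderivs (rev is) (\<phi> j) x) < ennreal ((1 / 2) ^ n)" for n
  proof -
    have "\<forall>\<^sub>F j in sequentially. \<forall>is\<in>{is. length is \<le> m}. weighted_nn_integral \<Omega> p s (\<lambda>x. W is x - pderivs (rev is) (\<phi> j) x) < ennreal ((1 / 2) ^ n)"
    proof (subst eventually_ball_finite_distrib[OF finite_lists_of_length_le], intro ballI)
      fix "is" :: "'n list" assume "is \<in> {is. length is \<le> m}"
      then show "\<forall>\<^sub>F j in sequentially. weighted_nn_integral \<Omega> p s (\<lambda>x. W is x - pderivs (rev is) (\<phi> j) x) < ennreal ((1 / 2) ^ n)"
        by (intro order_tendstoD(2)[OF sobolev_approxD(3)[OF assms]]) auto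
    qed
    then show ?thesis using eventually_happens trivial_limit_sequentially by blast
  qed
  then obtain \<sigma> where \<sigma>: "\<And>n. \<forall>is\<in>{is. length is \<le> m}. weighted_nn_integral \<Omega> p s (\<lambda>x. W is x - pderivs (rev is) (\<phi> (\<sigma> n)) x) < ennreal ((1 / 2) ^ n)"
    by metis
  have fast: "weighted_nn_integral \<Omega> p s (\<lambda>x. W is x - pderivs (rev is) (\<phi> (\<sigma> n)) x) \<le> ennreal ((1 / 2) ^ n)"
    if "length is \<le> m" for "is" n
    using \<sigma>[of n] that by (auto intro: less_imp_le)
  have "(\<lambda>n. ennreal ((1 / 2) ^ n)) \<longlonglongrightarrow> ennreal 0"
    by (intro tendsto_ennrealI LIMSEQ_power_zero) simp
  then have "(\<lambda>n. ennreal ((1 / 2) ^ n)) \<longlonglongrightarrow> 0" by simp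
  then have "(\<lambda>n. weighted_nn_integral \<Omega> p s (\<lambda>x. W is x - pderivs (rev is) (\<phi> (\<sigma> n)) x)) \<longlonglongrightarrow> 0"
    if "length is \<le> m" for "is"
    by (rule ennreal_tendsto_0_le[OF _ fast[OF that]])
  then have "sobolev_approx \<Omega> m p s u W (\<lambda>n. \<phi> (\<sigma> n))"
    using assms by (simp add: sobolev_approx_def)
  from that[OF this fast] show ?thesis .
qed

lemma lebesgue_on_ex_borel:
  fixes f :: "real ^ 'n::finite \<Rightarrow> real"
  assumes "f \<in> borel_measurable (lebesgue_on \<Omega>)" "open \<Omega>"
  obtains f' where "f' \<in> borel_measurable borel" "AE x in lebesgue_on \<Omega>. f' x = f x"
proof -
  have "(\<lambda>x. indicator \<Omega> x *\<^sub>R f x) \<in> borel_measurable lebesgue"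
    using assms by (subst (asm) borel_measurable_restrict_space_iff) auto
  then obtain f' where f': "f' \<in> borel_measurable lborel" "AE x in lborel. indicator \<Omega> x *\<^sub>R f x = f' x"
    using completion_ex_borel_measurable_real by blast
  have "AE x in lebesgue. indicator \<Omega> x *\<^sub>R f x = f' x" by (rule AE_completion[OF f'(2)])
  then have "AE x in lebesgue_on \<Omega>. f' x = f x"
    using assms(2) by (subst AE_restrict_space_iff) (auto elim!: eventually_mono)
  with f'(1) show ?thesis using that by simp
qed

text \<open>\<open>g\<close> adds three pieces: the weak derivatives of order \<open>m\<close>, a
  common bound for the errors of all approximants, and \<open>\<bar>u\<bar>\<close> divided by the
  \<open>m\<close>-th power of the capped distance. The first two dominate the derivatives of every
  approximant, the third encodes the integral condition.\<close>

lemma ex_control_function: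
  fixes \<Omega> :: "(real ^ 'n::finite) set"
  assumes \<Omega>: "open \<Omega>" "\<Omega> \<noteq> UNIV" and p: "1 \<le> p"
    and u: "u \<in> weighted_Sobolev0 \<Omega> m p s"
    and hardy: "(\<integral>\<^sup>+ x. ennreal (\<bar>u x\<bar> powr p * bdist \<Omega> x powr (- real m * p + s)) \<partial>lebesgue_on \<Omega>) < \<infinity>"
  obtains \<phi> W g where "sobolev_approx \<Omega> m p s u W \<phi>"
    "AE x in lebesgue_on \<Omega>. (\<lambda>j. \<phi> j x) \<longlonglongrightarrow> u x"
    "g \<in> borel_measurable borel" "\<And>x. 0 \<le> g x" "weighted_nn_integral \<Omega> p s g < \<infinity>"
    "\<And>j. AE x in lebesgue_on \<Omega>. deriv_abs_sum m (\<phi> j) x \<le> g x"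
    "AE x in lebesgue_on \<Omega>. \<bar>u x\<bar> \<le> min 1 (bdist \<Omega> x) ^ m * g x"
proof -
  have p0: "0 < p" using p by simp
  obtain W \<phi>0 where "sobolev_approx \<Omega> m p s u W \<phi>0" using weighted_Sobolev0E[OF \<Omega> p u] by blast
  then obtain \<phi> where A: "sobolev_approx \<Omega> m p s u W \<phi>"
    and fast: "\<And>is n. length is \<le> m \<Longrightarrow>
      weighted_nn_integral \<Omega> p s (\<lambda>x. W is x - pderivs (rev is) (\<phi> n) x) \<le> ennreal ((1 / 2) ^ n)"
    using sobolev_approx_fast by blast
  note W = sobolev_approxD(1)[OF A] and WLp = sobolev_approxD(2)[OF A] and \<phi> = sobolev_approxD(4)[OF A]
  define D where "D j is x = W is x - pderivs (rev is) (\<phi> j) x" for j "is" x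
  have inO: "AE x in lebesgue_on \<Omega>. x \<in> \<Omega>" by (intro AE_I2) (simp add: space_restrict_space)
  have WM: "W is \<in> borel_measurable (lebesgue_on \<Omega>)" if "length is \<le> m" for "is"
    using WLp[OF that] by (simp add: weighted_Lp_iff)
  have DM: "D j is \<in> borel_measurable (lebesgue_on \<Omega>)" if "length is \<le> m" for j "is"
    unfolding D_def[abs_def]
    by (intro borel_measurable_diff WM that borel_measurable_lebesgue_onI smooth_borel_measurable smooth_pderivs test_functionsD(1)[OF \<phi>])
  \<comment> \<open>Collects the \<open>p\<close>-th powers of all errors of the whole sequence: the
    geometric rates make it integrable against the weight, it dominates each single error, and where
    it is finite the errors tend to 0 pointwise.\<close>
  define H where "H x = (\<Sum>n. \<Sum>is | length is \<le> m. ennreal (\<bar>D n is x\<bar> powr p))" for x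
  have termM: "(\<lambda>x. \<Sum>is | length is \<le> m. ennreal (\<bar>D n is x\<bar> powr p)) \<in> borel_measurable (lebesgue_on \<Omega>)" for n
  proof (intro borel_measurable_sum)
    fix "is" :: "'n list" assume "is \<in> {is. length is \<le> m}"
    then have [measurable]: "D n is \<in> borel_measurable (lebesgue_on \<Omega>)" using DM by simp
    show "(\<lambda>x. ennreal (\<bar>D n is x\<bar> powr p)) \<in> borel_measurable (lebesgue_on \<Omega>)" by measurable
  qed
  have HM [measurable]: "H \<in> borel_measurable (lebesgue_on \<Omega>)"
    unfolding H_def[abs_def] using termM by (intro borel_measurable_suminf_order)
  have Hint: "(\<integral>\<^sup>+ x. H x * ennreal (bdist \<Omega> x powr s) \<partial>lebesgue_on \<Omega>) < \<infinity>"
  proof -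
    let ?c = "real (card {is :: 'n list. length is \<le> m})"
    have "(\<integral>\<^sup>+ x. H x * ennreal (bdist \<Omega> x powr s) \<partial>lebesgue_on \<Omega>) =
      (\<integral>\<^sup>+ x. (\<Sum>n. (\<Sum>is | length is \<le> m. ennreal (\<bar>D n is x\<bar> powr p)) * ennreal (bdist \<Omega> x powr s)) \<partial>lebesgue_on \<Omega>)"
      unfolding H_def by (simp only: ennreal_suminf_multc)
    also have "\<dots> = (\<Sum>n. \<integral>\<^sup>+ x. (\<Sum>is | length is \<le> m. ennreal (\<bar>D n is x\<bar> powr p)) * ennreal (bdist \<Omega> x powr s) \<partial>lebesgue_on \<Omega>)"
    proof (intro nn_integral_suminf)
      show "(\<lambda>x. (\<Sum>is | length is \<le> m. ennreal (\<bar>D n is x\<bar> powr p)) * ennreal (bdist \<Omega> x powr s)) \<in> borel_measurable (lebesgue_on \<Omega>)" for n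
        using termM[of n] by measurable
    qed
    also have "\<dots> = (\<Sum>n. \<Sum>is | length is \<le> m. weighted_nn_integral \<Omega> p s (D n is))"
    proof (intro suminf_cong)
      fix n
      have "(\<integral>\<^sup>+ x. (\<Sum>is | length is \<le> m. ennreal (\<bar>D n is x\<bar> powr p)) * ennreal (bdist \<Omega> x powr s) \<partial>lebesgue_on \<Omega>) =
        (\<integral>\<^sup>+ x. (\<Sum>is | length is \<le> m. ennreal (\<bar>D n is x\<bar> powr p * bdist \<Omega> x powr s)) \<partial>lebesgue_on \<Omega>)"
        by (simp only: sum_distrib_right ennreal_mult' powr_ge_zero)
      also have "\<dots> = (\<Sum>is | length is \<le> m. weighted_nn_integral \<Omega> p s (D n is))"
        unfolding weighted_nn_integral_def
      proof (intro nn_integral_sum)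
        fix "is" :: "'n list" assume "is \<in> {is. length is \<le> m}"
        then have [measurable]: "D n is \<in> borel_measurable (lebesgue_on \<Omega>)" using DM by simp
        show "(\<lambda>x. ennreal (\<bar>D n is x\<bar> powr p * bdist \<Omega> x powr s)) \<in> borel_measurable (lebesgue_on \<Omega>)" by measurable
      qed
      finally show "(\<integral>\<^sup>+ x. (\<Sum>is | length is \<le> m. ennreal (\<bar>D n is x\<bar> powr p)) * ennreal (bdist \<Omega> x powr s) \<partial>lebesgue_on \<Omega>) =
        (\<Sum>is | length is \<le> m. weighted_nn_integral \<Omega> p s (D n is))" .
    qed
    also have "\<dots> \<le> (\<Sum>n. ennreal (?c * (1 / 2) ^ n))"
    proof (intro suminf_le)
      fix n
      have "(\<Sum>is | length is \<le> m. weighted_nn_integral \<Omega> p s (D n is)) \<le> (\<Sum>is :: 'n list | length is \<le> m. ennreal ((1 / 2) ^ n))"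
        using fast unfolding D_def[abs_def] by (intro sum_mono) simp
      also have "\<dots> = ennreal (?c * (1 / 2) ^ n)"
        by (simp only: sum_constant ennreal_mult' ennreal_of_nat_eq_real_of_nat of_nat_0_le_iff)
      finally show "(\<Sum>is | length is \<le> m. weighted_nn_integral \<Omega> p s (D n is)) \<le> ennreal (?c * (1 / 2) ^ n)" .
    qed auto
    also have "\<dots> = ennreal (\<Sum>n. ?c * (1 / 2) ^ n)"
      by (intro suminf_ennreal2 summable_mult summable_geometric) auto
    also have "\<dots> < \<infinity>" by simp
    finally show ?thesis .
  qed
  have AEH: "AE x in lebesgue_on \<Omega>. H x < \<infinity>"
  proof -
    have "AE x in lebesgue_on \<Omega>. H x * ennreal (bdist \<Omega> x powr s) \<noteq> \<infinity>"
      using Hint by (intro nn_integral_PInf_AE) auto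
    with inO show ?thesis
    proof eventually_elim
      case (elim x)
      have "bdist \<Omega> x powr s > 0" using bdist_pos[OF \<Omega> elim(1)] by simp
      then have "ennreal (bdist \<Omega> x powr s) \<noteq> 0" by simp
      then show ?case using elim(2) by (cases "H x = top") (auto simp: ennreal_top_mult less_top)
    qed
  qed
  have DH: "ennreal (\<bar>D n is x\<bar> powr p) \<le> (\<Sum>is | length is \<le> m. ennreal (\<bar>D n is x\<bar> powr p))"
    if "length is \<le> m" for n "is" x
    using that by (intro member_le_sum[where f="\<lambda>is. ennreal (\<bar>D n is x\<bar> powr p)"]) (auto simp: finite_lists_of_length_le)
  define \<rho> where "\<rho> x = min 1 (bdist \<Omega> x)" for x
  define g1 where "g1 x = (\<Sum>is | length is = m. \<bar>W is x\<bar>)" for x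
  define g2 where "g2 x = enn2real (H x) powr (1 / p)" for x
  define g3 where "g3 x = \<bar>u x\<bar> / \<rho> x ^ m" for x
  define c where "c = real (card {is :: 'n list. length is = m})"
  have uW: "AE x in lebesgue_on \<Omega>. W [] x = u x" using W[of "[]"] by (intro has_weak_deriv_Nil_AE_eq \<Omega>) simp
  have uM [measurable]: "u \<in> borel_measurable (lebesgue_on \<Omega>)"
    using W[of "[]"] \<Omega>(1) by (intro locally_integrable_measurable) (auto simp: has_weak_deriv_def)
  have \<rho>M [measurable]: "\<rho> \<in> borel_measurable (lebesgue_on \<Omega>)" unfolding \<rho>_def[abs_def] by measurable
  have g1Lp: "g1 \<in> weighted_Lp \<Omega> p s"
    unfolding weighted_Lp_iff
  proof
    show "g1 \<in> borel_measurable (lebesgue_on \<Omega>)"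
      unfolding g1_def[abs_def] using WM by (intro borel_measurable_sum borel_measurable_abs) auto
    have "weighted_nn_integral \<Omega> p s g1 \<le> ennreal (real (card {is :: 'n list. length is = m}) powr p) * (\<Sum>is | length is = m. weighted_nn_integral \<Omega> p s (W is))"
      unfolding g1_def using WM p0 by (intro weighted_nn_integral_sum finite_lists_length) auto
    also have "\<dots> < \<infinity>"
      using WLp by (auto simp: ennreal_mult_less_top weighted_Lp_iff less_top finite_lists_length)
    finally show "weighted_nn_integral \<Omega> p s g1 < \<infinity>" .
  qed
  have g2Lp: "g2 \<in> weighted_Lp \<Omega> p s"
    unfolding weighted_Lp_iff
  proof
    show "g2 \<in> borel_measurable (lebesgue_on \<Omega>)" unfolding g2_def[abs_def] by measurable
    have "weighted_nn_integral \<Omega> p s g2 \<le> (\<integral>\<^sup>+ x. H x * ennreal (bdist \<Omega> x powr s) \<partial>lebesgue_on \<Omega>)"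
      unfolding weighted_nn_integral_def
    proof (intro nn_integral_mono)
      fix x
      have "\<bar>g2 x\<bar> powr p = enn2real (H x)" using p0 by (simp add: g2_def powr_powr)
      then have "ennreal (\<bar>g2 x\<bar> powr p * bdist \<Omega> x powr s) = ennreal (enn2real (H x)) * ennreal (bdist \<Omega> x powr s)"
        by (simp add: ennreal_mult')
      also have "\<dots> \<le> H x * ennreal (bdist \<Omega> x powr s)" by (intro mult_right_mono) (auto simp: ennreal_enn2real_if)
      finally show "ennreal (\<bar>g2 x\<bar> powr p * bdist \<Omega> x powr s) \<le> H x * ennreal (bdist \<Omega> x powr s)" .
    qed
    then show "weighted_nn_integral \<Omega> p s g2 < \<infinity>" using Hint by (rule le_less_trans)
  qed
  have g3Lp: "g3 \<in> weighted_Lp \<Omega> p s"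
    unfolding weighted_Lp_iff
  proof
    show "g3 \<in> borel_measurable (lebesgue_on \<Omega>)" unfolding g3_def[abs_def] by measurable
    have "weighted_nn_integral \<Omega> p s g3 \<le> (\<integral>\<^sup>+ x. ennreal (\<bar>u x\<bar> powr p * bdist \<Omega> x powr s) + ennreal (\<bar>u x\<bar> powr p * bdist \<Omega> x powr (- real m * p + s)) \<partial>lebesgue_on \<Omega>)"
      unfolding weighted_nn_integral_def
    proof (rule nn_integral_mono)
      fix x assume "x \<in> space (lebesgue_on \<Omega>)"
      then have x: "x \<in> \<Omega>" by (simp add: space_restrict_space)
      note d = bdist_pos[OF \<Omega> x]
      have "\<bar>g3 x\<bar> powr p * bdist \<Omega> x powr s \<le> \<bar>u x\<bar> powr p * bdist \<Omega> x powr s + \<bar>u x\<bar> powr p * bdist \<Omega> x powr (- real m * p + s)"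
      \<comment> \<open>Within distance 1 of the boundary \<open>\<rho>\<close> is the distance
        itself and the integral condition applies; elsewhere \<open>\<rho> = 1\<close> and the
        weighted norm of \<open>u\<close> suffices.\<close>
      proof (cases "bdist \<Omega> x \<le> 1")
        case True
        have "(bdist \<Omega> x ^ m) powr p = bdist \<Omega> x powr (real m * p)"
          using d by (simp add: powr_powr flip: powr_realpow)
        moreover have "\<bar>g3 x\<bar> = \<bar>u x\<bar> / bdist \<Omega> x ^ m"
          using d True by (simp add: g3_def \<rho>_def)
        ultimately have "\<bar>g3 x\<bar> powr p = \<bar>u x\<bar> powr p * bdist \<Omega> x powr (- real m * p)"
          using d powr_minus_divide[of "bdist \<Omega> x" "real m * p"] by (simp add: powr_divide)
        then have "\<bar>g3 x\<bar> powr p * bdist \<Omega> x powr s = \<bar>u x\<bar> powr p * bdist \<Omega> x powr (- real m * p + s)"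
          by (simp only: powr_add mult.assoc)
        then show ?thesis by simp
      qed (simp add: g3_def \<rho>_def)
      then show "ennreal (\<bar>g3 x\<bar> powr p * bdist \<Omega> x powr s) \<le> ennreal (\<bar>u x\<bar> powr p * bdist \<Omega> x powr s) + ennreal (\<bar>u x\<bar> powr p * bdist \<Omega> x powr (- real m * p + s))"
        by (simp add: ennreal_leI flip: ennreal_plus)
    qed
    also have "\<dots> = weighted_nn_integral \<Omega> p s u + (\<integral>\<^sup>+ x. ennreal (\<bar>u x\<bar> powr p * bdist \<Omega> x powr (- real m * p + s)) \<partial>lebesgue_on \<Omega>)"
      unfolding weighted_nn_integral_def by (rule nn_integral_add) measurable
    also have "weighted_nn_integral \<Omega> p s u = weighted_nn_integral \<Omega> p s (W [])"
      by (rule weighted_nn_integral_cong_AE[symmetric, OF uW])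
    also have "weighted_nn_integral \<Omega> p s (W []) + (\<integral>\<^sup>+ x. ennreal (\<bar>u x\<bar> powr p * bdist \<Omega> x powr (- real m * p + s)) \<partial>lebesgue_on \<Omega>) < \<infinity>"
      using hardy WLp[of "[]"] by (simp add: weighted_Lp_iff)
    finally show "weighted_nn_integral \<Omega> p s g3 < \<infinity>" .
  qed
  \<comment> \<open>The factors 1 fit the form of \<open>weighted_Lp_lincomb\<close>;
    \<open>c\<close> counts the derivatives of order \<open>m\<close>, each of which brings one
    error bounded by \<open>g2\<close>.\<close>
  define g0 where "g0 x = 1 * (1 * g1 x + c * g2 x) + 1 * g3 x" for x
  have g0Lp: "g0 \<in> weighted_Lp \<Omega> p s"
    unfolding g0_def[abs_def] by (intro weighted_Lp_lincomb g1Lp g2Lp g3Lp p0)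
  have nn: "0 \<le> g1 x" "0 \<le> g2 x" "0 \<le> c" for x by (auto simp: g1_def g2_def c_def sum_nonneg)
  have "g0 \<in> borel_measurable (lebesgue_on \<Omega>)" using g0Lp by (simp add: weighted_Lp_iff)
  then obtain g' where g': "g' \<in> borel_measurable borel" "AE x in lebesgue_on \<Omega>. g' x = g0 x"
    using lebesgue_on_ex_borel[OF _ \<Omega>(1)] by blast
  \<comment> \<open>A Borel representative, made nonnegative everywhere, since
    \<open>abs_le_level_sum\<close> asks for both without an exceptional set.\<close>
  define g where "g x = max 0 (g' x)" for x
  have g03: "0 \<le> g3 x" "0 \<le> g0 x" if "x \<in> \<Omega>" for x
  proof -
    show "0 \<le> g3 x" using bdist_pos[OF \<Omega> that] by (simp add: g3_def \<rho>_def)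
    then show "0 \<le> g0 x" using nn by (simp add: g0_def)
  qed
  have gg0: "AE x in lebesgue_on \<Omega>. g x = g0 x"
    using g'(2) inO by eventually_elim (use g03 in \<open>auto simp: g_def\<close>)
  have lim: "AE x in lebesgue_on \<Omega>. (\<lambda>j. \<phi> j x) \<longlonglongrightarrow> u x"
    using AEH uW
  proof eventually_elim
    case (elim x)
    have "(\<Sum>n. ennreal (\<bar>D n [] x\<bar> powr p)) \<le> H x"
      unfolding H_def by (intro suminf_le DH) auto
    then have "(\<Sum>n. ennreal (\<bar>D n [] x\<bar> powr p)) \<noteq> top" using elim(1) by (auto simp: less_top dest: le_less_trans)
    then have "summable (\<lambda>n. \<bar>D n [] x\<bar> powr p)" by (intro summable_suminf_not_top) auto
    then have "(\<lambda>n. \<bar>D n [] x\<bar> powr p) \<longlonglongrightarrow> 0" by (rule summable_LIMSEQ_zero)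
    then have "(\<lambda>n. (\<bar>D n [] x\<bar> powr p) powr (1 / p)) \<longlonglongrightarrow> 0"
      using p0 by (intro tendsto_zero_powrI[where f="\<lambda>n. \<bar>D n [] x\<bar> powr p" and g="\<lambda>_. 1 / p" and b="1 / p"]) auto
    then have "(\<lambda>n. \<bar>D n [] x\<bar>) \<longlonglongrightarrow> 0" using p0 by (simp add: powr_powr)
    then have "(\<lambda>n. W [] x - D n [] x) \<longlonglongrightarrow> W [] x - 0"
      by (intro tendsto_diff tendsto_const) (simp add: tendsto_rabs_zero_iff)
    then show ?case by (simp add: D_def elim(2))
  qed
  have der: "AE x in lebesgue_on \<Omega>. deriv_abs_sum m (\<phi> j) x \<le> g x" for j
    using AEH gg0 inO
  proof eventually_elim
    case (elim x)
    have le: "\<bar>pderivs (rev is) (\<phi> j) x\<bar> \<le> \<bar>W is x\<bar> + g2 x" if l: "length is = m" for "is"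
    proof -
      have "ennreal (\<bar>D j is x\<bar> powr p) \<le> H x"
        unfolding H_def using l DH[of "is" j x]
          ennreal_le_suminf[of "\<lambda>n. \<Sum>is | length is \<le> m. ennreal (\<bar>D n is x\<bar> powr p)" j]
        by (simp del: sum_ennreal)
      then have "\<bar>D j is x\<bar> powr p \<le> enn2real (H x)" using elim(1) by (cases "H x" rule: ennreal_cases) auto
      then have "(\<bar>D j is x\<bar> powr p) powr (1 / p) \<le> g2 x" unfolding g2_def using p0 by (intro powr_mono2) auto
      then have "\<bar>D j is x\<bar> \<le> g2 x" using p0 by (simp add: powr_powr)
      then show ?thesis by (simp add: D_def)
    qed
    \<comment> \<open>Reversal permutes the lists of length \<open>m\<close>, so the order of the
      directions disappears in the sum.\<close>
    have "deriv_abs_sum m (\<phi> j) x = (\<Sum>is | length is = m. \<bar>pderivs (rev is) (\<phi> j) x\<bar>)"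
      unfolding deriv_abs_sum_def by (rule sum.reindex_bij_witness[where i=rev and j=rev]) auto
    also have "\<dots> \<le> (\<Sum>is | length is = m. \<bar>W is x\<bar> + g2 x)" using le by (intro sum_mono) auto
    also have "\<dots> = g1 x + c * g2 x" by (simp add: sum.distrib g1_def c_def)
    also have "\<dots> \<le> g0 x" using g03(1)[OF elim(3)] by (simp add: g0_def)
    finally show ?case using elim(2) by simp
  qed
  have ub: "AE x in lebesgue_on \<Omega>. \<bar>u x\<bar> \<le> min 1 (bdist \<Omega> x) ^ m * g x"
    using gg0 inO
  proof eventually_elim
    case (elim x)
    have \<rho>: "0 < \<rho> x" using bdist_pos[OF \<Omega> elim(2)] by (simp add: \<rho>_def)
    then have "\<bar>u x\<bar> = \<rho> x ^ m * g3 x" by (simp add: g3_def)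
    also have "\<dots> \<le> \<rho> x ^ m * g x" using elim(1) nn \<rho> by (intro mult_left_mono) (auto simp: g0_def)
    finally show ?case by (simp add: \<rho>_def)
  qed
  have gfin: "weighted_nn_integral \<Omega> p s g < \<infinity>"
    using weighted_nn_integral_cong_AE[OF gg0, of p s] g0Lp by (simp add: weighted_Lp_iff)
  have gM: "g \<in> borel_measurable borel" unfolding g_def[abs_def] using g'(1) by measurable
  have g0': "0 \<le> g x" for x by (simp add: g_def)
  show ?thesis by (rule that[OF A lim gM g0' gfin der ub])
qed

theorem theorem6p22:
  fixes \<Omega> :: "(real ^ 'n::finite) set"
    and m :: nat and p s :: real
    and u :: "real ^ 'n \<Rightarrow> real"
  assumes "0 < m" and "1 < p"
    and "open \<Omega>" and "- \<Omega> \<noteq> {}"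
    and "u \<in> weighted_Sobolev0 \<Omega> m p s"
    and "(\<integral>\<^sup>+ x. ennreal (\<bar>u x\<bar> powr p * bdist \<Omega> x powr (- real m * p + s)) \<partial>lebesgue_on \<Omega>) < \<infinity>"
  shows "\<exists>u1 \<in> weighted_Sobolev0_plus \<Omega> m p s. \<exists>u2 \<in> weighted_Sobolev0_plus \<Omega> m p s.
           AE x in lebesgue_on \<Omega>. u x = u1 x - u2 x"
proof -
  have \<Omega>: "open \<Omega>" "\<Omega> \<noteq> UNIV" and p: "1 \<le> p" using assms by auto
  obtain \<phi> W g where A: "sobolev_approx \<Omega> m p s u W \<phi>"
    and lim: "AE x in lebesgue_on \<Omega>. (\<lambda>j. \<phi> j x) \<longlonglongrightarrow> u x"
    and g: "g \<in> borel_measurable borel" "\<And>x. 0 \<le> g x" and gfin: "weighted_nn_integral \<Omega> p s g < \<infinity>"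
    and der: "\<And>j. AE x in lebesgue_on \<Omega>. deriv_abs_sum m (\<phi> j) x \<le> g x"
    and ug: "AE x in lebesgue_on \<Omega>. \<bar>u x\<bar> \<le> min 1 (bdist \<Omega> x) ^ m * g x"
  proof (rule ex_control_function[OF \<Omega> p assms(5,6)])
  qed (rule that; assumption)
  note \<phi> = test_functionsD(1)[OF sobolev_approxD(4)[OF A]]
  have W0: "has_weak_deriv \<Omega> [] u (W [])" using sobolev_approxD(1)[OF A, of "[]"] by simp
  have uM: "u \<in> borel_measurable (lebesgue_on \<Omega>)"
    using W0 \<Omega>(1) by (intro locally_integrable_measurable) (auto simp: has_weak_deriv_def)
  \<comment> \<open>The pointwise estimate is stated for Borel functions, so \<open>u\<close> is
    replaced by a version that agrees with it almost everywhere on \<open>\<Omega>\<close>.\<close>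
  obtain U where U: "U \<in> borel_measurable borel" "AE x in lebesgue_on \<Omega>. U x = u x"
    using lebesgue_on_ex_borel[OF uM \<Omega>(1)] by blast
  have limU: "AE x in lebesgue_on \<Omega>. (\<lambda>j. \<phi> j x) \<longlonglongrightarrow> U x"
    using lim U(2) by eventually_elim simp
  have Ug: "AE x in lebesgue_on \<Omega>. \<bar>U x\<bar> \<le> min 1 (bdist \<Omega> x) ^ m * g x"
    using ug U(2) by eventually_elim simp
  have gfin': "(\<integral>\<^sup>+ x. ennreal (\<bar>g x\<bar> powr p * bdist \<Omega> x powr s) * indicator \<Omega> x \<partial>lborel) < \<infinity>"
  proof -
    have [measurable]: "g \<in> borel_measurable borel" "bdist \<Omega> \<in> borel_measurable borel"
      by (rule g) (rule bdist_measurable)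
    have "(\<lambda>x. ennreal (\<bar>g x\<bar> powr p * bdist \<Omega> x powr s)) \<in> borel_measurable borel" by measurable
    from nn_integral_lebesgue_on_eq_lborel[OF this \<Omega>(1)] show ?thesis
      using gfin by (simp add: weighted_nn_integral_def)
  qed
  have conv: "(\<lambda>j. weighted_nn_integral \<Omega> p s (\<lambda>x. \<phi> j x - U x)) \<longlonglongrightarrow> 0"
  proof -
    have "weighted_nn_integral \<Omega> p s (\<lambda>x. \<phi> j x - U x) = weighted_nn_integral \<Omega> p s (\<lambda>x. W [] x - pderivs (rev []) (\<phi> j) x)" for j
      unfolding weighted_nn_integral_def using U(2) has_weak_deriv_Nil_AE_eq[OF \<Omega>(1) W0]
      by (intro nn_integral_cong_AE, eventually_elim) (simp add: abs_minus_commute)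
    then show ?thesis using sobolev_approxD(3)[OF A, of "[]"] by simp
  qed
  have L1: "(\<lambda>j. \<integral>\<^sup>+ y. ennreal \<bar>\<phi> j y - U y\<bar> * indicator (ball x R) y \<partial>lborel) \<longlonglongrightarrow> 0"
    if "cball x R \<subseteq> \<Omega>" for x R
    by (rule local_L1_tendsto_0[OF \<Omega> p _ that conv])
      (intro borel_measurable_diff smooth_borel_measurable \<phi> U)
  define C where "C = 2 ^ m * (2 * real m ^ CARD('n) * (40 * real m) ^ m) + 2 * (2 ^ m * real m ^ (m - 1))"
  have C: "0 \<le> C" by (simp add: C_def)
  obtain w where w: "w \<in> weighted_Sobolev0 \<Omega> m p s" "AE x in lebesgue_on \<Omega>. 0 \<le> w x"
    and Sw: "AE x in lebesgue_on \<Omega>. level_sum \<Omega> g m x \<le> ennreal (w x)"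
  proof (rule maximal_majorant[OF \<Omega> assms(2,1) g(1) gfin'])
  qed (rule that; assumption)
  have inO: "AE x in lebesgue_on \<Omega>. x \<in> \<Omega>" by (intro AE_I2) (simp add: space_restrict_space)
  have dom: "AE x in lebesgue_on \<Omega>. \<bar>u x\<bar> \<le> C * w x"
    using limU Sw w(2) U(2) inO
  proof eventually_elim
    case (elim x)
    have "ennreal \<bar>U x\<bar> \<le> ennreal C * level_sum \<Omega> g m x"
      unfolding C_def by (rule abs_le_level_sum[OF \<Omega> \<phi> assms(1) elim(5) g der U(1) Ug elim(1) L1])
    also have "\<dots> \<le> ennreal C * ennreal (w x)" using elim(2) by (intro mult_left_mono) auto
    also have "\<dots> = ennreal (C * w x)" using C by (simp add: ennreal_mult')
    finally show ?case using C elim(3,4) by (simp add: ennreal_le_iff)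
  qed
  \<comment> \<open>\<open>u1\<close> is \<open>C * w\<close> and \<open>u2\<close> is
    \<open>C * w - u\<close>; the vanishing summand brings \<open>u1\<close> into the form of
    \<open>weighted_Sobolev0_lincomb\<close>. Both are nonnegative because
    \<open>\<bar>u\<bar> \<le> C * w\<close> almost everywhere.\<close>
  define u1 where "u1 x = C * w x + 0 * u x" for x
  define u2 where "u2 x = C * w x + (- 1) * u x" for x
  have "u1 \<in> weighted_Sobolev0 \<Omega> m p s" "u2 \<in> weighted_Sobolev0 \<Omega> m p s"
    unfolding u1_def[abs_def] u2_def[abs_def] by (intro weighted_Sobolev0_lincomb \<Omega> p w assms(5))+
  moreover have "AE x in lebesgue_on \<Omega>. 0 \<le> u1 x" "AE x in lebesgue_on \<Omega>. 0 \<le> u2 x"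
    using dom by (eventually_elim, auto simp: u1_def u2_def)+
  ultimately have "u1 \<in> weighted_Sobolev0_plus \<Omega> m p s" "u2 \<in> weighted_Sobolev0_plus \<Omega> m p s"
    by (simp_all add: weighted_Sobolev0_plus_def)
  moreover have "AE x in lebesgue_on \<Omega>. u x = u1 x - u2 x" by (simp add: u1_def u2_def)
  ultimately show ?thesis by blast
qed

end
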